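(* Let $A_{-1}\in\mathbb{R}^{n\times n}$, $C\in\mathbb{R}^{p\times n}$, let $A_2,A_3$ be $n\times n$ matrix functions with entries in $L_2(-1,0)$, and let $T>0$. Consider the neutral type system $$\dot z(t)=A_{-1}\dot z(t-1)+\int_{-1}^0\left[A_2(\theta)\dot z(t+\theta)+A_3(\theta)z(t+\theta)\right]\mathrm{d}\theta \qquad (\Sigma)$$ with generator $\mathcal{A}$ in $M_2=\mathbb{R}^n\times L_2(-1,0;\mathbb{R}^n)$, and the transposed (adjoint) controlled system $$\dot z(t)=A_{-1}^*\dot z(t-1)+\int_{-1}^0\left[A_2^*(\theta)\dot z(t+\theta)+A_3^*(\theta)z(t+\theta)\right]\mathrm{d}\theta+C^*u(t)\qquad(\Sigma^\dagger)$$ with generator $\mathcal{A}^\dagger$ (both generators are defined in the context). 1. The system $(\Sigma)$ with the output $y(t)=\mathcal{C}x(t)=Cz(t-1)$ is exactly observable in the interval $[0,T]$, i.e. there is $\delta>0$ such that $$\|\mathcal{K}x_0\|_{L_2}^2=\int_0^T\left\|\mathcal{C}e^{\mathcal{A}t}x_0\right\|_{\mathbb{R}^p}^2\mathrm{d}t\ \ge\ \delta^2\|x_0\|_{M_2}^2\quad\text{for all } x_0,$$ if and only if the adjoint system $(\Sigma^\dagger)$ is exactly controllable at time $T$, i.e. $$\left\{\int_0^Te^{\mathcal{A}^\dagger t}\begin{pmatrix}C^*u(t)\\0\end{pmatrix}\mathrm{d}t:\ u\in L_2(0,T;\mathbb{R}^p)\right\}=D(\mathcal{A}^\dagger).$$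 2. If $\det A_{-1}\ne0$, then Assertion 1 also holds with the output $y(t)=\mathcal{C}x(t)=Cz(t)$ in place of $Cz(t-1)$, and for the same time $T$.
   Context: The star on a matrix denotes the transpose. The operator $\mathcal{A}$ acts in $M_2$ by $\mathcal{A}(v,\varphi)=\big(\int_{-1}^0[A_2(\theta)\varphi'(\theta)+A_3(\theta)\varphi(\theta)]\,\mathrm{d}\theta,\ \varphi'\big)$ with $D(\mathcal{A})=\{(v,\varphi):\varphi\in H^1([-1,0];\mathbb{R}^n),\ v=\varphi(0)-A_{-1}\varphi(-1)\}$; it generates a $C_0$-semigroup, and $x(t)=e^{\mathcal{A}t}x_0=(v(t),z_t(\cdot))$ with $z_t(\theta)=z(t+\theta)$, $v(t)=z(t)-A_{-1}z(t-1)$ for $x_0\in D(\mathcal{A})$. The operator $\mathcal{A}^\dagger$ is defined by the same formulas with $A_{-1},A_2,A_3$ replaced by $A_{-1}^*,A_2^*,A_3^*$. The output operator $\mathcal{C}$ is defined on $D(\mathcal{A})$ by $\mathcal{C}(v,\varphi)=C\varphi(-1)$ for the output $Cz(t-1)$, and by $\mathcal{C}(v,\varphi)=C\varphi(0)$ for the output $Cz(t)$. The operator $\mathcal{K}$ is $x_0\mapsto\mathcal{C}e^{\mathcal{A}t}x_0\in L_2(0,T;\mathbb{R}^p)$, defined for $x_0\in D(\mathcal{A})$ and extended by continuity to $M_2$ ($\mathcal{C}$ is admissible); the observability inequality is required for all $x_0\in M_2$, equivalently for all $x_0\in D(\mathcal{A})$. *)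

theory Defs
  imports "HOL-Analysis.Analysis"
begin

definition sq_integrable :: "'s measure \<Rightarrow> ('s \<Rightarrow> 'a::euclidean_space) \<Rightarrow> bool" where
  "sq_integrable M f \<longleftrightarrow> f \<in> borel_measurable M \<and> integrable M (\<lambda>x. (norm (f x))\<^sup>2)"

lemma sq_integrable_zero: "sq_integrable M (\<lambda>x. 0)"
  by (simp add: sq_integrable_def)

lemma sq_integrable_scaleR:
  assumes "sq_integrable M f" shows "sq_integrable M (\<lambda>x. c *\<^sub>R f x)"
  using assms by (auto simp: sq_integrable_def power_mult_distrib)

lemma sq_integrable_add:
  fixes f g :: "'s \<Rightarrow> 'a::euclidean_space"
  assumes "sq_integrable M f" "sq_integrable M g"
  shows "sq_integrable M (\<lambda>x. f x + g x)"
proof -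
  have [measurable]: "f \<in> borel_measurable M" "g \<in> borel_measurable M"
    using assms by (auto simp: sq_integrable_def)
  have "integrable M (\<lambda>x. 2 * (norm (f x))\<^sup>2 + 2 * (norm (g x))\<^sup>2)"
    using assms by (auto simp: sq_integrable_def)
  then have "integrable M (\<lambda>x. (norm (f x + g x))\<^sup>2)"
  proof (rule Bochner_Integration.integrable_bound)
    have "(norm (a + b))\<^sup>2 \<le> 2 * (norm a)\<^sup>2 + 2 * (norm b)\<^sup>2" for a b :: 'a
    proof -
      have "(norm (a + b))\<^sup>2 \<le> (norm a + norm b)\<^sup>2"
        by (simp add: norm_triangle_ineq power_mono)
      also have "\<dots> \<le> 2 * (norm a)\<^sup>2 + 2 * (norm b)\<^sup>2"
        using sum_squares_bound[of "norm a" "norm b"] by (simp add: power2_sum)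
      finally show ?thesis .
    qed
    then show "AE x in M. norm ((norm (f x + g x))\<^sup>2) \<le> norm (2 * (norm (f x))\<^sup>2 + 2 * (norm (g x))\<^sup>2)"
      by simp
  qed measurable
  then show ?thesis by (simp add: sq_integrable_def)
qed

lemma sq_integrable_minus:
  assumes "sq_integrable M f" shows "sq_integrable M (\<lambda>x. - f x)"
  using sq_integrable_scaleR[OF assms, of "-1"] by simp

lemma sq_integrable_diff:
  assumes "sq_integrable M f" "sq_integrable M g"
  shows "sq_integrable M (\<lambda>x. f x - g x)"
  using sq_integrable_add[OF assms(1) sq_integrable_minus[OF assms(2)]] by simp

lemma sq_integrable_inner:
  fixes f g :: "'s \<Rightarrow> 'a::euclidean_space"
  assumes "sq_integrable M f" "sq_integrable M g"
  shows "integrable M (\<lambda>x. f x \<bullet> g x)"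
proof -
  have [measurable]: "f \<in> borel_measurable M" "g \<in> borel_measurable M"
    using assms by (auto simp: sq_integrable_def)
  have "integrable M (\<lambda>x. (norm (f x))\<^sup>2 + (norm (g x))\<^sup>2)"
    using assms by (auto simp: sq_integrable_def)
  then show ?thesis
  proof (rule Bochner_Integration.integrable_bound)
    have "\<bar>a \<bullet> b\<bar> \<le> (norm a)\<^sup>2 + (norm b)\<^sup>2" for a b :: 'a
    proof -
      have "\<bar>a \<bullet> b\<bar> \<le> norm a * norm b" by (rule Cauchy_Schwarz_ineq2)
      also have "\<dots> \<le> (norm a)\<^sup>2 + (norm b)\<^sup>2"
        using sum_squares_bound[of "norm a" "norm b"] mult_nonneg_nonneg[of "norm a" "norm b"]
        by (simp del: mult_nonneg_nonneg)
      finally show ?thesis .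
    qed
    then show "AE x in M. norm (f x \<bullet> g x) \<le> norm ((norm (f x))\<^sup>2 + (norm (g x))\<^sup>2)"
      by simp
  qed measurable
qed

text \<open>
  \<open>'a L2\<close> is the Hilbert space \<open>L\<^sub>2(-1, 0; 'a)\<close>: square integrable functions modulo equality almost
  everywhere. Besides completeness, second countability is proved because the Bochner integral of
  functions with values in \<open>L\<^sub>2\<close> requires it.
\<close>

abbreviation (input) delay_measure :: "real measure" where
  "delay_measure \<equiv> lebesgue_on {-1..0}"

definition L2_rel :: "(real \<Rightarrow> 'a::euclidean_space) \<Rightarrow> (real \<Rightarrow> 'a) \<Rightarrow> bool" where
  "L2_rel f g \<longleftrightarrow> sq_integrable delay_measure f \<and> sq_integrable delay_measure g \<and>
     (AE x in delay_measure. f x = g x)"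

quotient_type (overloaded) 'a L2 = "real \<Rightarrow> 'a::euclidean_space" / partial: L2_rel
proof (rule part_equivpI)
  show "\<exists>f::real \<Rightarrow> 'a. L2_rel f f"
    by (rule exI[of _ "\<lambda>_. 0"]) (simp add: L2_rel_def sq_integrable_zero)
  show "symp (L2_rel :: (real \<Rightarrow> 'a) \<Rightarrow> _)"
    by (auto simp: symp_def L2_rel_def elim: AE_mp)
  show "transp (L2_rel :: (real \<Rightarrow> 'a) \<Rightarrow> _)"
    by (auto simp: transp_def L2_rel_def elim!: AE_mp)
qed

lemma L2_rel_refl [simp]: "L2_rel f f \<longleftrightarrow> sq_integrable delay_measure f"
  by (simp add: L2_rel_def)

lemma sq_integrable_rep_L2: "sq_integrable delay_measure (rep_L2 x)"
  using Quotient3_rep_reflp[OF Quotient3_L2, of x] by simp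

lemma abs_rep_L2: "abs_L2 (rep_L2 x) = x"
  by (rule Quotient3_abs_rep[OF Quotient3_L2])

lemma rep_abs_L2:
  "sq_integrable delay_measure f \<Longrightarrow> AE x in delay_measure. rep_L2 (abs_L2 f) x = f x"
  using rep_abs_rsp_left[OF Quotient3_L2, of f f] by (simp add: L2_rel_def)

lemma abs_L2_eqI:
  assumes "sq_integrable delay_measure f" "sq_integrable delay_measure g"
    "AE x in delay_measure. f x = g x"
  shows "abs_L2 f = abs_L2 g"
  using assms Quotient3_rel_abs[OF Quotient3_L2, of f g] by (simp add: L2_rel_def)

instantiation L2 :: (euclidean_space) real_inner
begin

lift_definition zero_L2 :: "'a L2" is "\<lambda>_. 0"
  by (simp add: sq_integrable_zero)

lift_definition plus_L2 :: "'a L2 \<Rightarrow> 'a L2 \<Rightarrow> 'a L2" is "\<lambda>f g x. f x + g x"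
  by (auto simp: L2_rel_def sq_integrable_add elim!: AE_mp)

lift_definition minus_L2 :: "'a L2 \<Rightarrow> 'a L2 \<Rightarrow> 'a L2" is "\<lambda>f g x. f x - g x"
  by (auto simp: L2_rel_def sq_integrable_diff elim!: AE_mp)

lift_definition uminus_L2 :: "'a L2 \<Rightarrow> 'a L2" is "\<lambda>f x. - f x"
  by (auto simp: L2_rel_def sq_integrable_minus elim!: AE_mp)

lift_definition scaleR_L2 :: "real \<Rightarrow> 'a L2 \<Rightarrow> 'a L2" is "\<lambda>c f x. c *\<^sub>R f x"
  by (auto simp: L2_rel_def sq_integrable_scaleR elim!: AE_mp)

lift_definition inner_L2 :: "'a L2 \<Rightarrow> 'a L2 \<Rightarrow> real" is "\<lambda>f g. LINT x|delay_measure. f x \<bullet> g x"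
  by (rule integral_cong_AE)
     (auto simp: L2_rel_def sq_integrable_def borel_measurable_inner)

definition norm_L2 :: "'a L2 \<Rightarrow> real" where
  "norm_L2 x = sqrt (x \<bullet> x)"

definition dist_L2 :: "'a L2 \<Rightarrow> 'a L2 \<Rightarrow> real" where
  "dist_L2 x y = norm (x - y)"

definition sgn_L2 :: "'a L2 \<Rightarrow> 'a L2" where
  "sgn_L2 x = scaleR (inverse (norm x)) x"

definition uniformity_L2 :: "('a L2 \<times> 'a L2) filter" where
  "uniformity_L2 = (INF e\<in>{0<..}. principal {(x, y). dist x y < e})"

definition open_L2 :: "'a L2 set \<Rightarrow> bool" where
  "open_L2 U \<longleftrightarrow> (\<forall>x\<in>U. eventually (\<lambda>(x', y). x' = x \<longrightarrow> y \<in> U) uniformity)"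

instance
proof
  fix x y z :: "'a L2" and r s :: real
  show "x + y + z = x + (y + z)"
    by transfer (auto simp: L2_rel_def sq_integrable_add add.assoc)
  show "x + y = y + x"
    by transfer (auto simp: L2_rel_def sq_integrable_add add.commute)
  show "0 + x = x"
    by transfer (auto simp: L2_rel_def sq_integrable_add)
  show "- x + x = 0"
    by transfer (auto simp: L2_rel_def sq_integrable_zero)
  show "x - y = x + - y"
    by transfer (auto simp: L2_rel_def sq_integrable_diff)
  show "r *\<^sub>R (x + y) = r *\<^sub>R x + r *\<^sub>R y"
    by transfer (auto simp: L2_rel_def sq_integrable_add sq_integrable_scaleR scaleR_add_right)
  show "(r + s) *\<^sub>R x = r *\<^sub>R x + s *\<^sub>R x"
    by transfer (auto simp: L2_rel_def sq_integrable_add sq_integrable_scaleR scaleR_add_left)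
  show "r *\<^sub>R s *\<^sub>R x = (r * s) *\<^sub>R x"
    by transfer (auto simp: L2_rel_def sq_integrable_scaleR)
  show "1 *\<^sub>R x = x"
    by transfer auto
  show "dist x y = norm (x - y)" by (rule dist_L2_def)
  show "sgn x = scaleR (inverse (norm x)) x" by (rule sgn_L2_def)
  show "uniformity = (INF e\<in>{0<..}. principal {(x::'a L2, y). dist x y < e})"
    by (rule uniformity_L2_def)
  show "open U \<longleftrightarrow> (\<forall>x\<in>U. \<forall>\<^sub>F (x', y) in uniformity. x' = x \<longrightarrow> y \<in> U)" for U :: "'a L2 set"
    by (rule open_L2_def)
  show "x \<bullet> y = y \<bullet> x"
    by transfer (simp add: inner_commute)
  show "(x + y) \<bullet> z = x \<bullet> z + y \<bullet> z"
    by transfer (simp add: inner_add_left sq_integrable_inner)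
  show "(r *\<^sub>R x) \<bullet> y = r * (x \<bullet> y)"
    by transfer simp
  show "0 \<le> x \<bullet> x"
    by transfer simp
  show "x \<bullet> x = 0 \<longleftrightarrow> x = 0"
  proof transfer
    fix f :: "real \<Rightarrow> 'a" assume "L2_rel f f"
    then have f: "sq_integrable delay_measure f" by simp
    have "(LINT x|delay_measure. f x \<bullet> f x) = 0 \<longleftrightarrow> (AE x in delay_measure. f x \<bullet> f x = 0)"
      using sq_integrable_inner[OF f f] by (intro integral_nonneg_eq_0_iff_AE) auto
    then show "(LINT x|delay_measure. f x \<bullet> f x) = 0 \<longleftrightarrow> L2_rel f (\<lambda>_. 0)"
      using f by (simp add: L2_rel_def sq_integrable_zero)
  qed
  show "norm x = sqrt (x \<bullet> x)" by (rule norm_L2_def)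
qed

end

lemma norm_abs_L2:
  assumes "sq_integrable delay_measure f"
  shows "(norm (abs_L2 f))\<^sup>2 = (LINT x|delay_measure. (norm (f x))\<^sup>2)"
proof -
  have "(norm (abs_L2 f))\<^sup>2 = abs_L2 f \<bullet> abs_L2 f"
    by (simp add: power2_norm_eq_inner)
  also have "\<dots> = (LINT x|delay_measure. f x \<bullet> f x)"
    using assms by (intro inner_L2.abs_eq) auto
  finally show ?thesis by (simp add: power2_norm_eq_inner)
qed

lemma abs_L2_add:
  "sq_integrable delay_measure f \<Longrightarrow> sq_integrable delay_measure g \<Longrightarrow>
    abs_L2 f + abs_L2 g = abs_L2 (\<lambda>x. f x + g x)"
  by (rule plus_L2.abs_eq) auto

lemma abs_L2_diff:
  "sq_integrable delay_measure f \<Longrightarrow> sq_integrable delay_measure g \<Longrightarrow>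
    abs_L2 f - abs_L2 g = abs_L2 (\<lambda>x. f x - g x)"
  by (rule minus_L2.abs_eq) auto

lemma abs_L2_scaleR:
  "sq_integrable delay_measure f \<Longrightarrow> c *\<^sub>R abs_L2 f = abs_L2 (\<lambda>x. c *\<^sub>R f x)"
  by (rule scaleR_L2.abs_eq) auto

lemma sq_integrable_imp_integrable:
  fixes f :: "'s \<Rightarrow> 'a::euclidean_space"
  assumes "finite_measure M" "sq_integrable M f"
  shows "integrable M f"
proof -
  interpret finite_measure M by fact
  have "integrable M (\<lambda>x. 1 + (norm (f x))\<^sup>2)"
    using assms(2) by (auto simp: sq_integrable_def)
  then show ?thesis
  proof (rule Bochner_Integration.integrable_bound)
    show "f \<in> borel_measurable M" using assms(2) by (simp add: sq_integrable_def)
    have "a \<le> 1 + a\<^sup>2" if "a \<ge> 0" for a :: real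
      using sum_squares_bound[of 1 a] that by simp
    then show "AE x in M. norm (f x) \<le> norm (1 + (norm (f x))\<^sup>2)" by simp
  qed
qed

lemma finite_measure_delay: "finite_measure delay_measure"
  by (rule finite_measure_lebesgue_on) simp

instance L2 :: (euclidean_space) banach
proof
  fix X :: "nat \<Rightarrow> 'a L2" assume C: "Cauchy X"
  interpret finite_measure delay_measure by (rule finite_measure_delay)
  define s where "s n = rep_L2 (X n)" for n
  have s: "sq_integrable delay_measure (s n)" for n
    by (simp add: s_def sq_integrable_rep_L2)
  have [measurable]: "s n \<in> borel_measurable delay_measure" for n
    using s by (simp add: sq_integrable_def)
  have sd: "sq_integrable delay_measure (\<lambda>x. s i x - s j x)" for i j
    by (intro sq_integrable_diff s)
  have nrm: "(norm (X i - X j))\<^sup>2 = (LINT x|delay_measure. (norm (s i x - s j x))\<^sup>2)" for i j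
    using norm_abs_L2[OF sd] abs_L2_diff[OF s s] by (simp add: s_def abs_rep_L2)
  have l1: "(LINT x|delay_measure. norm (s i x - s j x)) \<le> norm (X i - X j)" for i j
  proof -
    let ?d = "\<lambda>x. norm (s i x - s j x)"
    have i1: "integrable delay_measure ?d"
      using sq_integrable_imp_integrable[OF finite_measure_delay sd] by (rule integrable_norm)
    have i2: "integrable delay_measure (\<lambda>x. (?d x)\<^sup>2)"
      using sd by (simp add: sq_integrable_def)
    define m where "m = (LINT x|delay_measure. ?d x)"
    have ms: "measure delay_measure (space delay_measure) = 1"
      by (simp add: measure_restrict_space)
    have "0 \<le> (LINT x|delay_measure. (?d x - m)\<^sup>2)" by simp
    also have "\<dots> = (LINT x|delay_measure. (?d x)\<^sup>2 + m\<^sup>2 - 2 * m * ?d x)"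
      by (simp add: power2_diff mult.commute mult.left_commute mult.assoc)
    also have "\<dots> = (LINT x|delay_measure. (?d x)\<^sup>2) + m\<^sup>2 - 2 * m * m"
      using i1 i2 ms by (simp add: m_def lebesgue_integral_const)
    also have "\<dots> = (norm (X i - X j))\<^sup>2 - m\<^sup>2"
      unfolding nrm by (simp add: power2_eq_square)
    finally have "m\<^sup>2 \<le> (norm (X i - X j))\<^sup>2" by simp
    then show ?thesis unfolding m_def[symmetric] by (rule power2_le_imp_le) simp
  qed
  obtain r where r: "strict_mono r" "AE x in delay_measure. Cauchy (\<lambda>i. s (r i) x)"
  proof (rule cauchy_L1_AE_cauchy_subseq[of delay_measure s])
    show "integrable delay_measure (s n)" for n
      by (rule sq_integrable_imp_integrable[OF finite_measure_delay s])
    show "\<exists>N. \<forall>i\<ge>N. \<forall>j\<ge>N. (LINT x|delay_measure. norm (s i x - s j x)) < e" if e: "e > 0" for e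
    proof -
      obtain N where "\<forall>i\<ge>N. \<forall>j\<ge>N. norm (X i - X j) < e"
        using CauchyD[OF C e] by blast
      then show ?thesis using l1 by (meson le_less_trans)
    qed
  qed auto
  define g where "g x = lim (\<lambda>i. s (r i) x)" for x
  have [measurable]: "g \<in> borel_measurable delay_measure"
    unfolding g_def by measurable
  have conv: "AE x in delay_measure. (\<lambda>i. s (r i) x) \<longlonglongrightarrow> g x"
    using r(2) by eventually_elim (simp add: g_def Cauchy_convergent_iff convergent_LIMSEQ_iff)
  have key: "sq_integrable delay_measure (\<lambda>x. g x - s i x) \<and>
       (LINT x|delay_measure. (norm (g x - s i x))\<^sup>2) \<le> e\<^sup>2"
    if e: "e > 0" and i: "\<And>j. j \<ge> N \<Longrightarrow> norm (X j - X i) < e" for i N e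
  proof -
    have "(\<integral>\<^sup>+x. ennreal ((norm (g x - s i x))\<^sup>2) \<partial>delay_measure) \<le>
          (\<integral>\<^sup>+x. liminf (\<lambda>k. ennreal ((norm (s (r k) x - s i x))\<^sup>2)) \<partial>delay_measure)"
    proof (rule nn_integral_mono_AE)
      show "AE x in delay_measure. ennreal ((norm (g x - s i x))\<^sup>2) \<le>
          liminf (\<lambda>k. ennreal ((norm (s (r k) x - s i x))\<^sup>2))"
        using conv
      proof eventually_elim
        case (elim x)
        have "(\<lambda>k. ennreal ((norm (s (r k) x - s i x))\<^sup>2)) \<longlonglongrightarrow> ennreal ((norm (g x - s i x))\<^sup>2)"
          by (intro tendsto_intros tendsto_ennrealI elim)
        from lim_imp_Liminf[OF trivial_limit_sequentially this] show ?case by simp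
      qed
    qed
    also have "\<dots> \<le> liminf (\<lambda>k. \<integral>\<^sup>+x. ennreal ((norm (s (r k) x - s i x))\<^sup>2) \<partial>delay_measure)"
      by (rule nn_integral_liminf) measurable
    also have "\<dots> = liminf (\<lambda>k. ennreal ((norm (X (r k) - X i))\<^sup>2))"
    proof -
      have "(\<integral>\<^sup>+x. ennreal ((norm (s (r k) x - s i x))\<^sup>2) \<partial>delay_measure) = ennreal ((norm (X (r k) - X i))\<^sup>2)" for k
        unfolding nrm using sd by (intro nn_integral_eq_integral) (auto simp: sq_integrable_def)
      then show ?thesis by simp
    qed
    also have "\<dots> \<le> ennreal (e\<^sup>2)"
    proof -
      have "\<forall>\<^sub>F k in sequentially. ennreal ((norm (X (r k) - X i))\<^sup>2) \<le> ennreal (e\<^sup>2)"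
        unfolding eventually_sequentially
      proof (intro exI allI impI)
        fix k assume "N \<le> k"
        then have "r k \<ge> N" using seq_suble[OF r(1), of k] by simp
        from i[OF this] show "ennreal ((norm (X (r k) - X i))\<^sup>2) \<le> ennreal (e\<^sup>2)"
          by (intro ennreal_leI power_mono) auto
      qed
      from Liminf_mono[OF this] show ?thesis by (simp add: Liminf_const)
    qed
    finally have *: "(\<integral>\<^sup>+x. ennreal ((norm (g x - s i x))\<^sup>2) \<partial>delay_measure) \<le> ennreal (e\<^sup>2)" .
    have int: "integrable delay_measure (\<lambda>x. (norm (g x - s i x))\<^sup>2)"
    proof (rule integrableI_bounded)
      show "(\<integral>\<^sup>+x. ennreal (norm ((norm (g x - s i x))\<^sup>2)) \<partial>delay_measure) < \<infinity>"
        using le_less_trans[OF * ennreal_less_top] by simp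
    qed measurable
    moreover have "(LINT x|delay_measure. (norm (g x - s i x))\<^sup>2) \<le> e\<^sup>2"
      using * nn_integral_eq_integral[OF int] by simp
    ultimately show ?thesis by (simp add: sq_integrable_def)
  qed
  have g: "sq_integrable delay_measure g"
  proof -
    obtain N where "\<forall>i\<ge>N. \<forall>j\<ge>N. norm (X i - X j) < 1"
      using CauchyD[OF C, of 1] by auto
    then have "sq_integrable delay_measure (\<lambda>x. g x - s N x)"
      using key[of 1 N N] by simp
    from sq_integrable_add[OF this s[of N]] show ?thesis by simp
  qed
  have "X \<longlonglongrightarrow> abs_L2 g"
  proof (rule LIMSEQ_I)
    fix e :: real assume e: "e > 0"
    obtain N where N: "\<forall>i\<ge>N. \<forall>j\<ge>N. norm (X i - X j) < e/2"
      using CauchyD[OF C, of "e/2"] e by auto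
    have "norm (X i - abs_L2 g) < e" if "i \<ge> N" for i
    proof -
      have "(norm (abs_L2 g - X i))\<^sup>2 = (LINT x|delay_measure. (norm (g x - s i x))\<^sup>2)"
        using norm_abs_L2[OF sq_integrable_diff[OF g s]] abs_L2_diff[OF g s]
        by (simp add: s_def abs_rep_L2)
      also have "\<dots> \<le> (e/2)\<^sup>2"
        using key[of "e/2" N i] N that e by simp
      finally have "norm (abs_L2 g - X i) \<le> e/2"
        by (rule power2_le_imp_le) (use e in simp)
      then show ?thesis using e by (simp add: norm_minus_commute)
    qed
    then show "\<exists>N. \<forall>i\<ge>N. norm (X i - abs_L2 g) < e" by blast
  qed
  then show "convergent X" by (auto simp: convergent_def)
qed


lemma abs_L2_tendsto:
  fixes f :: "real \<Rightarrow> 'a::euclidean_space"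
  assumes s: "\<And>n. sq_integrable delay_measure (s n)" and f: "sq_integrable delay_measure f"
    and w: "integrable delay_measure w"
    and lim: "\<And>x. (\<lambda>n. s n x) \<longlonglongrightarrow> f x"
    and bound: "\<And>n x. (norm (s n x - f x))\<^sup>2 \<le> w x"
  shows "(\<lambda>n. abs_L2 (s n)) \<longlonglongrightarrow> abs_L2 f"
proof -
  have [measurable]: "s n \<in> borel_measurable delay_measure" "f \<in> borel_measurable delay_measure" for n
    using s f by (auto simp: sq_integrable_def)
  have "(\<lambda>n. LINT x|delay_measure. (norm (s n x - f x))\<^sup>2) \<longlonglongrightarrow> (LINT x|delay_measure. 0::real)"
  proof (rule integral_dominated_convergence[where w=w])
    show "AE x in delay_measure. (\<lambda>n. (norm (s n x - f x))\<^sup>2) \<longlonglongrightarrow> 0"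
    proof (rule AE_I2)
      fix x
      have "(\<lambda>n. (norm (s n x - f x))\<^sup>2) \<longlonglongrightarrow> (norm (f x - f x))\<^sup>2"
        by (intro tendsto_intros lim)
      then show "(\<lambda>n. (norm (s n x - f x))\<^sup>2) \<longlonglongrightarrow> 0" by simp
    qed
  qed (use w bound in auto)
  also have "(\<lambda>n. LINT x|delay_measure. (norm (s n x - f x))\<^sup>2) =
      (\<lambda>n. (norm (abs_L2 (s n) - abs_L2 f))\<^sup>2)"
    using s f by (simp add: abs_L2_diff norm_abs_L2 sq_integrable_diff)
  finally have "(\<lambda>n. sqrt ((norm (abs_L2 (s n) - abs_L2 f))\<^sup>2)) \<longlonglongrightarrow> sqrt 0"
    by (intro tendsto_real_sqrt) simp
  then have "(\<lambda>n. norm (abs_L2 (s n) - abs_L2 f)) \<longlonglongrightarrow> 0" by simp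
  then show ?thesis
    by (rule LIM_zero_cancel[OF tendsto_norm_zero_cancel])
qed

lemma abs_L2_sum:
  assumes "finite A" "\<And>i. i \<in> A \<Longrightarrow> sq_integrable delay_measure (f i)"
  shows "sq_integrable delay_measure (\<lambda>x. \<Sum>i\<in>A. f i x) \<and>
    abs_L2 (\<lambda>x. \<Sum>i\<in>A. f i x) = (\<Sum>i\<in>A. abs_L2 (f i))"
  using assms
proof (induction A rule: finite_induct)
  case empty
  show ?case by (simp add: sq_integrable_zero zero_L2_def)
next
  case (insert a A)
  then have "sq_integrable delay_measure (f a)" "sq_integrable delay_measure (\<lambda>x. \<Sum>i\<in>A. f i x)"
    "abs_L2 (\<lambda>x. \<Sum>i\<in>A. f i x) = (\<Sum>i\<in>A. abs_L2 (f i))"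
    by auto
  then show ?case
    using insert(1,2) abs_L2_add[of "f a" "\<lambda>x. \<Sum>i\<in>A. f i x"]
    by (simp add: sq_integrable_add)
qed

lemma sq_integrable_indicator:
  fixes b :: "'a::euclidean_space"
  assumes A: "A \<in> sets lebesgue"
  shows "sq_integrable delay_measure (\<lambda>x. indicator A x *\<^sub>R b)"
  unfolding sq_integrable_def
proof
  interpret finite_measure delay_measure by (rule finite_measure_delay)
  show m: "(\<lambda>x. indicator A x *\<^sub>R b) \<in> borel_measurable delay_measure"
    using A by (intro measurable_restrict_space1 borel_measurable_scaleR) auto
  show "integrable delay_measure (\<lambda>x. (norm (indicator A x *\<^sub>R b))\<^sup>2)"
  proof (rule integrable_const_bound[where B="(norm b)\<^sup>2"])
    show "(\<lambda>x. (norm (indicator A x *\<^sub>R b))\<^sup>2) \<in> borel_measurable delay_measure"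
      using m by measurable
  qed (auto simp: indicator_def)
qed

lemma L2_separable:
  "\<exists>D::'a::euclidean_space L2 set. countable D \<and> closure D = UNIV \<and>
     D \<subseteq> span (range (\<lambda>(r, b). abs_L2 (\<lambda>x. indicator {..<r} x *\<^sub>R b)))"
proof -
  interpret finite_measure delay_measure by (rule finite_measure_delay)
  define ind :: "real set \<Rightarrow> 'a \<Rightarrow> 'a L2"
    where "ind A e = abs_L2 (\<lambda>x. indicator A x *\<^sub>R e)" for A e
  define t :: "rat \<times> rat \<times> 'a \<Rightarrow> 'a L2"
    where "t = (\<lambda>(q, r, b). of_rat q *\<^sub>R ind {..<of_rat r} b)"
  define D where "D = (\<lambda>l. sum_list (map t l)) ` lists (UNIV \<times> UNIV \<times> Basis)"
  define V where "V = closure D"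
  note sq = sq_integrable_indicator
  have cD: "countable D"
    unfolding D_def by (intro countable_image countable_lists countable_SIGMA)
      (auto intro: countable_finite)
  have D0: "0 \<in> D" unfolding D_def by (rule image_eqI[of _ _ "[]"]) auto
  have Dadd: "x + y \<in> D" if xy: "x \<in> D" "y \<in> D" for x y
  proof -
    obtain l m where "x = sum_list (map t l)" "y = sum_list (map t m)"
      "l \<in> lists (UNIV \<times> UNIV \<times> Basis)" "m \<in> lists (UNIV \<times> UNIV \<times> Basis)"
      using xy unfolding D_def by blast
    then show ?thesis unfolding D_def by (intro image_eqI[of _ _ "l @ m"]) auto
  qed
  have Dscale: "of_rat q *\<^sub>R x \<in> D" if x: "x \<in> D" for q x
  proof -
    obtain l where l: "x = sum_list (map t l)" "l \<in> lists (UNIV \<times> UNIV \<times> Basis)"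
      using x unfolding D_def by blast
    have "of_rat q *\<^sub>R sum_list (map t l) = sum_list (map t (map (\<lambda>(p, r, b). (q * p, r, b)) l))"
      by (induction l) (auto simp: t_def scaleR_add_right of_rat_mult)
    moreover have "map (\<lambda>(p, r, b). (q * p, r, b)) l \<in> lists (UNIV \<times> UNIV \<times> Basis)"
      using l(2) by (induction l) auto
    ultimately show ?thesis unfolding D_def l(1) by (rule image_eqI)
  qed
  have subV: "subspace V"
    unfolding subspace_def
  proof (intro conjI ballI allI)
    show "0 \<in> V" using D0 closure_subset unfolding V_def by blast
    show "x + y \<in> V" if xy: "x \<in> V" "y \<in> V" for x y
    proof -
      obtain X Y where "\<forall>n. X n \<in> D" "X \<longlonglongrightarrow> x" "\<forall>n. Y n \<in> D" "Y \<longlonglongrightarrow> y"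
        using xy unfolding V_def closure_sequential by blast
      then show ?thesis unfolding V_def closure_sequential
        by (intro exI[of _ "\<lambda>n. X n + Y n"]) (auto intro: Dadd tendsto_add)
    qed
    show "c *\<^sub>R x \<in> V" if x: "x \<in> V" for c x
    proof -
      obtain X where X: "\<forall>n. X n \<in> D" "X \<longlonglongrightarrow> x"
        using x unfolding V_def closure_sequential by blast
      have "\<exists>q. c < real_of_rat q \<and> real_of_rat q < c + inverse (real (Suc n))" for n
        by (rule of_rat_dense) simp
      then obtain q where q: "\<And>n. c < real_of_rat (q n) \<and> real_of_rat (q n) < c + inverse (real (Suc n))"
        by metis
      have "(\<lambda>n. c + inverse (real (Suc n))) \<longlonglongrightarrow> c + 0"
        by (intro tendsto_intros LIMSEQ_inverse_real_of_nat)
      then have up: "(\<lambda>n. c + inverse (real (Suc n))) \<longlonglongrightarrow> c" by simp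
      have "(\<lambda>n. real_of_rat (q n)) \<longlonglongrightarrow> c"
      proof (rule real_tendsto_sandwich[OF _ _ tendsto_const up])
        show "\<forall>\<^sub>F n in sequentially. c \<le> real_of_rat (q n)"
          by (rule always_eventually) (use q in \<open>blast intro: less_imp_le\<close>)
        show "\<forall>\<^sub>F n in sequentially. real_of_rat (q n) \<le> c + inverse (real (Suc n))"
          by (rule always_eventually) (use q in \<open>blast intro: less_imp_le\<close>)
      qed
      then show ?thesis unfolding V_def closure_sequential using X
        by (intro exI[of _ "\<lambda>n. of_rat (q n) *\<^sub>R X n"]) (auto intro: Dscale tendsto_scaleR)
    qed
  qed
  have limV: "x \<in> V" if "\<And>n. X n \<in> V" "X \<longlonglongrightarrow> x" for X x
    using that closed_sequentially[of V] unfolding V_def by blast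
  have ind_eq: "ind A e = (\<Sum>b\<in>Basis. (e \<bullet> b) *\<^sub>R ind A b)" if A: "A \<in> sets lebesgue" for A e
  proof -
    have "(\<Sum>b\<in>Basis. (e \<bullet> b) *\<^sub>R ind A b) = (\<Sum>b\<in>Basis. abs_L2 (\<lambda>x. (e \<bullet> b) *\<^sub>R indicator A x *\<^sub>R b))"
      unfolding ind_def by (simp add: abs_L2_scaleR sq[OF A])
    also have "\<dots> = abs_L2 (\<lambda>x. \<Sum>b\<in>Basis. (e \<bullet> b) *\<^sub>R indicator A x *\<^sub>R b)"
      by (rule conjunct2[OF abs_L2_sum, symmetric]) (rule finite_Basis, rule sq_integrable_scaleR[OF sq[OF A]])
    also have "(\<lambda>x. \<Sum>b\<in>Basis. (e \<bullet> b) *\<^sub>R indicator A x *\<^sub>R b) = (\<lambda>x. indicator A x *\<^sub>R e)"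
      by (auto simp: indicator_def euclidean_representation)
    finally show ?thesis by (simp add: ind_def)
  qed
  have rat: "ind {..<of_rat r} e \<in> V" for r e
  proof -
    have "ind {..<of_rat r} b \<in> D" if "b \<in> Basis" for b
      unfolding D_def by (rule image_eqI[of _ _ "[(1, r, b)]"]) (use that in \<open>auto simp: t_def\<close>)
    then have "ind {..<of_rat r} b \<in> V" if "b \<in> Basis" for b
      using that closure_subset unfolding V_def by blast
    then have "(\<Sum>b\<in>Basis. (e \<bullet> b) *\<^sub>R ind {..<of_rat r} b) \<in> V"
      by (intro subspace_sum[OF subV] subspace_scale[OF subV])
    then show ?thesis by (subst ind_eq) auto
  qed
  let ?G = "range (\<lambda>r. {..<real_of_rat r})"
  have borelG: "sigma_sets UNIV ?G = sets borel"
  proof -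
    have "borel = sigma UNIV ?G"
    proof (rule borel_eq_sigmaI1[where X="range (\<lambda>a::real. {..<a})"])
      show "borel = sigma UNIV (range (\<lambda>a::real. {..<a}))"
        using borel_eq_lessThan[where 'a=real] by (simp add: eucl_lessThan)
      show "X \<in> sets (sigma UNIV ?G)" if X: "X \<in> range (\<lambda>a::real. {..<a})" for X
      proof -
        obtain a where a: "X = {..<a}" using X by auto
        have "X = (\<Union>r\<in>{r. real_of_rat r < a}. {..<real_of_rat r})"
        proof
          show "X \<subseteq> (\<Union>r\<in>{r. real_of_rat r < a}. {..<real_of_rat r})"
          proof
            fix x assume "x \<in> X"
            then obtain r where "x < real_of_rat r" "real_of_rat r < a"
              using of_rat_dense[of x a] a by auto
            then show "x \<in> (\<Union>r\<in>{r. real_of_rat r < a}. {..<real_of_rat r})" by blast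
          qed
        qed (auto simp: a)
        also have "\<dots> \<in> sets (sigma UNIV ?G)"
        proof (rule sets.countable_UN'')
          show "countable {r. real_of_rat r < a}" by (rule countableI_type)
          show "{..<real_of_rat r} \<in> sets (sigma UNIV ?G)" if "r \<in> {r. real_of_rat r < a}" for r
            by (simp add: sigma_sets.Basic sets_measure_of)
        qed
        finally show ?thesis .
      qed
    qed auto
    then have "sets borel = sets (sigma UNIV ?G)" by (rule arg_cong)
    also have "\<dots> = sigma_sets UNIV ?G" by (rule sets_measure_of) simp
    finally show ?thesis by (rule sym)
  qed
  have UNIV_ind: "ind UNIV e = ind {..<of_rat 1} e" for e
    unfolding ind_def
  proof (rule abs_L2_eqI[OF sq sq AE_I2])
    fix x assume "x \<in> space delay_measure"
    then show "indicator UNIV x *\<^sub>R e = indicator {..<of_rat 1} x *\<^sub>R e" by simp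
  qed auto
  have bor: "ind A e \<in> V" if "A \<in> sets borel" for A e
  proof -
    have "Int_stable ?G"
    proof (rule Int_stableI_image)
      fix i j :: rat
      have "{..<real_of_rat i} \<inter> {..<real_of_rat j} = {..<real_of_rat (min i j)}"
        using of_rat_less_eq[of i j, where 'a=real] of_rat_less_eq[of j i, where 'a=real]
        by (cases "i \<le> j") (auto simp: min_def)
      then show "\<exists>k\<in>UNIV. {..<real_of_rat i} \<inter> {..<real_of_rat j} = {..<real_of_rat k}" by blast
    qed
    moreover have "?G \<subseteq> Pow UNIV" by simp
    moreover have "A \<in> sigma_sets UNIV ?G" using that borelG by simp
    ultimately show ?thesis
    proof (induction rule: sigma_sets_induct_disjoint)
      case (basic A) then show ?case using rat by auto
    next
      case empty
      have "ind {} e = 0" by (simp add: ind_def zero_L2_def)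
      then show ?case using subspace_0[OF subV] by simp
    next
      case (compl A)
      then have A: "A \<in> sets lebesgue" using borelG by auto
      have "ind UNIV e - ind A e = ind (UNIV - A) e"
      proof -
        have "indicator UNIV x *\<^sub>R e - indicator A x *\<^sub>R e = indicator (UNIV - A) x *\<^sub>R e" for x
          by (simp add: indicator_def)
        then show ?thesis unfolding ind_def by (subst abs_L2_diff[OF sq sq]) (use A in auto)
      qed
      moreover have "ind UNIV e \<in> V" unfolding UNIV_ind by (rule rat)
      ultimately show ?case using compl subspace_diff[OF subV] by metis
    next
      case (union A)
      then have A: "A i \<in> sets lebesgue" for i using borelG by auto
      define B where "B n = (\<Union>i<n. A i)" for n
      have B: "B n \<in> sets lebesgue" for n unfolding B_def using A by blast
      have U: "(\<Union>i. A i) \<in> sets lebesgue" using A by blast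
      have "ind (B n) e \<in> V" for n
      proof (induction n)
        case 0
        have "ind (B 0) e = 0" by (simp add: ind_def zero_L2_def B_def)
        then show ?case using subspace_0[OF subV] by simp
      next
        case (Suc n)
        have "A n \<inter> B n = {}"
          using disjoint_family_onD[OF union(1), of n] by (fastforce simp: B_def)
        moreover have "B (Suc n) = B n \<union> A n" by (auto simp: B_def lessThan_Suc)
        ultimately have "indicator (B (Suc n)) x *\<^sub>R e = indicator (B n) x *\<^sub>R e + indicator (A n) x *\<^sub>R e" for x
          by (auto simp: indicator_def)
        then have "ind (B (Suc n)) e = ind (B n) e + ind (A n) e"
          unfolding ind_def by (subst abs_L2_add) (auto intro: sq A B)
        then show ?case using Suc union subspace_add[OF subV] by metis
      qed
      moreover have "(\<lambda>n. ind (B n) e) \<longlonglongrightarrow> ind (\<Union>i. A i) e"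
        unfolding ind_def
      proof (rule abs_L2_tendsto[where w="\<lambda>_. (norm e)\<^sup>2"])
        fix x
        have "(\<lambda>n. indicator (B n) x :: real) \<longlonglongrightarrow> indicator (\<Union>n. B n) x"
          by (rule LIMSEQ_indicator_incseq) (fastforce simp: incseq_def B_def)
        moreover have "(\<Union>n. B n) = (\<Union>i. A i)" by (auto simp: B_def)
        ultimately show "(\<lambda>n. indicator (B n) x *\<^sub>R e) \<longlonglongrightarrow> indicator (\<Union>i. A i) x *\<^sub>R e"
          by (auto intro: tendsto_scaleR)
        show "(norm (indicator (B n) x *\<^sub>R e - indicator (\<Union>i. A i) x *\<^sub>R e))\<^sup>2 \<le> (norm e)\<^sup>2" for n
          by (auto simp: indicator_def B_def)
      qed (use sq B U in auto)
      ultimately show ?case by (rule limV)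
    qed
  qed
  have leb: "ind A e \<in> V" if A: "A \<in> sets lebesgue" for A e
  proof -
    obtain S N N' where *: "A = S \<union> N" "N \<subseteq> N'" "N' \<in> null_sets lborel" "S \<in> sets lborel"
      using sets_completionE[OF A] by blast
    have "AE x in lebesgue. x \<notin> N'"
      using *(3) by (intro AE_not_in null_sets_completionI)
    then have "AE x in delay_measure. x \<notin> N'"
      by (subst AE_restrict_space_iff) auto
    then have "ind A e = ind S e"
      unfolding ind_def using * A
      by (intro abs_L2_eqI sq) (auto elim!: eventually_mono simp: indicator_def)
    then show ?thesis using bor *(4) by simp
  qed
  have "x \<in> V" for x :: "'a L2"
  proof -
    define f where "f = (\<lambda>s. indicator {-1..0} s *\<^sub>R rep_L2 x s)"
    have AEf: "AE s in delay_measure. f s = rep_L2 x s"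
      by (rule AE_I2) (simp add: f_def)
    have rep: "sq_integrable delay_measure (rep_L2 x)" by (rule sq_integrable_rep_L2)
    have fm: "f \<in> borel_measurable delay_measure"
      using rep by (subst measurable_cong[of _ f "rep_L2 x"]) (auto simp: sq_integrable_def f_def)
    have "integrable delay_measure (\<lambda>s. (norm (f s))\<^sup>2)"
      using rep by (subst Bochner_Integration.integrable_cong[OF refl, of _ _ "\<lambda>s. (norm (rep_L2 x s))\<^sup>2"])
        (auto simp: sq_integrable_def f_def)
    with fm have f: "sq_integrable delay_measure f" by (simp add: sq_integrable_def)
    have xf: "x = abs_L2 f"
      using abs_L2_eqI[OF f rep AEf] by (simp add: abs_rep_L2)
    obtain s where s: "\<And>i. simple_function delay_measure (s i)"
        "\<And>x. x \<in> space delay_measure \<Longrightarrow> (\<lambda>i. s i x) \<longlonglongrightarrow> f x"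
        "\<And>i x. x \<in> space delay_measure \<Longrightarrow> norm (s i x) \<le> 2 * norm (f x)"
      using borel_measurable_implies_sequence_metric[OF fm, of 0] unfolding norm_conv_dist by metis
    define g where "g i x = (\<Sum>y\<in>s i ` {-1..0}. indicator (s i -` {y} \<inter> {-1..0}) x *\<^sub>R y)" for i x
    have fin: "finite (s i ` {-1..0})" for i
      using s(1)[of i] by (auto simp: simple_function_def)
    have sets: "s i -` {y} \<inter> {-1..0} \<in> sets lebesgue" for i y
    proof -
      have "s i -` {y} \<inter> {-1..0} \<in> sets delay_measure"
        using simple_functionD(2)[OF s(1), of i "{y}"] by simp
      then show ?thesis by (subst (asm) sets_restrict_space_iff) auto
    qed
    have gs: "g i x = s i x" if "x \<in> {-1..0}" for i x
    proof -
      have "g i x = (\<Sum>y\<in>s i ` {-1..0}. if y = s i x then y else 0)"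
        unfolding g_def using that by (intro sum.cong) (auto simp: indicator_def)
      then show ?thesis using that fin[of i] by simp
    qed
    have g0: "g i x = 0" if "x \<notin> {-1..0}" for i x
      using that by (simp add: g_def)
    have g: "sq_integrable delay_measure (g i)" "abs_L2 (g i) \<in> V" for i
    proof -
      have *: "sq_integrable delay_measure (g i) \<and>
          abs_L2 (g i) = (\<Sum>y\<in>s i ` {-1..0}. ind (s i -` {y} \<inter> {-1..0}) y)"
        unfolding g_def ind_def by (rule abs_L2_sum[OF fin sq[OF sets]])
      then show "sq_integrable delay_measure (g i)" by simp
      show "abs_L2 (g i) \<in> V" using * by (auto intro!: subspace_sum[OF subV] leb sets)
    qed
    have "(\<lambda>i. abs_L2 (g i)) \<longlonglongrightarrow> abs_L2 f"
    proof (rule abs_L2_tendsto[where w="\<lambda>x. 9 * (norm (f x))\<^sup>2"])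
      show "integrable delay_measure (\<lambda>x. 9 * (norm (f x))\<^sup>2)"
        using f by (simp add: sq_integrable_def)
      fix x
      show "(\<lambda>i. g i x) \<longlonglongrightarrow> f x"
        using s(2)[of x] gs[of x] g0[of x] by (cases "x \<in> {-1..0}") (auto simp: f_def)
      show "(norm (g i x - f x))\<^sup>2 \<le> 9 * (norm (f x))\<^sup>2" for i
      proof -
        have "norm (g i x) \<le> 2 * norm (f x)"
          using s(3)[of x i] gs[of x i] g0[of x i] by (cases "x \<in> {-1..0}") auto
        then have "norm (g i x - f x) \<le> 3 * norm (f x)"
          using norm_triangle_ineq4[of "g i x" "f x"] by simp
        then have "(norm (g i x - f x))\<^sup>2 \<le> (3 * norm (f x))\<^sup>2" by (rule power_mono) simp
        then show ?thesis by (simp add: power_mult_distrib)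
      qed
    qed (use g f in auto)
    then show ?thesis unfolding xf using g(2) by (rule limV[rotated])
  qed
  then have "closure D = UNIV" unfolding V_def by blast
  moreover have "D \<subseteq> span (range (\<lambda>(r, b). abs_L2 (\<lambda>x. indicator {..<r} x *\<^sub>R b)))"
  proof
    fix x assume "x \<in> D"
    then obtain l where x: "x = sum_list (map t l)" by (auto simp: D_def)
    have "t p \<in> span (range (\<lambda>(r, b). abs_L2 (\<lambda>x. indicator {..<r} x *\<^sub>R b)))" for p
    proof (cases p)
      case (fields q r b)
      have "ind {..<real_of_rat r} b \<in> range (\<lambda>(r, b). abs_L2 (\<lambda>x. indicator {..<r} x *\<^sub>R b))"
        unfolding ind_def by (rule range_eqI[of _ _ "(real_of_rat r, b)"]) simp
      then show ?thesis unfolding fields t_def by (simp add: span_scale span_base)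
    qed
    then show "x \<in> span (range (\<lambda>(r, b). abs_L2 (\<lambda>x. indicator {..<r} x *\<^sub>R b)))"
      unfolding x by (induction l) (auto intro: span_add span_zero)
  qed
  ultimately show ?thesis using cD by blast
qed

lemma L2_eq_0I:
  fixes x :: "'a::euclidean_space L2"
  assumes "\<And>r b. x \<bullet> abs_L2 (\<lambda>s. indicator {..<r} s *\<^sub>R b) = 0"
  shows "x = 0"
proof -
  let ?E = "range (\<lambda>(r, b). abs_L2 (\<lambda>s. indicator {..<r} s *\<^sub>R b)) :: 'a L2 set"
  obtain D :: "'a L2 set" where D: "closure D = UNIV" "D \<subseteq> span ?E"
    using L2_separable[where 'a='a] by blast
  have "x \<bullet> y = 0" if "y \<in> span ?E" for y
    using that
  proof (induction rule: span_induct_alt)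
    case base
    show ?case by simp
  next
    case (step c z y)
    have "x \<bullet> z = 0" using step(1) assms by auto
    then show ?case using step by (simp add: inner_add_right)
  qed
  then have "D \<subseteq> {y. x \<bullet> y = 0}" using D(2) by blast
  moreover have "closed {y. x \<bullet> y = 0}"
    by (intro closed_Collect_eq continuous_intros)
  ultimately have "closure D \<subseteq> {y. x \<bullet> y = 0}" by (rule closure_minimal)
  then have "x \<bullet> x = 0" using D(1) by blast
  then show ?thesis by simp
qed

instance L2 :: (euclidean_space) second_countable_topology
proof
  obtain D :: "'a L2 set" where D: "countable D" "closure D = UNIV"
    using L2_separable[where 'a='a] by blast
  define B where "B = (\<lambda>(d, n). ball d (inverse (real (Suc n)))) ` (D \<times> (UNIV :: nat set))"
  have "topological_basis B"
  proof (rule topological_basisI)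
    show "open b" if "b \<in> B" for b using that by (auto simp: B_def)
    fix U and x :: "'a L2" assume "open U" "x \<in> U"
    then obtain e where e: "e > 0" "ball x e \<subseteq> U" using open_contains_ball by blast
    obtain n where n: "inverse (real (Suc n)) < e/2"
      using reals_Archimedean[of "e/2"] e by auto
    have "x \<in> closure D" using D by simp
    then obtain d where d: "d \<in> D" "dist d x < inverse (real (Suc n))"
      unfolding closure_approachable by (metis inverse_positive_iff_positive of_nat_0_less_iff zero_less_Suc)
    have "ball d (inverse (real (Suc n))) \<subseteq> ball x e"
    proof
      fix y assume "y \<in> ball d (inverse (real (Suc n)))"
      then have "dist x y < e"
        using d(2) n dist_triangle[of x y d] by (simp add: dist_commute)
      then show "y \<in> ball x e" by simp
    qed
    then show "\<exists>b\<in>B. x \<in> b \<and> b \<subseteq> U"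
      using d e by (intro bexI[of _ "ball d (inverse (real (Suc n)))"]) (auto simp: B_def)
  qed
  moreover have "countable B"
    unfolding B_def using D(1) by auto
  ultimately show "\<exists>B::'a L2 set set. countable B \<and> open = generate_topology B"
    using topological_basis_imp_subbasis by blast
qed


text \<open>
  \<open>H1_rep \<phi> f \<psi>\<close>: on \<open>[-1, 0]\<close> the function \<open>f\<close> is the absolutely continuous representative of the class
  \<open>\<phi>\<close>, and its derivative is the \<open>L\<^sub>2\<close> class \<open>\<psi>\<close>.
\<close>

definition H1_rep :: "'a::euclidean_space L2 \<Rightarrow> (real \<Rightarrow> 'a) \<Rightarrow> 'a L2 \<Rightarrow> bool" where
  "H1_rep \<phi> f \<psi> \<longleftrightarrow> (AE \<theta> in delay_measure. rep_L2 \<phi> \<theta> = f \<theta>) \<and>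
     (\<forall>\<theta>\<in>{-1..0}. f \<theta> = f (-1) + (LINT s:{-1..\<theta>}|lebesgue. rep_L2 \<psi> s))"

definition H1 :: "'a::euclidean_space L2 set" where
  "H1 = {\<phi>. \<exists>f \<psi>. H1_rep \<phi> f \<psi>}"

text \<open>The next two are meaningful for \<open>\<phi> \<in> H1\<close>; see \<open>pointval_eq\<close> and \<open>weak_deriv_eq\<close> below.\<close>

definition pointval :: "'a::euclidean_space L2 \<Rightarrow> real \<Rightarrow> 'a" where
  "pointval \<phi> \<theta> = (THE c. \<exists>f \<psi>. H1_rep \<phi> f \<psi> \<and> f \<theta> = c)"

definition weak_deriv :: "'a::euclidean_space L2 \<Rightarrow> 'a L2" where
  "weak_deriv \<phi> = (THE \<psi>. \<exists>f. H1_rep \<phi> f \<psi>)"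

lemma set_integrable_rep_L2: "set_integrable lebesgue {-1..0} (rep_L2 \<psi>)"
  using sq_integrable_imp_integrable[OF finite_measure_delay sq_integrable_rep_L2]
  by (simp add: set_integrable_def integrable_restrict_space)

lemma H1_rep_integral:
  "H1_rep \<phi> f \<psi> \<Longrightarrow> \<theta> \<in> {-1..0} \<Longrightarrow> f \<theta> - f (-1) = (LINT s:{-1..\<theta>}|lebesgue. rep_L2 \<psi> s)"
  unfolding H1_rep_def by (metis add_diff_cancel_left')

lemma H1_rep_continuous_on:
  assumes "H1_rep \<phi> f \<psi>" shows "continuous_on {-1..0} f"
proof -
  have "rep_L2 \<psi> integrable_on {-1..0}"
    by (rule set_lebesgue_integral_eq_integral(1)[OF set_integrable_rep_L2])
  then have "continuous_on {-1..0} (\<lambda>\<theta>. f (-1) + integral {-1..\<theta>} (rep_L2 \<psi>))"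
    by (intro continuous_on_add continuous_on_const indefinite_integral_continuous_1)
  moreover have "f (-1) + integral {-1..\<theta>} (rep_L2 \<psi>) = f \<theta>" if "\<theta> \<in> {-1..0}" for \<theta>
  proof -
    have "set_integrable lebesgue {-1..\<theta>} (rep_L2 \<psi>)"
      by (rule set_integrable_subset[OF set_integrable_rep_L2]) (use that in auto)
    from set_lebesgue_integral_eq_integral(2)[OF this] show ?thesis
      using H1_rep_integral[OF assms that] by (simp add: algebra_simps)
  qed
  ultimately show ?thesis by (rule continuous_on_eq)
qed

lemma H1_rep_unique:
  assumes "H1_rep \<phi> f \<psi>" "H1_rep \<phi> g \<eta>"
  shows "\<theta> \<in> {-1..0} \<Longrightarrow> f \<theta> = g \<theta>" and "\<psi> = \<eta>"
proof -
  define h where "h x = f (max (-1) (min 0 x)) - g (max (-1) (min 0 x))" for x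
  have "continuous_on UNIV h"
    unfolding h_def
    by (intro continuous_intros continuous_on_compose2[OF H1_rep_continuous_on[OF assms(1)]]
        continuous_on_compose2[OF H1_rep_continuous_on[OF assms(2)]]) auto
  then have cl: "closed {x. h x = 0}"
    by (intro closed_Collect_eq continuous_intros)
  have "AE x in delay_measure. rep_L2 \<phi> x = f x" "AE x in delay_measure. rep_L2 \<phi> x = g x"
    using assms unfolding H1_rep_def by blast+
  then have "AE x in delay_measure. f x = g x"
    by eventually_elim simp
  then have "AE x in lebesgue. x \<in> {-1..0} \<longrightarrow> f x = g x"
    by (subst (asm) AE_restrict_space_iff) auto
  then have "AE x in lebesgue. x \<in> {-1<..<0} \<longrightarrow> x \<in> {x. h x = 0}"
    by eventually_elim (auto simp: h_def max_def min_def)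
  then have "{-1<..<0} \<subseteq> {x. h x = 0}"
    using mem_closed_if_AE_lebesgue_open[OF open_greaterThanLessThan cl] by blast
  then have "closure {-1<..<0} \<subseteq> {x. h x = 0}" using cl by (rule closure_minimal)
  then have "h \<theta> = 0" if "\<theta> \<in> {-1..0}" for \<theta>
    using that by auto
  then have fg: "f \<theta> = g \<theta>" if "\<theta> \<in> {-1..0}" for \<theta>
    using that by (simp add: h_def)
  then show "\<theta> \<in> {-1..0} \<Longrightarrow> f \<theta> = g \<theta>" by blast
  define d where "d s = rep_L2 \<psi> s - rep_L2 \<eta> s" for s
  have d: "sq_integrable delay_measure d"
    unfolding d_def by (intro sq_integrable_diff sq_integrable_rep_L2)
  have eq: "\<psi> - \<eta> = abs_L2 d"
    unfolding d_def by (simp add: abs_L2_diff[OF sq_integrable_rep_L2 sq_integrable_rep_L2, symmetric] abs_rep_L2)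
  have dint: "set_integrable lebesgue {-1..\<theta>} d" "(LINT s:{-1..\<theta>}|lebesgue. d s) = 0" if "\<theta> \<in> {-1..0}" for \<theta>
  proof -
    have i: "set_integrable lebesgue {-1..\<theta>} (rep_L2 \<xi>)" for \<xi> :: "'a L2"
      by (rule set_integrable_subset[OF set_integrable_rep_L2]) (use that in auto)
    show "set_integrable lebesgue {-1..\<theta>} d" unfolding d_def by (intro set_integral_diff i)
    have "f \<theta> - f (-1) = g \<theta> - g (-1)" using fg that by simp
    moreover have "f \<theta> - f (-1) = (LINT s:{-1..\<theta>}|lebesgue. rep_L2 \<psi> s)"
      "g \<theta> - g (-1) = (LINT s:{-1..\<theta>}|lebesgue. rep_L2 \<eta> s)"
      using assms that by (auto intro: H1_rep_integral)
    ultimately show "(LINT s:{-1..\<theta>}|lebesgue. d s) = 0"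
      unfolding d_def by (simp add: set_integral_diff(2)[OF i i])
  qed
  have "\<psi> - \<eta> = 0"
  proof (rule L2_eq_0I)
    fix r :: real and b :: 'a
    have sq: "sq_integrable delay_measure (\<lambda>s. indicator {..<r} s *\<^sub>R b)"
      by (rule sq_integrable_indicator) simp
    have "(\<psi> - \<eta>) \<bullet> abs_L2 (\<lambda>s. indicator {..<r} s *\<^sub>R b) =
        (LINT s|delay_measure. d s \<bullet> (indicator {..<r} s *\<^sub>R b))"
      unfolding eq using d sq by (intro inner_L2.abs_eq) auto
    also have "\<dots> = (LINT s|lebesgue. (indicator {-1..min r 0} s *\<^sub>R d s) \<bullet> b)"
    proof -
      have "(LINT s|delay_measure. d s \<bullet> (indicator {..<r} s *\<^sub>R b)) =
          (LINT s|lebesgue. indicator {-1..0} s *\<^sub>R (d s \<bullet> (indicator {..<r} s *\<^sub>R b)))"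
        by (rule integral_restrict_space) auto
      also have "\<dots> = (LINT s|lebesgue. (indicator {-1..min r 0} s *\<^sub>R d s) \<bullet> b)"
      proof (rule integral_cong_AE)
        have "AE s in lebesgue. s \<noteq> r"
          using AE_not_in[of "{r}" lebesgue] by simp
        then show "AE s in lebesgue. indicator {-1..0} s *\<^sub>R (d s \<bullet> (indicator {..<r} s *\<^sub>R b)) =
            (indicator {-1..min r 0} s *\<^sub>R d s) \<bullet> b"
          by eventually_elim (auto simp: indicator_def)
        have m1: "(\<lambda>s. d s \<bullet> (indicator {..<r} s *\<^sub>R b)) \<in> borel_measurable delay_measure"
          using sq_integrable_inner[OF d sq] by simp
        then show "(\<lambda>s. indicator {-1..0} s *\<^sub>R (d s \<bullet> (indicator {..<r} s *\<^sub>R b))) \<in> borel_measurable lebesgue"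
          by (subst (asm) borel_measurable_restrict_space_iff) (auto simp: mult.commute)
        show "(\<lambda>s. (indicator {-1..min r 0} s *\<^sub>R d s) \<bullet> b) \<in> borel_measurable lebesgue"
        proof (cases "r < -1")
          case False
          then have "min r 0 \<in> {-1..0}" by auto
          from dint(1)[OF this] have "integrable lebesgue (\<lambda>s. indicator {-1..min r 0} s *\<^sub>R d s)"
            by (simp add: set_integrable_def)
          then show ?thesis by (intro borel_measurable_integrable integrable_inner_left)
        qed auto
      qed
      finally show ?thesis .
    qed
    also have "\<dots> = 0"
    proof (cases "r < -1")
      case False
      then have r: "min r 0 \<in> {-1..0}" by auto
      have "integrable lebesgue (\<lambda>s. indicator {-1..min r 0} s *\<^sub>R d s)"
        using dint(1)[OF r] by (simp add: set_integrable_def)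
      from integral_inner_left[OF this] show ?thesis
        using dint(2)[OF r] by (simp add: set_lebesgue_integral_def)
    qed auto
    finally show "(\<psi> - \<eta>) \<bullet> abs_L2 (\<lambda>s. indicator {..<r} s *\<^sub>R b) = 0" .
  qed
  then show "\<psi> = \<eta>" by simp
qed

lemma pointval_eq: "H1_rep \<phi> f \<psi> \<Longrightarrow> \<theta> \<in> {-1..0} \<Longrightarrow> pointval \<phi> \<theta> = f \<theta>"
  unfolding pointval_def by (rule the_equality) (use H1_rep_unique(1) in blast)+

lemma weak_deriv_eq: "H1_rep \<phi> f \<psi> \<Longrightarrow> weak_deriv \<phi> = \<psi>"
  unfolding weak_deriv_def by (rule the_equality) (use H1_rep_unique(2) in blast)+


type_synonym 'n M2 = "(real ^ 'n) \<times> (real ^ 'n) L2"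

definition C0_semigroup :: "(real \<Rightarrow> 'x \<Rightarrow> 'x::real_normed_vector) \<Rightarrow> bool" where
  "C0_semigroup S \<longleftrightarrow>
     (\<forall>t\<ge>0. bounded_linear (S t)) \<and>
     S 0 = id \<and>
     (\<forall>s\<ge>0. \<forall>t\<ge>0. S (s + t) = S s \<circ> S t) \<and>
     (\<forall>x. ((\<lambda>t. S t x) \<longlongrightarrow> x) (at_right 0))"

text \<open>
  The operator \<open>A\<close> with domain \<open>D\<close> is the infinitesimal generator of the \<open>C\<^sub>0\<close>-semigroup \<open>S\<close>, that is
  \<open>S t = e\<^sup>A\<^sup>t\<close> for \<open>t \<ge> 0\<close>. The values of \<open>S\<close> at negative times are irrelevant, as are those of \<open>A\<close>
  outside \<open>D\<close>.
\<close>

definition generates ::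
  "'x set \<Rightarrow> ('x \<Rightarrow> 'x) \<Rightarrow> (real \<Rightarrow> 'x \<Rightarrow> 'x::real_normed_vector) \<Rightarrow> bool" where
  "generates D A S \<longleftrightarrow> C0_semigroup S \<and>
     (\<forall>x y. ((\<lambda>h. (S h x - x) /\<^sub>R h) \<longlongrightarrow> y) (at_right 0) \<longleftrightarrow> x \<in> D \<and> A x = y)"

definition neutral_dom :: "real ^ 'n ^ 'n \<Rightarrow> 'n::finite M2 set" where
  "neutral_dom A1 = {(v, \<phi>). \<phi> \<in> H1 \<and> v = pointval \<phi> 0 - A1 *v pointval \<phi> (-1)}"

definition neutral_op ::
  "(real \<Rightarrow> real ^ 'n ^ 'n) \<Rightarrow> (real \<Rightarrow> real ^ 'n ^ 'n) \<Rightarrow> 'n::finite M2 \<Rightarrow> 'n M2" where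
  "neutral_op A2 A3 = (\<lambda>(v, \<phi>).
     (LINT \<theta>:{-1..0}|lebesgue. A2 \<theta> *v rep_L2 (weak_deriv \<phi>) \<theta> + A3 \<theta> *v rep_L2 \<phi> \<theta>,
      weak_deriv \<phi>))"

text \<open>
  \<open>output_at C (-1)\<close> is the output \<open>C z(t - 1)\<close> and \<open>output_at C 0\<close> is the output \<open>C z(t)\<close>; both are
  used on the domain of the generator only.
\<close>

definition output_at :: "real ^ 'n ^ 'p \<Rightarrow> real \<Rightarrow> 'n::finite M2 \<Rightarrow> real ^ 'p" where
  "output_at C \<theta> = (\<lambda>(v, \<phi>). C *v pointval \<phi> \<theta>)"

text \<open>
  \<open>observation D c S T x y\<close> states that \<open>\<^bold>K x = y\<close> in \<open>L\<^sub>2(0, T)\<close>, where \<open>\<^bold>K\<close> is the extension by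
  continuity to the whole space of the map \<open>x \<longmapsto> (\<lambda>t. c (S t x))\<close> given on the dense domain \<open>D\<close>:
  \<open>y\<close> is the \<open>L\<^sub>2(0, T)\<close>-limit of outputs with initial states in \<open>D\<close> converging to \<open>x\<close>. Constant
  sequences show that it contains the outputs for \<open>x \<in> D\<close> themselves.
\<close>

definition observation ::
  "'x set \<Rightarrow> ('x \<Rightarrow> 'y) \<Rightarrow> (real \<Rightarrow> 'x \<Rightarrow> 'x::real_normed_vector) \<Rightarrow> real \<Rightarrow>
    'x \<Rightarrow> (real \<Rightarrow> 'y::euclidean_space) \<Rightarrow> bool" where
  "observation D c S T x y \<longleftrightarrow> sq_integrable (lebesgue_on {0..T}) y \<and>
     (\<exists>X. (\<forall>k. X k \<in> D \<and> sq_integrable (lebesgue_on {0..T}) (\<lambda>t. c (S t (X k)))) \<and>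
        X \<longlonglongrightarrow> x \<and>
        (\<lambda>k. LINT t:{0..T}|lebesgue. (norm (c (S t (X k)) - y t))\<^sup>2) \<longlonglongrightarrow> 0)"

definition exactly_observable ::
  "'x set \<Rightarrow> ('x \<Rightarrow> 'y::euclidean_space) \<Rightarrow> (real \<Rightarrow> 'x \<Rightarrow> 'x::real_normed_vector) \<Rightarrow> real \<Rightarrow> bool" where
  "exactly_observable D c S T \<longleftrightarrow>
     (\<exists>\<delta>>0. \<forall>x y. observation D c S T x y \<longrightarrow>
        (LINT t:{0..T}|lebesgue. (norm (y t))\<^sup>2) \<ge> \<delta>\<^sup>2 * (norm x)\<^sup>2)"

definition exactly_controllable ::
  "'x set \<Rightarrow> ('u::euclidean_space \<Rightarrow> 'x) \<Rightarrow>
    (real \<Rightarrow> 'x \<Rightarrow> 'x::{banach, second_countable_topology}) \<Rightarrow> real \<Rightarrow> bool" where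
  "exactly_controllable D b S T \<longleftrightarrow>
     {LINT t:{0..T}|lebesgue. S t (b (u t)) | u. sq_integrable (lebesgue_on {0..T}) u} = D"

end

theory Submission
  imports Defs
begin

text \<open>
  The idea is to exhibit a bounded bilinear form that turns \<open>e\<^sup>A\<^sup>t\<close> into the adjoint of the semigroup
  of the transposed system. An element of the domain of either generator is determined by
  \<open>X = (c, \<eta>)\<close> with \<open>c = \<phi>(-1)\<close> and \<open>\<eta> = \<phi>'\<close>; write \<open>x = E X\<close> for the element and \<open>A x = N X\<close>. Integration by
  parts turns the delay functional into \<open>A\<^sub>0 \<phi>(-1) + \<integral> k \<phi>'\<close>. In these coordinates the form
    \<open>\<langle>(v, \<psi>), (c, \<eta>)\<rangle> = v \<cdot> c - \<integral> (k \<psi>) \<cdot> c + \<integral> \<psi>(\<sigma>) \<cdot> \<eta>(-1 - \<sigma>) d\<sigma> - \<integral>\<integral> k(\<theta>) \<psi>(\<sigma>) \<cdot> \<eta>(\<theta> - 1 - \<sigma>) d\<sigma> d\<theta>\<close>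
  satisfies \<open>\<langle>E\<^sup>\<dagger> Y, X\<rangle>\<^sup>\<dagger> = \<langle>E X, Y\<rangle>\<close> and \<open>\<langle>N\<^sup>\<dagger> Y, X\<rangle>\<^sup>\<dagger> = \<langle>N X, Y\<rangle>\<close>, because convolution is commutative and commutes with
  integration. Hence \<open>\<langle>S\<^sup>\<dagger>(t) w, X\<rangle>\<^sup>\<dagger> = \<langle>w, X\<^sub>t\<rangle>\<^sup>\<dagger>\<close> with \<open>E X\<^sub>t = S(t) E X\<close>, and pairing the reached state with \<open>X\<close>
  gives \<open>\<integral> u(t) \<cdot> C \<phi>\<^sub>t(-1) dt\<close>. The form satisfies an inf-sup condition, so controllability implies
  observability by uniform boundedness, and the converse is a Riesz representation on the range of the
  output map.

  If \<open>A\<^sub>-\<^sub>1\<close> is invertible, the equation can be solved backwards, so \<open>S(1)\<close> and \<open>S\<^sup>\<dagger>(1)\<close> are bounded below; the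
  output \<open>C z(t)\<close> of \<open>x\<close> is the output \<open>C z(t - 1)\<close> of \<open>S(1) x\<close>.
\<close>

subsection \<open>Functional analysis and \<open>C\<^sub>0\<close>-semigroups\<close>

text \<open>The generator of the transposed system is not the Hilbert adjoint of \<open>A\<close> in
  M2, and the reachable set has to be compared with a domain instead of the whole space. Both
  obstacles are met by pairing a state with the coordinates (c, \<eta>) of a domain element: these
  range over M2 itself. The reflected argument in the convolution records that duality reverses time
  along the delay. The moment term is there because v - \<integral> k \<psi> is the quantity whose
  derivative along a solution is just A0 z(t - 1), so that the kernel drops out of the velocity;
  \<open>A1\<close> enters only through the first component of E, as a bilinear term that
  transposes. The coordinate c is z(t - 1), which is why the delayed output is the one dual to the
  input (C* u, 0). The undelayed output differs by a unit time shift, and this shift has to be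
  undone on both sides: a lower bound for \<open>S 1\<close> serves the step from controllability to
  observability, injectivity of \<open>Sd 1\<close> the converse.\<close>

lemma uniform_boundedness:
  fixes f :: "'i \<Rightarrow> 'a::banach \<Rightarrow> 'b::real_normed_vector"
  assumes lin: "\<And>i. i \<in> I \<Longrightarrow> bounded_linear (f i)"
    and pw: "\<And>x. \<exists>M. \<forall>i\<in>I. norm (f i x) \<le> M"
  shows "\<exists>M. \<forall>i\<in>I. \<forall>x. norm (f i x) \<le> M * norm x"
proof -
  define F where "F n = {x. \<forall>i\<in>I. norm (f i x) \<le> real n}" for n :: nat
  have clo: "closed (F n)" for n
  proof -
    have "F n = (\<Inter>i\<in>I. {x. norm (f i x) \<le> real n})" by (auto simp: F_def)
    moreover have "closed {x. norm (f i x) \<le> real n}" if "i \<in> I" for i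
      by (intro closed_Collect_le continuous_intros
          linear_continuous_on[OF lin[OF that], of UNIV])
    ultimately show ?thesis by auto
  qed
  have cover: "(\<Union>n. F n) = UNIV"
  proof -
    have "\<exists>n. x \<in> F n" for x
    proof -
      obtain M where M: "\<forall>i\<in>I. norm (f i x) \<le> M" using pw by blast
      obtain n where "M \<le> real n" using real_arch_simple by blast
      with M show ?thesis by (auto simp: F_def intro: order_trans)
    qed
    then show ?thesis by blast
  qed
  \<comment> \<open>Baire: countably many closed sets cover a complete space.\<close>
  have "\<exists>n. interior (F n) \<noteq> {}"
  proof (rule ccontr)
    assume "\<not> ?thesis"
    then have e: "interior (F n) = {}" for n by blast
    have "Met_TC.mtopology interior_of \<Union>(range F) = {}"
      by (rule Met_TC.metric_Baire_category_alt)
        (auto simp: e clo complete_UNIV mtopology_is_euclidean)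
    then show False using cover by simp
  qed
  then obtain n a where "a \<in> interior (F n)" by blast
  then obtain e where e: "e > 0" "cball a e \<subseteq> F n"
    using open_contains_cball[of "interior (F n)"] interior_subset[of "F n"] open_interior by blast
  show ?thesis
  proof (intro exI ballI allI)
    fix i x assume i: "i \<in> I"
    interpret bounded_linear "f i" by (rule lin[OF i])
    show "norm (f i x) \<le> 2 * real n / e * norm x"
    proof (cases "x = 0")
      case True then show ?thesis by (simp add: zero)
    next
      case False
      \<comment> \<open>Scaled so that \<open>a + y\<close> stays in the ball; writing
        \<open>f i y\<close> as the difference of the values at \<open>a + y\<close> and
        \<open>a\<close> produces the factor 2.\<close>
      define y where "y = (e / norm x) *\<^sub>R x"
      have "norm y = e" using False e by (simp add: y_def)
      then have "a + y \<in> F n" "a \<in> F n" using e by (auto simp: subset_iff dist_norm)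
      then have "norm (f i (a + y)) \<le> n" "norm (f i a) \<le> n" using i by (auto simp: F_def)
      moreover have "f i y = f i (a + y) - f i a" by (simp add: add)
      ultimately have "norm (f i y) \<le> 2 * real n"
        using norm_triangle_ineq4[of "f i (a + y)" "f i a"] by simp
      then have "e / norm x * norm (f i x) \<le> 2 * real n" using e by (simp add: y_def scaleR)
      then show ?thesis using False e by (simp add: field_simps)
    qed
  qed
qed

text \<open>\<open>u\<close> is the limit of \<open>L x\<close> along a minimising sequence of \<open>\<parallel>L x\<parallel>\<^sup>2 - 2 l x\<close>.\<close>

lemma inner_representation_on_range:
  fixes L :: "'v::real_vector \<Rightarrow> 'h::{real_inner, complete_space}" and l :: "'v \<Rightarrow> real"
  assumes L: "linear L" and l: "linear l" and bound: "\<And>x. \<bar>l x\<bar> \<le> M * norm (L x)"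
  shows "\<exists>u. \<forall>x. l x = L x \<bullet> u"
proof -
  define J where "J x = (norm (L x))\<^sup>2 - 2 * l x" for x
  have lower: "- (M\<^sup>2) \<le> J x" for x
  proof -
    have "0 \<le> (norm (L x) - M)\<^sup>2" by simp
    then show ?thesis using bound[of x] by (simp add: J_def power2_diff mult.commute) 
  qed
  define m where "m = Inf (range J)"
  have bdd: "bdd_below (range J)" using lower by (intro bdd_belowI) auto
  have mJ: "m \<le> J x" for x unfolding m_def by (intro cInf_lower bdd) auto
  have "\<exists>x. J x < m + inverse (real (Suc n))" for n
    using cInf_lessD[of "range J" "m + inverse (real (Suc n))"] unfolding m_def by auto
  then obtain X where X: "\<And>n. J (X n) < m + inverse (real (Suc n))" by metis
  \<comment> \<open>The parallelogram law; the linear part of \<open>J\<close> cancels, so almost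
    minimal values force \<open>L (X i)\<close> and \<open>L (X j)\<close> to be close.\<close>
  have par: "(norm (L x - L y))\<^sup>2 = 2 * (J x + J y - 2 * J ((1/2) *\<^sub>R (x + y)))" for x y
    unfolding J_def power2_norm_eq_inner linear_scale[OF L] linear_scale[OF l] linear_add[OF L] linear_add[OF l]
    by (simp add: inner_add_left inner_add_right inner_diff_left inner_diff_right inner_commute algebra_simps)
  have close: "(norm (L (X i) - L (X j)))\<^sup>2 \<le> 2 * (inverse (real (Suc i)) + inverse (real (Suc j)))" for i j
    unfolding par using X[of i] X[of j] mJ[of "(1/2) *\<^sub>R (X i + X j)"] by simp
  have "Cauchy (\<lambda>n. L (X n))"
  proof (rule metric_CauchyI)
    fix e :: real assume e: "e > 0"
    then obtain N where N: "inverse (real (Suc N)) < e\<^sup>2 / 4"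
      using reals_Archimedean[of "e\<^sup>2 / 4"] by auto
    have "dist (L (X i)) (L (X j)) < e" if "i \<ge> N" "j \<ge> N" for i j
    proof -
      have "inverse (real (Suc i)) \<le> inverse (real (Suc N))" "inverse (real (Suc j)) \<le> inverse (real (Suc N))"
        using that by (auto simp: divide_simps)
      then have "(norm (L (X i) - L (X j)))\<^sup>2 \<le> 4 * inverse (real (Suc N))"
        using close[of i j] by (simp only: distrib_left)
      also have "\<dots> < e\<^sup>2" using N by simp
      finally have "(norm (L (X i) - L (X j)))\<^sup>2 < e\<^sup>2" .
      then show ?thesis unfolding dist_norm by (rule power_less_imp_less_base) (use e in simp)
    qed
    then show "\<exists>N. \<forall>i\<ge>N. \<forall>j\<ge>N. dist (L (X i)) (L (X j)) < e" by blast
  qed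
  then obtain u where u: "(\<lambda>n. L (X n)) \<longlonglongrightarrow> u" using convergent_eq_Cauchy by blast
  have ineq: "0 \<le> 2 * t * (u \<bullet> L x - l x) + t\<^sup>2 * (norm (L x))\<^sup>2" for t x
  proof -
    have 1: "- inverse (real (Suc n)) \<le> 2 * t * (L (X n) \<bullet> L x - l x) + t\<^sup>2 * (norm (L x))\<^sup>2" for n
    proof -
      have "J (X n + t *\<^sub>R x) = J (X n) + (2 * t * (L (X n) \<bullet> L x - l x) + t\<^sup>2 * (norm (L x))\<^sup>2)"
        unfolding J_def power2_norm_eq_inner linear_scale[OF L] linear_scale[OF l] linear_add[OF L] linear_add[OF l]
        by (simp add: inner_add_left inner_add_right inner_commute algebra_simps power2_eq_square)
      then show ?thesis using mJ[of "X n + t *\<^sub>R x"] X[of n] by simp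
    qed
    have "(\<lambda>n. - inverse (real (Suc n))) \<longlonglongrightarrow> - 0"
      by (intro tendsto_intros LIMSEQ_inverse_real_of_nat)
    moreover have "(\<lambda>n. 2 * t * (L (X n) \<bullet> L x - l x) + t\<^sup>2 * (norm (L x))\<^sup>2)
        \<longlonglongrightarrow> 2 * t * (u \<bullet> L x - l x) + t\<^sup>2 * (norm (L x))\<^sup>2"
      by (intro tendsto_intros u)
    ultimately show ?thesis using 1 by (intro LIMSEQ_le) auto
  qed
  have "l x = L x \<bullet> u" for x
  proof -
    define d where "d = u \<bullet> L x - l x"
    \<comment> \<open>The added 1 keeps \<open>q\<close> positive when \<open>L x = 0\<close>;
      \<open>- d / q\<close> is close to the minimiser of the quadratic in t.\<close>
    define q where "q = (norm (L x))\<^sup>2 + 1"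
    have q: "q > 0" by (simp add: q_def add_nonneg_pos)
    have "0 \<le> 2 * (- d / q) * d + (- d / q)\<^sup>2 * (q - 1)"
      using ineq[of "- d / q" x] by (simp add: d_def q_def)
    also have "\<dots> = - d\<^sup>2 * (q + 1) / q\<^sup>2"
      using q by (simp add: field_simps power2_eq_square)
    finally have "d\<^sup>2 * (q + 1) / q\<^sup>2 \<le> 0" by simp
    then have "d\<^sup>2 \<le> 0" using q by (simp add: divide_le_0_iff mult_le_0_iff)
    then show ?thesis by (simp add: d_def inner_commute)
  qed
  then show ?thesis by blast
qed

section \<open>Orbits and generators of strongly continuous semigroups\<close>

lemma C0_semigroupD:
  assumes "C0_semigroup S"
  shows "t \<ge> 0 \<Longrightarrow> bounded_linear (S t)" and "S 0 = id"
    and "s \<ge> 0 \<Longrightarrow> t \<ge> 0 \<Longrightarrow> S (s + t) = S s \<circ> S t"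
    and "((\<lambda>t. S t x) \<longlongrightarrow> x) (at_right 0)"
  using assms by (auto simp: C0_semigroup_def)

text \<open>Near 0 by contradiction: unbounded operators at times t n tending to 0 would violate
  uniform boundedness, since S (t n) z converges for every z. Larger times are powers of small
  ones.\<close>

lemma C0_semigroup_locally_bounded:
  fixes S :: "real \<Rightarrow> 'x \<Rightarrow> 'x::banach"
  assumes S: "C0_semigroup S"
  shows "\<exists>M>0. \<forall>t\<in>{0..T}. \<forall>x. norm (S t x) \<le> M * norm x"
proof -
  note lin = C0_semigroupD(1)[OF S] and id = C0_semigroupD(2)[OF S]
    and add = C0_semigroupD(3)[OF S] and lim = C0_semigroupD(4)[OF S]
  have "\<exists>n. \<forall>t\<in>{0..inverse (real (Suc n))}. \<forall>x. norm (S t x) \<le> real n * norm x"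
  proof (rule ccontr)
    assume "\<not> ?thesis"
    then have "\<forall>n. \<exists>t x. t \<in> {0..inverse (real (Suc n))} \<and> real n * norm x < norm (S t x)"
      by (meson not_le)
    then obtain t x where t: "\<And>n. t n \<in> {0..inverse (real (Suc n))}"
      and x: "\<And>n. real n * norm (x n) < norm (S (t n) (x n))" by metis
    have t0: "t \<longlonglongrightarrow> 0"
      by (rule tendsto_sandwich[OF _ _ tendsto_const LIMSEQ_inverse_real_of_nat])
        (use t in auto)
    have conv: "(\<lambda>n. S (t n) z) \<longlonglongrightarrow> z" for z
    proof (rule metric_LIMSEQ_I)
      fix e :: real assume e: "e > 0"
      from tendstoD[OF lim e, of z] obtain d where d: "d > 0" "\<And>s. 0 < s \<Longrightarrow> s < d \<Longrightarrow> dist (S s z) z < e"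
        unfolding eventually_at_right_field by auto
      then have d': "dist (S s z) z < e" if "0 \<le> s" "s < d" for s
        using that e id by (cases "s = 0") auto
      obtain N where "\<And>n. n \<ge> N \<Longrightarrow> dist (t n) 0 < d" using metric_LIMSEQ_D[OF t0 d(1)] by blast
      then show "\<exists>N. \<forall>n\<ge>N. dist (S (t n) z) z < e"
        using t d' by (intro exI[of _ N]) auto
    qed
    have "\<exists>M. \<forall>n\<in>UNIV. \<forall>z. norm (S (t n) z) \<le> M * norm z"
    proof (rule uniform_boundedness)
      show "bounded_linear (S (t n))" for n using lin t[of n] by simp
      show "\<exists>M. \<forall>n\<in>UNIV. norm (S (t n) z) \<le> M" for z
        using convergent_imp_Bseq[OF convergentI[OF conv[of z]]] by (auto simp: Bseq_def)
    qed
    then obtain M where M: "\<And>n z. norm (S (t n) z) \<le> M * norm z" by blast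
    obtain n where n: "M \<le> real n" using real_arch_simple by blast
    have "norm (S (t n) (x n)) \<le> real n * norm (x n)"
      using M[of n "x n"] mult_right_mono[OF n, of "norm (x n)"] by simp
    then show False using x[of n] by simp
  qed
  then obtain n where n: "\<And>t x. t \<in> {0..inverse (real (Suc n))} \<Longrightarrow> norm (S t x) \<le> real n * norm x"
    by blast
  define c where "c = real n + 1"
  have c: "c \<ge> 1" "\<And>t x. t \<in> {0..inverse (real (Suc n))} \<Longrightarrow> norm (S t x) \<le> c * norm x"
    using n by (auto simp: c_def distrib_right intro: add_increasing2)
  have pow: "norm (S (real k * t) x) \<le> c ^ k * norm x" if t: "t \<in> {0..inverse (real (Suc n))}" for k t x
  proof (induction k)
    case 0 then show ?case by (simp add: id)
  next
    case (Suc k)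
    have "S (real (Suc k) * t) = S t \<circ> S (real k * t)"
      using add[of t "real k * t"] t by (simp add: algebra_simps)
    then have "norm (S (real (Suc k) * t) x) \<le> c * norm (S (real k * t) x)" using c(2)[OF t] by simp
    also have "\<dots> \<le> c * (c ^ k * norm x)" using Suc c(1) by (intro mult_left_mono) auto
    finally show ?case by simp
  qed
  obtain k where k: "T * real (Suc n) \<le> real k" using real_arch_simple by blast
  have "norm (S t x) \<le> c ^ Suc k * norm x" if "t \<in> {0..T}" for t x
  proof -
    have "t * real (Suc n) \<le> real (Suc k)"
    proof -
      have "t * real (Suc n) \<le> T * real (Suc n)" using that by (intro mult_right_mono) auto
      also have "\<dots> \<le> real (Suc k)" using k by simp
      finally show ?thesis .
    qed
    then have "t / real (Suc k) \<in> {0..inverse (real (Suc n))}"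
      using that by (auto simp: field_simps)
    from pow[OF this, of "Suc k" x] show ?thesis by simp
  qed
  then show ?thesis using c(1) by (intro exI[of _ "c ^ Suc k"]) auto
qed

text \<open>Continuity from the left and from the right is one estimate: the increment from the
  earlier time r to the later one factors as S r (S h x - x), and S r is bounded uniformly for r up
  to t + 1.\<close>

lemma C0_semigroup_continuous_on:
  fixes S :: "real \<Rightarrow> 'x \<Rightarrow> 'x::banach"
  assumes S: "C0_semigroup S"
  shows "continuous_on {0..} (\<lambda>t. S t x)"
proof -
  note lin = C0_semigroupD(1)[OF S] and id = C0_semigroupD(2)[OF S]
    and add = C0_semigroupD(3)[OF S] and lim = C0_semigroupD(4)[OF S]
  show ?thesis
    unfolding continuous_on_iff
  proof (intro ballI allI impI)
    fix t e :: real assume t: "t \<in> {0..}" and e: "e > 0"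
    obtain M where M: "M > 0" "\<And>s x. s \<in> {0..t+1} \<Longrightarrow> norm (S s x) \<le> M * norm x"
      using C0_semigroup_locally_bounded[OF S, of "t+1"] by blast
    from tendstoD[OF lim, of "e / M" x] e M obtain d where d: "d > 0"
      "\<And>s. 0 < s \<Longrightarrow> s < d \<Longrightarrow> dist (S s x) x < e / M"
      unfolding eventually_at_right_field by auto
    have key: "dist (S (r + h) x) (S r x) < e" if "0 \<le> r" "r \<le> t + 1" "0 \<le> h" "h < d" for r h
    proof (cases "h = 0")
      case True then show ?thesis using e by simp
    next
      case False
      then have h: "0 < h" using that by simp
      have "S (r + h) x - S r x = S r (S h x - x)"
        using add[of r h] that linear_diff[OF bounded_linear.linear[OF lin[of r]]] by simp
      then have "dist (S (r + h) x) (S r x) \<le> M * norm (S h x - x)"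
        using M(2)[of r "S h x - x"] that by (simp add: dist_norm)
      also have "\<dots> < M * (e / M)"
        using d(2)[OF h] that M by (intro mult_strict_left_mono) (auto simp: dist_norm)
      finally show ?thesis using M by simp
    qed
    have "dist (S s x) (S t x) < e" if "s \<ge> 0" "dist s t < min d 1" for s
      using key[of t "s - t"] key[of s "t - s"] that t
      by (cases "s \<le> t") (auto simp: dist_real_def dist_commute)
    then show "\<exists>d>0. \<forall>s\<in>{0..}. dist s t < d \<longrightarrow> dist (S s x) (S t x) < e"
      using d(1) by (intro exI[of _ "min d 1"]) auto
  qed
qed

text \<open>The definition of a generator provides only the right derivative at time 0. The
  semigroup law moves it to other times; for the left derivative the quotient is based at a time r <
  t, so the local bound and the continuity of s \<mapsto> S s (A x) are needed as well.\<close>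

lemma generates_orbit:
  fixes S :: "real \<Rightarrow> 'x \<Rightarrow> 'x::banach"
  assumes g: "generates D A S" and x: "x \<in> D" and t: "t \<ge> 0"
  shows "S t x \<in> D" and "A (S t x) = S t (A x)"
    and "((\<lambda>t. S t x) has_vector_derivative S t (A x)) (at t within {0..})"
proof -
  have S: "C0_semigroup S"
    and gen: "\<And>x y. ((\<lambda>h. (S h x - x) /\<^sub>R h) \<longlongrightarrow> y) (at_right 0) \<longleftrightarrow> x \<in> D \<and> A x = y"
    using g by (auto simp: generates_def)
  note lin = C0_semigroupD(1)[OF S] and add = C0_semigroupD(3)[OF S]
  have quot: "((\<lambda>h. (S h x - x) /\<^sub>R h) \<longlongrightarrow> A x) (at_right 0)" using gen x by blast
  have eq: "S r ((S h x - x) /\<^sub>R h) = (S (r + h) x - S r x) /\<^sub>R h" if "h \<ge> 0" "r \<ge> 0" for h r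
    using bounded_linear.linear[OF lin[of r]] that add[of r h]
    by (simp add: linear_diff linear_scale)
  have "((\<lambda>h. S t ((S h x - x) /\<^sub>R h)) \<longlongrightarrow> S t (A x)) (at_right 0)"
    by (rule bounded_linear.tendsto[OF lin[OF t] quot])
  moreover have "\<forall>\<^sub>F h in at_right 0. S t ((S h x - x) /\<^sub>R h) = (S h (S t x) - S t x) /\<^sub>R h"
    using eventually_at_right_less[of 0]
  proof eventually_elim
    case (elim h)
    then show ?case using eq[of h t] t add[of h t] by (simp add: add.commute)
  qed
  ultimately have "((\<lambda>h. (S h (S t x) - S t x) /\<^sub>R h) \<longlongrightarrow> S t (A x)) (at_right 0)"
    by (simp add: tendsto_cong)
  then show "S t x \<in> D" "A (S t x) = S t (A x)" using gen by blast+
  show "((\<lambda>t. S t x) has_vector_derivative S t (A x)) (at t within {0..})"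
    unfolding has_vector_derivative_def has_derivative_within_alt2
  proof (intro conjI allI impI)
    show "bounded_linear (\<lambda>u. u *\<^sub>R S t (A x))" by (rule bounded_linear_scaleR_left)
    fix e :: real assume e: "e > 0"
    obtain M where M: "M > 0" "\<And>s x. s \<in> {0..t+1} \<Longrightarrow> norm (S s x) \<le> M * norm x"
      using C0_semigroup_locally_bounded[OF S, of "t+1"] by blast
    from tendstoD[OF quot, of "e / (2 * M)"] e M obtain d where d: "d > 0"
      "\<And>h. 0 < h \<Longrightarrow> h < d \<Longrightarrow> dist ((S h x - x) /\<^sub>R h) (A x) < e / (2 * M)"
      unfolding eventually_at_right_field by auto
    have "continuous_on {0..} (\<lambda>t. S t (A x))" by (rule C0_semigroup_continuous_on[OF S])
    then obtain d' where d': "d' > 0"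
      "\<And>s. s \<in> {0..} \<Longrightarrow> dist s t < d' \<Longrightarrow> dist (S s (A x)) (S t (A x)) < e / 2"
      unfolding continuous_on_iff using t e by (metis atLeast_iff half_gt_zero)
    have key: "norm (S (r + h) x - S r x - h *\<^sub>R S t (A x)) \<le> e * h"
      if h: "0 < h" "h < d" and r: "0 \<le> r" "r \<le> t" "t \<le> r + h" "dist r t < d'" for r h
    proof -
      define q where "q = (S h x - x) /\<^sub>R h"
      have "S (r + h) x - S r x = h *\<^sub>R S r q" using eq[of h r] h r by (simp add: q_def)
      then have "S (r + h) x - S r x - h *\<^sub>R S t (A x) = h *\<^sub>R (S r (q - A x) + (S r (A x) - S t (A x)))"
        using linear_diff[OF bounded_linear.linear[OF lin[OF r(1)]]] by (simp add: algebra_simps)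
      then have "norm (S (r + h) x - S r x - h *\<^sub>R S t (A x)) \<le> h * (norm (S r (q - A x)) + norm (S r (A x) - S t (A x)))"
        using h norm_triangle_ineq by (simp add: mult_left_mono)
      also have "norm (S r (q - A x)) \<le> M * norm (q - A x)" using M(2)[of r] r by simp
      also have "\<dots> \<le> M * (e / (2 * M))" using d(2)[of h] h M(1) by (intro mult_left_mono) (auto simp: q_def dist_norm)
      also have "\<dots> = e / 2" using M(1) by simp
      also have "norm (S r (A x) - S t (A x)) \<le> e / 2" using d'(2)[of r] r by (simp add: dist_norm)
      finally show ?thesis using h by (simp add: mult.commute)
    qed
    have "norm (S s x - S t x - (s - t) *\<^sub>R S t (A x)) \<le> e * norm (s - t)"
      if s: "s \<ge> 0" "0 < dist s t" "dist s t < min d d'" for s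
    proof (cases "s < t")
      case True
      have "norm (S (s + (t - s)) x - S s x - (t - s) *\<^sub>R S t (A x)) \<le> e * (t - s)"
        using True s by (intro key) (auto simp: dist_real_def)
      moreover have "S s x - S t x - (s - t) *\<^sub>R S t (A x) = - (S (s + (t - s)) x - S s x - (t - s) *\<^sub>R S t (A x))"
        by (simp add: algebra_simps)
      ultimately show ?thesis using True by (simp only: norm_minus_cancel real_norm_def) simp
    next
      case False
      have "norm (S (t + (s - t)) x - S t x - (s - t) *\<^sub>R S t (A x)) \<le> e * (s - t)"
        using False s t d' by (intro key) (auto simp: dist_real_def)
      then show ?thesis using False by simp
    qed
    then show "\<forall>\<^sub>F s in at t within {0..}. norm (S s x - S t x - (s - t) *\<^sub>R S t (A x)) \<le> e * norm (s - t)"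
      unfolding eventually_at using d(1) d'(1) by (intro exI[of _ "min d d'"]) auto
  qed
qed

text \<open>Derivatives are handled as limits of quotients because the product rule for the pairing
  will distribute one difference over two different bilinear forms.\<close>

lemma has_vector_derivative_iff_quotient:
  "(f has_vector_derivative y) (at s within A) \<longleftrightarrow> ((\<lambda>r. (f r - f s) /\<^sub>R (r - s)) \<longlongrightarrow> y) (at s within A)"
proof -
  have eq: "norm ((1 / norm (r - s)) *\<^sub>R (f r - (f s + (r - s) *\<^sub>R y))) = norm ((f r - f s) /\<^sub>R (r - s) - y)"
    if "r \<noteq> s" for r
  proof -
    have "(f r - f s) /\<^sub>R (r - s) - y = (1 / (r - s)) *\<^sub>R (f r - (f s + (r - s) *\<^sub>R y))"
      using that by (simp add: diff_diff_eq[symmetric] scaleR_diff_right[of _ _ "_ *\<^sub>R y"] inverse_eq_divide)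
    then show ?thesis by simp
  qed
  have "(f has_vector_derivative y) (at s within A) \<longleftrightarrow>
      ((\<lambda>r. norm ((1 / norm (r - s)) *\<^sub>R (f r - (f s + (r - s) *\<^sub>R y)))) \<longlongrightarrow> 0) (at s within A)"
    unfolding has_vector_derivative_def has_derivative_within tendsto_norm_zero_iff
    by (simp add: bounded_linear_scaleR_left)
  also have "\<dots> \<longleftrightarrow> ((\<lambda>r. norm ((f r - f s) /\<^sub>R (r - s) - y)) \<longlongrightarrow> 0) (at s within A)"
  proof (rule tendsto_cong)
    have "\<forall>\<^sub>F r in at s within A. r \<noteq> s" by (simp add: eventually_at_filter)
    then show "\<forall>\<^sub>F r in at s within A. norm ((1 / norm (r - s)) *\<^sub>R (f r - (f s + (r - s) *\<^sub>R y))) =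
        norm ((f r - f s) /\<^sub>R (r - s) - y)"
      by eventually_elim (rule eq)
  qed
  also have "\<dots> \<longleftrightarrow> ((\<lambda>r. (f r - f s) /\<^sub>R (r - s)) \<longlongrightarrow> y) (at s within A)"
    unfolding tendsto_norm_zero_iff by (rule LIM_zero_iff)
  finally show ?thesis .
qed

lemma has_vector_derivative_right_quotient:
  assumes "(f has_vector_derivative y) (at t within {t..b})" "t < b"
  shows "((\<lambda>h. (f (t + h) - f t) /\<^sub>R h) \<longlongrightarrow> y) (at_right (0::real))"
proof -
  have "((\<lambda>r. (f r - f t) /\<^sub>R (r - t)) \<longlongrightarrow> y) (at_right t)"
    using assms by (simp add: has_vector_derivative_iff_quotient at_within_Icc_at_right)
  then show ?thesis by (subst (asm) filterlim_at_right_to_0) (simp add: add.commute)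
qed

text \<open>The averages of S s x over [0, h] lie in the domain and tend to x as h decreases to
  0.\<close>

lemma generates_dense:
  fixes S :: "real \<Rightarrow> 'x \<Rightarrow> 'x::banach"
  assumes g: "generates D A S"
  shows "closure D = UNIV"
proof -
  have S: "C0_semigroup S"
    and gen: "\<And>x y. ((\<lambda>h. (S h x - x) /\<^sub>R h) \<longlongrightarrow> y) (at_right 0) \<longleftrightarrow> x \<in> D \<and> A x = y"
    using g by (auto simp: generates_def)
  note lin = C0_semigroupD(1)[OF S] and id = C0_semigroupD(2)[OF S] and add = C0_semigroupD(3)[OF S]
  have "x \<in> closure D" for x
  proof -
    define G where "G t = integral {0..t} (\<lambda>s. S s x)" for t
    have cont: "continuous_on {0..b} (\<lambda>s. S s x)" for b
      by (rule continuous_on_subset[OF C0_semigroup_continuous_on[OF S]]) auto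
    have dG: "((\<lambda>h. (G (t + h) - G t) /\<^sub>R h) \<longlongrightarrow> S t x) (at_right 0)" if t: "t \<ge> 0" for t
    proof -
      have "(G has_vector_derivative S t x) (at t within {0..t+1})"
        unfolding G_def using t by (intro integral_has_vector_derivative cont) auto
      then have "(G has_vector_derivative S t x) (at t within {t..t+1})"
        by (rule has_vector_derivative_within_subset) (use t in auto)
      then show ?thesis by (rule has_vector_derivative_right_quotient) simp
    qed
    have shift: "S r (G h) = G (r + h) - G r" if "r \<ge> 0" "h \<ge> 0" for r h
    proof -
      have "S r (G h) = integral {0..h} (\<lambda>s. S r (S s x))"
        unfolding G_def
        using integral_linear[OF integrable_continuous_real[OF cont] lin[OF that(1)], of h] by (simp add: o_def)
      also have "\<dots> = integral {0..h} (\<lambda>s. S (s + r) x)"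
        by (intro integral_cong) (use add[OF that(1)] in \<open>simp add: add.commute[of _ r]\<close>)
      also have "\<dots> = integral {r..r + h} (\<lambda>s. S s x)"
        using integral_shift_Icc_real[of 0 h "\<lambda>s. S s x" r] by (simp add: o_def add.commute)
      also have "\<dots> = G (r + h) - G r"
        unfolding G_def using Henstock_Kurzweil_Integration.integral_combine[where a=0 and c=r and b="r + h" and f="\<lambda>s. S s x"] that
          integrable_continuous_real[OF cont] by (simp add: algebra_simps)
      finally show ?thesis .
    qed
    have mem: "G h /\<^sub>R k \<in> D" if h: "h \<ge> 0" for h k
    proof -
      have G0: "G 0 = 0" by (simp add: G_def)
      have "((\<lambda>r. (G (h + r) - G h) /\<^sub>R r - (G (0 + r) - G 0) /\<^sub>R r) \<longlongrightarrow> S h x - S 0 x) (at_right 0)"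
        by (intro tendsto_diff dG) (use h in auto)
      then have "((\<lambda>r. inverse k *\<^sub>R ((G (h + r) - G h) /\<^sub>R r - (G (0 + r) - G 0) /\<^sub>R r)) \<longlongrightarrow> inverse k *\<^sub>R (S h x - S 0 x)) (at_right 0)"
        by (intro tendsto_scaleR tendsto_const)
      moreover have "\<forall>\<^sub>F r in at_right 0. inverse k *\<^sub>R ((G (h + r) - G h) /\<^sub>R r - (G (0 + r) - G 0) /\<^sub>R r) = (S r (G h /\<^sub>R k) - G h /\<^sub>R k) /\<^sub>R r"
        using eventually_at_right_less[of 0]
      proof eventually_elim
        case (elim r)
        then have "G (h + r) = G r + S r (G h)" using shift[of r h] h by (simp add: add.commute)
        then show ?case using elim linear_scale[OF bounded_linear.linear[OF lin[of r]]]
          by (simp add: G0 algebra_simps)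
      qed
      ultimately have "((\<lambda>r. (S r (G h /\<^sub>R k) - G h /\<^sub>R k) /\<^sub>R r) \<longlongrightarrow> inverse k *\<^sub>R (S h x - S 0 x)) (at_right 0)"
        by (rule Lim_transform_eventually)
      then show ?thesis using gen by blast
    qed
    have "((\<lambda>h. (G (0 + h) - G 0) /\<^sub>R h) \<longlongrightarrow> S 0 x) (at_right 0)" by (rule dG) simp
    then have "((\<lambda>h. G h /\<^sub>R h) \<longlongrightarrow> x) (at_right 0)" by (simp add: G_def id)
    then show ?thesis
    proof (rule Lim_in_closed_set[OF closed_closure, rotated 2])
      show "\<forall>\<^sub>F h in at_right 0. G h /\<^sub>R h \<in> closure D"
        using eventually_at_right_less[of 0]
        by eventually_elim (use mem closure_subset in \<open>auto intro: less_imp_le\<close>)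
    qed simp
  qed
  then show ?thesis by blast
qed

section \<open>Square integrable functions on an interval\<close>

lemma set_lint_lebesgue_on:
  fixes f :: "real \<Rightarrow> 'b::{banach, second_countable_topology}"
  shows "(LINT t:{a..b}|lebesgue. f t) = (LINT t|lebesgue_on {a..b}. f t)"
  unfolding set_lebesgue_integral_def by (rule integral_restrict_space[symmetric]) simp

lemma continuous_on_measurable_lebesgue_on:
  fixes f :: "real \<Rightarrow> 'b::real_normed_vector"
  assumes "continuous_on {a..b} f"
  shows "f \<in> borel_measurable (lebesgue_on {a..b})"
proof (cases "a \<le> b")
  case True
  \<comment> \<open>Clamping the argument extends \<open>f\<close> continuously to the line.\<close>
  have "continuous_on UNIV (\<lambda>t. f (max a (min t b)))"
    by (rule continuous_on_compose2[OF assms]) (use True in \<open>auto intro!: continuous_intros\<close>)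
  then have "(\<lambda>t. f (max a (min t b))) \<in> borel_measurable borel"
    by (rule borel_measurable_continuous_onI)
  then have "(\<lambda>t. f (max a (min t b))) \<in> borel_measurable lebesgue"
    by (intro measurable_completion) simp
  then have "(\<lambda>t. f (max a (min t b))) \<in> borel_measurable (lebesgue_on {a..b})"
    by (rule measurable_restrict_space1)
  then show ?thesis by (rule measurable_cong[THEN iffD1, rotated]) auto
next
  case False
  then have "space (lebesgue_on {a..b}) = {}" by simp
  then show ?thesis by (simp add: measurable_def)
qed

lemma sq_integrable_continuous_on:
  fixes f :: "real \<Rightarrow> 'b::euclidean_space"
  assumes f: "continuous_on {a..b} f"
  shows "sq_integrable (lebesgue_on {a..b}) f"
  unfolding sq_integrable_def
proof
  interpret finite_measure "lebesgue_on {a..b}" by (rule finite_measure_lebesgue_on) simp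
  show m: "f \<in> borel_measurable (lebesgue_on {a..b})" by (rule continuous_on_measurable_lebesgue_on[OF f])
  have "bounded (f ` {a..b})" by (intro compact_imp_bounded compact_continuous_image f) simp
  then obtain M where M: "\<forall>t\<in>{a..b}. norm (f t) \<le> M" by (auto simp: bounded_iff)
  show "integrable (lebesgue_on {a..b}) (\<lambda>t. (norm (f t))\<^sup>2)"
  proof (rule integrable_const_bound[where B="M\<^sup>2"])
    show "AE t in lebesgue_on {a..b}. norm ((norm (f t))\<^sup>2) \<le> M\<^sup>2"
      by (rule AE_I2) (use M in \<open>auto intro: power_mono\<close>)
  qed (use m in measurable)
qed

lemma integral_norm_add_sq:
  fixes f g :: "'s \<Rightarrow> 'a::euclidean_space"
  assumes f: "sq_integrable M f" and g: "sq_integrable M g"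
  shows "(LINT x|M. (norm (f x + t *\<^sub>R g x))\<^sup>2) =
    (LINT x|M. (norm (f x))\<^sup>2) + 2 * t * (LINT x|M. f x \<bullet> g x) + t\<^sup>2 * (LINT x|M. (norm (g x))\<^sup>2)"
proof -
  have "(norm (f x + t *\<^sub>R g x))\<^sup>2 = (norm (f x))\<^sup>2 + 2 * t * (f x \<bullet> g x) + t\<^sup>2 * (norm (g x))\<^sup>2" for x
    unfolding power2_norm_eq_inner
    by (simp add: inner_add_left inner_add_right inner_commute algebra_simps power2_eq_square)
  moreover have "integrable M (\<lambda>x. (norm (f x))\<^sup>2)" "integrable M (\<lambda>x. (norm (g x))\<^sup>2)"
    "integrable M (\<lambda>x. f x \<bullet> g x)"
    using f g sq_integrable_inner[OF f g] by (auto simp: sq_integrable_def)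
  ultimately show ?thesis by simp
qed

lemma sq_integrable_Cauchy_Schwarz:
  fixes f g :: "'s \<Rightarrow> 'a::euclidean_space"
  assumes f: "sq_integrable M f" and g: "sq_integrable M g"
  shows "\<bar>LINT x|M. f x \<bullet> g x\<bar> \<le> sqrt (LINT x|M. (norm (f x))\<^sup>2) * sqrt (LINT x|M. (norm (g x))\<^sup>2)"
proof -
  define a where "a = (LINT x|M. (norm (f x))\<^sup>2)"
  define b where "b = (LINT x|M. f x \<bullet> g x)"
  define d where "d = (LINT x|M. (norm (g x))\<^sup>2)"
  have q: "0 \<le> a + 2 * t * b + t\<^sup>2 * d" for t
    unfolding a_def b_def d_def integral_norm_add_sq[OF f g, symmetric] by simp
  have "d \<ge> 0" by (simp add: d_def)
  have "b\<^sup>2 \<le> a * d"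
  proof (cases "d = 0")
    case True
    have "b = 0"
    proof (rule ccontr)
      assume "b \<noteq> 0"
      \<comment> \<open>At this point the affine function takes the value -1.\<close>
      then show False using q[of "- (a + 1) / (2 * b)"] True by (simp add: field_simps)
    qed
    then show ?thesis using True by simp
  next
    case False
    then have "d > 0" using \<open>d \<ge> 0\<close> by simp
    then show ?thesis using q[of "- b / d"] by (simp add: field_simps power2_eq_square)
  qed
  then have "sqrt (b\<^sup>2) \<le> sqrt (a * d)" by (rule real_sqrt_le_mono)
  then show ?thesis by (simp add: a_def b_def d_def real_sqrt_mult)
qed

text \<open>The complete space available, \<open>L2\<close>, lives over [-1, 0]; the interval [0, T]
  is carried to it by t = -T \<tau>. Since \<open>l\<close> is bounded by the norm of the output, it
  is represented on the range of the output map, whether or not that range is closed.\<close>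

lemma L2_interval_representation:
  fixes f :: "'v::real_vector \<Rightarrow> real \<Rightarrow> 'u::euclidean_space" and l :: "'v \<Rightarrow> real"
  assumes T: "T > 0" and lin: "\<And>t. t \<in> {0..T} \<Longrightarrow> linear (\<lambda>x. f x t)"
    and cont: "\<And>x. continuous_on {0..T} (f x)" and l: "linear l"
    and bound: "\<And>x. \<bar>l x\<bar> \<le> M * sqrt (LINT t:{0..T}|lebesgue. (norm (f x t))\<^sup>2)"
  shows "\<exists>u. sq_integrable (lebesgue_on {0..T}) u \<and> (\<forall>x. l x = (LINT t:{0..T}|lebesgue. u t \<bullet> f x t))"
proof -
  define g where "g x \<tau> = f x (- T * \<tau>)" for x \<tau>
  have rng: "- T * \<tau> \<in> {0..T}" if "\<tau> \<in> {-1..0}" for \<tau>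
    using that T mult_left_mono[of "-1" \<tau> T] by (auto simp: mult_nonneg_nonpos)
  have g: "sq_integrable delay_measure (g x)" for x
    unfolding g_def
    by (intro sq_integrable_continuous_on continuous_on_compose2[OF cont] continuous_intros) (use rng in auto)
  define L where "L x = abs_L2 (g x)" for x
  have linL: "linear L"
  proof
    fix x y r
    show "L (x + y) = L x + L y"
      unfolding L_def abs_L2_add[OF g g]
      by (intro abs_L2_eqI sq_integrable_add g AE_I2) (use rng linear_add[OF lin] in \<open>auto simp: g_def\<close>)
    show "L (r *\<^sub>R x) = r *\<^sub>R L x"
      unfolding L_def abs_L2_scaleR[OF g]
      by (intro abs_L2_eqI sq_integrable_scaleR g AE_I2) (use rng linear_scale[OF lin] in \<open>auto simp: g_def\<close>)
  qed
  have cov: "(LINT t:{0..T}|lebesgue. h t) = T *\<^sub>R (LINT \<tau>|delay_measure. h (- T * \<tau>))" for h :: "real \<Rightarrow> real"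
  proof -
    have ind: "indicator {0..T} (- T * \<tau>) = (indicator {-1..0} \<tau> :: real)" for \<tau>
      using T mult_le_cancel_left_pos[OF T, of "- \<tau>" 1] by (auto simp: indicator_def mult_le_0_iff)
    have "(LINT t:{0..T}|lebesgue. h t) = \<bar>-T\<bar> *\<^sub>R (LINT \<tau>|lebesgue. indicator {0..T} (0 + - T * \<tau>) *\<^sub>R h (0 + - T * \<tau>))"
      unfolding set_lebesgue_integral_def by (rule lebesgue_integral_real_affine) (use T in simp)
    also have "\<dots> = T *\<^sub>R (LINT \<tau>:{-1..0}|lebesgue. h (- T * \<tau>))"
      using T ind by (simp add: set_lebesgue_integral_def)
    finally show ?thesis by (simp add: set_lint_lebesgue_on)
  qed
  have nL: "(LINT t:{0..T}|lebesgue. (norm (f x t))\<^sup>2) = T * (norm (L x))\<^sup>2" for x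
    unfolding cov L_def norm_abs_L2[OF g] by (simp add: g_def)
  have "\<exists>u. \<forall>x. l x = L x \<bullet> u"
  proof (rule inner_representation_on_range[OF linL l])
    show "\<bar>l x\<bar> \<le> (M * sqrt T) * norm (L x)" for x
      using bound[of x] T by (simp add: nL real_sqrt_mult mult.assoc)
  qed
  then obtain u where u: "\<And>x. l x = L x \<bullet> u" by blast
  \<comment> \<open>The factor 1 / T compensates the Jacobian T of the substitution.\<close>
  define v where "v t = (1 / T) *\<^sub>R rep_L2 u (0 + (- 1 / T) * t)" for t
  have sq_v: "sq_integrable (lebesgue_on {0..T}) v"
  proof -
    let ?r = "\<lambda>s. indicator {-1..0} s *\<^sub>R rep_L2 u s"
    have i: "indicator {-1..0} (- 1 / T * t) = (indicator {0..T} t :: real)" for t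
      using T by (auto simp: indicator_def field_simps)
    have r: "?r \<in> borel_measurable lebesgue" "integrable lebesgue (\<lambda>s. (norm (?r s))\<^sup>2)"
    proof -
      have 1: "rep_L2 u \<in> borel_measurable delay_measure" "integrable delay_measure (\<lambda>s. (norm (rep_L2 u s))\<^sup>2)"
        using sq_integrable_rep_L2[of u] by (auto simp: sq_integrable_def)
      show "?r \<in> borel_measurable lebesgue"
        using 1(1) by (subst (asm) borel_measurable_restrict_space_iff) auto
      have "(norm (?r s))\<^sup>2 = indicator {-1..0} s *\<^sub>R (norm (rep_L2 u s))\<^sup>2" for s
        by (simp add: indicator_def)
      then show "integrable lebesgue (\<lambda>s. (norm (?r s))\<^sup>2)"
        using 1(2) by (simp add: integrable_restrict_space)
    qed
    have aff: "(\<lambda>t. ?r (0 + (- 1 / T) * t)) \<in> borel_measurable lebesgue"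
      using measurable_compose[OF lebesgue_affine_measurable[where c= "\<lambda>x::real. - 1 / T" and t=0] r(1)] T by simp
    have m: "v \<in> borel_measurable (lebesgue_on {0..T})"
    proof -
      have "(\<lambda>t. (1 / T) *\<^sub>R ?r (0 + (- 1 / T) * t)) \<in> borel_measurable lebesgue"
        by (rule borel_measurable_scaleR[OF borel_measurable_const aff])
      moreover have "(1 / T) *\<^sub>R ?r (0 + (- 1 / T) * t) = indicator {0..T} t *\<^sub>R v t" for t
        using i[of t] by (simp add: v_def)
      ultimately show ?thesis by (simp add: borel_measurable_restrict_space_iff)
    qed
    have "integrable lebesgue (\<lambda>t. (norm (?r (0 + (- 1 / T) * t)))\<^sup>2)"
      by (rule lebesgue_integrable_real_affine[OF r(2)]) (use T in simp)
    then have "integrable lebesgue (\<lambda>t. (1 / T)\<^sup>2 *\<^sub>R (norm (?r (0 + (- 1 / T) * t)))\<^sup>2)" by simp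
    then have "integrable lebesgue (\<lambda>t. indicator {0..T} t *\<^sub>R (norm (v t))\<^sup>2)"
    proof (rule Bochner_Integration.integrable_cong[OF refl, THEN iffD1, rotated])
      fix t
      show "(1 / T)\<^sup>2 *\<^sub>R (norm (?r (0 + (- 1 / T) * t)))\<^sup>2 = indicator {0..T} t *\<^sub>R (norm (v t))\<^sup>2"
      using i[of t] by (auto simp: v_def power_divide indicator_def)
    qed
    then have "integrable (lebesgue_on {0..T}) (\<lambda>t. (norm (v t))\<^sup>2)"
      by (simp add: integrable_restrict_space)
    then show ?thesis using m by (simp add: sq_integrable_def)
  qed
  have "l x = (LINT t:{0..T}|lebesgue. v t \<bullet> f x t)" for x
  proof -
    have "(LINT t:{0..T}|lebesgue. v t \<bullet> f x t) = T *\<^sub>R (LINT \<tau>|delay_measure. v (- T * \<tau>) \<bullet> f x (- T * \<tau>))"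
      by (rule cov)
    also have "\<dots> = T *\<^sub>R (LINT \<tau>|delay_measure. (1 / T) * (g x \<tau> \<bullet> rep_L2 u \<tau>))"
      using T by (simp add: v_def g_def inner_commute)
    also have "\<dots> = (LINT \<tau>|delay_measure. g x \<tau> \<bullet> rep_L2 u \<tau>)" using T by simp
    also have "\<dots> = L x \<bullet> abs_L2 (rep_L2 u)"
      unfolding L_def by (intro inner_L2.abs_eq[symmetric]) (auto simp: g sq_integrable_rep_L2)
    finally show ?thesis by (simp add: u abs_rep_L2)
  qed
  then show ?thesis using sq_v by blast
qed

subsection \<open>Abstract duality of observation and control\<close>

text \<open>\<open>E\<close> is a coordinate map onto the domain and \<open>N\<close> is the
  generator in these coordinates. The bound \<open>graph_norm\<close> makes \<open>E\<close> an
  isomorphism from the coordinate space onto the domain with its graph norm.\<close>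

locale parametrised_semigroup =
  fixes E N A :: "'h::{real_inner, banach, second_countable_topology} \<Rightarrow> 'h" and S :: "real \<Rightarrow> 'h \<Rightarrow> 'h"
  assumes E: "bounded_linear E" and N: "bounded_linear N"
    and graph_norm: "\<exists>K. \<forall>X. norm X \<le> K * (norm (E X) + norm (N X))"
    and generates: "generates (range E) A S" and A_E: "\<And>X. A (E X) = N X"
begin

lemma C0: "C0_semigroup S" using generates by (simp add: generates_def)

lemma S_linear: "t \<ge> 0 \<Longrightarrow> bounded_linear (S t)" using C0 by (simp add: C0_semigroup_def)

lemma S_add: "s \<ge> 0 \<Longrightarrow> t \<ge> 0 \<Longrightarrow> S (s + t) x = S s (S t x)" using C0 by (simp add: C0_semigroup_def)

lemma S_0: "S 0 x = x" using C0 by (simp add: C0_semigroup_def)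

text \<open>If \<open>E X = 0\<close>, then \<open>N X\<close> is the value of the generator at 0,
  which is 0 because the difference quotients there vanish; the graph norm leaves only
  \<open>X = 0\<close>.\<close>

lemma inj_E: "inj E"
proof (rule linear_injective_0[THEN iffD2, OF bounded_linear.linear[OF E]], intro allI impI)
  fix X assume X: "E X = 0"
  have "((\<lambda>h. (S h 0 - 0) /\<^sub>R h) \<longlongrightarrow> 0) (at_right 0)"
  proof (rule tendsto_eventually)
    show "\<forall>\<^sub>F h in at_right 0. (S h 0 - 0) /\<^sub>R h = 0"
      using eventually_at_right_less[of 0]
      by eventually_elim (use linear_0[OF bounded_linear.linear[OF S_linear]] in simp)
  qed
  then have "A 0 = 0" using generates unfolding generates_def by blast
  then have "N X = 0" using A_E[of X] X by simp
  then show "X = 0" using X graph_norm by (metis add.right_neutral mult_zero_right norm_le_zero_iff norm_zero)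
qed

definition orbit :: "real \<Rightarrow> 'h \<Rightarrow> 'h" where "orbit t X = inv E (S t (E X))"

lemma E_orbit: "t \<ge> 0 \<Longrightarrow> E (orbit t X) = S t (E X)"
  unfolding orbit_def using generates_orbit(1)[OF generates] by (intro f_inv_into_f) auto

lemma N_orbit: "t \<ge> 0 \<Longrightarrow> N (orbit t X) = S t (N X)"
  using generates_orbit(2)[OF generates, of "E X" t] by (simp add: A_E E_orbit[symmetric])

lemma orbit_0: "orbit 0 X = X"
  using inj_E by (simp add: orbit_def S_0)

lemma orbit_add: "s \<ge> 0 \<Longrightarrow> t \<ge> 0 \<Longrightarrow> orbit (s + t) X = orbit s (orbit t X)"
  by (simp add: orbit_def S_add E_orbit[unfolded orbit_def])

lemma linear_orbit: assumes t: "t \<ge> 0" shows "linear (orbit t)"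
proof
  note lin = bounded_linear.linear[OF E] bounded_linear.linear[OF S_linear[OF t]]
  show "orbit t (X + Y) = orbit t X + orbit t Y" for X Y
    using injD[OF inj_E] t by (auto simp: E_orbit linear_add[OF lin(1)] linear_add[OF lin(2)])
  show "orbit t (r *\<^sub>R X) = r *\<^sub>R orbit t X" for r X
    using injD[OF inj_E] t by (auto simp: E_orbit linear_scale[OF lin(1)] linear_scale[OF lin(2)])
qed

lemma orbit_derivative:
  "t \<ge> 0 \<Longrightarrow> ((\<lambda>t. S t (E X)) has_vector_derivative N (orbit t X)) (at t within {0..})"
  using generates_orbit(3)[OF generates, of "E X" t] by (simp add: A_E N_orbit)

lemma tendsto_of_graph:
  assumes "((\<lambda>s. E (f s)) \<longlongrightarrow> E X) F" "((\<lambda>s. N (f s)) \<longlongrightarrow> N X) F"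
  shows "(f \<longlongrightarrow> X) F"
proof -
  obtain K where K: "\<And>X. norm X \<le> K * (norm (E X) + norm (N X))" using graph_norm by blast
  have "((\<lambda>s. K * (norm (E (f s) - E X) + norm (N (f s) - N X))) \<longlongrightarrow> K * (norm (E X - E X) + norm (N X - N X))) F"
    by (intro tendsto_intros assms)
  then have "((\<lambda>s. K * (norm (E (f s) - E X) + norm (N (f s) - N X))) \<longlongrightarrow> 0) F" by simp
  then have "((\<lambda>s. f s - X) \<longlongrightarrow> 0) F"
  proof (rule Lim_null_comparison[rotated])
    show "\<forall>\<^sub>F s in F. norm (f s - X) \<le> K * (norm (E (f s) - E X) + norm (N (f s) - N X))"
      using K linear_diff[OF bounded_linear.linear[OF E]] linear_diff[OF bounded_linear.linear[OF N]]
      by (intro always_eventually) metis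
  qed
  then show ?thesis by (rule LIM_zero_cancel)
qed

text \<open>\<open>S t (E X)\<close> and \<open>S t (N X)\<close> are both continuous in t, so the
  orbit is continuous in the graph norm, that is, in coordinates.\<close>

lemma continuous_on_orbit: "continuous_on {0..} (\<lambda>t. orbit t X)"
  unfolding continuous_on_def
proof
  fix t :: real assume t: "t \<in> {0..}"
  have c: "((\<lambda>s. S s x) \<longlongrightarrow> S t x) (at t within {0..})" for x
    using C0_semigroup_continuous_on[OF C0] t by (auto simp: continuous_on_def)
  have ev: "\<forall>\<^sub>F s in at t within {0..}. s \<in> {0..}" by (simp add: eventually_at_filter)
  show "((\<lambda>s. orbit s X) \<longlongrightarrow> orbit t X) (at t within {0..})"
  proof (rule tendsto_of_graph)
    show "((\<lambda>s. E (orbit s X)) \<longlongrightarrow> E (orbit t X)) (at t within {0..})"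
      by (rule Lim_transform_eventually[OF c[of "E X"], folded E_orbit[OF t[unfolded atLeast_iff]]])
        (use ev in \<open>eventually_elim, simp add: E_orbit\<close>)
    show "((\<lambda>s. N (orbit s X)) \<longlongrightarrow> N (orbit t X)) (at t within {0..})"
      by (rule Lim_transform_eventually[OF c[of "N X"], folded N_orbit[OF t[unfolded atLeast_iff]]])
        (use ev in \<open>eventually_elim, simp add: N_orbit\<close>)
  qed
qed

end

text \<open>The coercivity assumptions are inf-sup conditions: a test vector of comparable size
  detects the norm of \<open>w\<close>. By \<beta>_B the input operator is the transpose of the
  output with respect to \<beta>d.\<close>

locale dual_semigroups =
  P: parametrised_semigroup E N A S + D: parametrised_semigroup Ed Nd Ad Sd
  for E N A :: "'h::{real_inner, banach, second_countable_topology} \<Rightarrow> 'h" and S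
    and Ed Nd Ad :: "'h \<Rightarrow> 'h" and Sd +
  fixes \<beta> \<beta>d :: "'h \<Rightarrow> 'h \<Rightarrow> real" and c :: "'h \<Rightarrow> 'u::euclidean_space" and B :: "'u \<Rightarrow> 'h" and T :: real
  assumes \<beta>: "bounded_bilinear \<beta>" and \<beta>d: "bounded_bilinear \<beta>d"
    and \<beta>_E: "\<And>X Y. \<beta>d (Ed Y) X = \<beta> (E X) Y"
    and \<beta>_N: "\<And>X Y. \<beta>d (Nd Y) X = \<beta> (N X) Y"
    and coercive: "\<exists>K. \<forall>w. \<exists>X. norm X \<le> K * norm w \<and> (norm w)\<^sup>2 \<le> \<beta> w X"
    and coercive_d: "\<exists>K. \<forall>w. \<exists>X. norm X \<le> K * norm w \<and> (norm w)\<^sup>2 \<le> \<beta>d w X"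
    and c: "bounded_linear c" and B: "bounded_linear B"
    and \<beta>_B: "\<And>u X. \<beta>d (B u) X = u \<bullet> c X"
    and T: "T > 0"
begin

lemma \<beta>d_eqI: assumes "\<And>X. \<beta>d w X = \<beta>d w' X" shows "w = w'"
proof -
  interpret \<beta>d: bounded_bilinear \<beta>d by (rule \<beta>d)
  obtain X where "(norm (w - w'))\<^sup>2 \<le> \<beta>d (w - w') X" using coercive_d by blast
  then show ?thesis using assms by (simp add: \<beta>d.diff_left)
qed

lemma adjoint_E: assumes t: "t \<ge> 0"
  shows "\<beta>d (Sd t (Ed Y)) X = \<beta>d (Ed Y) (P.orbit t X)"
proof -
  interpret \<beta>d: bounded_bilinear \<beta>d by (rule \<beta>d)
  interpret \<beta>: bounded_bilinear \<beta> by (rule \<beta>)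
  define F where "F s = \<beta>d (Sd s (Ed Y)) (P.orbit (t - s) X)" for s
  have "(F has_vector_derivative 0) (at s within {0..t})" if s: "s \<in> {0..t}" for s
  proof -
    let ?F = "at s within {0..t}"
    define p where "p r = Sd r (Ed Y)" for r
    define q where "q r = S (t - r) (E X)" for r
    have p: "p r = Ed (D.orbit r Y)" and q: "q r = E (P.orbit (t - r) X)" if "r \<in> {0..t}" for r
      using that by (auto simp: p_def q_def P.E_orbit D.E_orbit)
    have dp: "(p has_vector_derivative Nd (D.orbit s Y)) ?F"
      unfolding p_def by (rule has_vector_derivative_within_subset[OF D.orbit_derivative]) (use s in auto)
    have dq: "(q has_vector_derivative - N (P.orbit (t - s) X)) ?F"
    proof -
      have "((\<lambda>r. S (t - r) (E X)) has_vector_derivative (-1) *\<^sub>R N (P.orbit (t - s) X)) ?F"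
      proof (rule vector_diff_chain_within[of "\<lambda>r. t - r" "-1" s "{0..t}" "\<lambda>r. S r (E X)", unfolded o_def])
        show "((\<lambda>r. t - r) has_vector_derivative - 1) ?F"
          by (auto intro!: derivative_eq_intros)
        show "((\<lambda>r. S r (E X)) has_vector_derivative N (P.orbit (t - s) X)) (at (t - s) within (\<lambda>r. t - r) ` {0..t})"
          by (rule has_vector_derivative_within_subset[OF P.orbit_derivative]) (use s in auto)
      qed
      then show ?thesis by (simp add: q_def[abs_def])
    qed
    have cont: "((\<lambda>r. P.orbit (t - r) X) \<longlongrightarrow> P.orbit (t - s) X) ?F"
    proof -
      have "continuous_on {0..t} (\<lambda>r. P.orbit (t - r) X)"
        by (rule continuous_on_compose2[OF P.continuous_on_orbit]) (auto intro!: continuous_intros)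
      then show ?thesis using s by (auto simp: continuous_on_def)
    qed
    have "((\<lambda>r. \<beta>d ((p r - p s) /\<^sub>R (r - s)) (P.orbit (t - r) X) + \<beta> ((q r - q s) /\<^sub>R (r - s)) (D.orbit s Y))
        \<longlongrightarrow> \<beta>d (Nd (D.orbit s Y)) (P.orbit (t - s) X) + \<beta> (- N (P.orbit (t - s) X)) (D.orbit s Y)) ?F"
      by (intro tendsto_add \<beta>d.tendsto \<beta>.tendsto has_vector_derivative_iff_quotient[THEN iffD1] dp dq cont tendsto_const)
    then have lim: "((\<lambda>r. \<beta>d ((p r - p s) /\<^sub>R (r - s)) (P.orbit (t - r) X) + \<beta> ((q r - q s) /\<^sub>R (r - s)) (D.orbit s Y))
        \<longlongrightarrow> 0) ?F"
      by (simp add: \<beta>_N \<beta>.minus_left)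
    have eq: "(F r - F s) /\<^sub>R (r - s) =
        \<beta>d ((p r - p s) /\<^sub>R (r - s)) (P.orbit (t - r) X) + \<beta> ((q r - q s) /\<^sub>R (r - s)) (D.orbit s Y)"
      if r: "r \<in> {0..t}" for r
    proof -
      have "\<beta> (q r - q s) (D.orbit s Y) = \<beta>d (p s) (P.orbit (t - r) X) - \<beta>d (p s) (P.orbit (t - s) X)"
        using q[OF r] q[OF s] p[OF s] by (simp add: \<beta>.diff_left \<beta>_E)
      then have "F r - F s = \<beta>d (p r - p s) (P.orbit (t - r) X) + \<beta> (q r - q s) (D.orbit s Y)"
        by (simp add: F_def \<beta>d.diff_left p_def[symmetric])
      then show ?thesis
        by (simp add: \<beta>d.scaleR_left \<beta>.scaleR_left distrib_left)
    qed
    have "((\<lambda>r. (F r - F s) /\<^sub>R (r - s)) \<longlongrightarrow> 0) ?F"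
      by (rule Lim_transform_eventually[OF lim]) (use eq in \<open>simp add: eventually_at_filter\<close>)
    then have "((\<lambda>r. (F r - F s) / (r - s)) \<longlongrightarrow> 0) ?F" by (simp add: divide_inverse mult.commute)
    then show ?thesis
      unfolding has_real_derivative_iff_has_vector_derivative[symmetric] has_field_derivative_iff .
  qed
  then obtain k where "\<And>s. s \<in> {0..t} \<Longrightarrow> F s = k"
    by (rule has_vector_derivative_zero_constant[rotated]) auto
  then have "F 0 = F t" using t by simp
  then show ?thesis by (simp add: F_def D.S_0 P.orbit_0)
qed

text \<open>Extension from the dense domain; for fixed \<open>X\<close> both sides are continuous in
  \<open>w\<close>.\<close>

lemma adjoint: assumes t: "t \<ge> 0"
  shows "\<beta>d (Sd t w) X = \<beta>d w (P.orbit t X)"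
proof -
  interpret \<beta>d: bounded_bilinear \<beta>d by (rule \<beta>d)
  have "closed {w. \<beta>d (Sd t w) X = \<beta>d w (P.orbit t X)}"
    by (intro closed_Collect_eq \<beta>d.continuous_on continuous_on_const continuous_on_id
      linear_continuous_on[OF D.S_linear[OF t]])
  moreover have "range Ed \<subseteq> {w. \<beta>d (Sd t w) X = \<beta>d w (P.orbit t X)}" using adjoint_E[OF t] by auto
  ultimately have "closure (range Ed) \<subseteq> {w. \<beta>d (Sd t w) X = \<beta>d w (P.orbit t X)}" by (simp add: closure_minimal)
  then show ?thesis using generates_dense[OF D.generates] by auto
qed

definition reach :: "(real \<Rightarrow> 'u) \<Rightarrow> 'h" where "reach u = (LINT t:{0..T}|lebesgue. Sd t (B (u t)))"

text \<open>The shift serves both outputs: r = 0 will be C z(t - 1) and r = 1 will be C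
  z(t).\<close>

definition energy :: "real \<Rightarrow> 'h \<Rightarrow> real" where
  "energy r X = (LINT t:{0..T}|lebesgue. (norm (c (P.orbit (t + r) X)))\<^sup>2)"

lemma continuous_on_output: "r \<ge> 0 \<Longrightarrow> continuous_on {0..T} (\<lambda>t. c (P.orbit (t + r) X))"
  by (intro continuous_on_compose2[OF linear_continuous_on[OF c]] continuous_on_compose2[OF P.continuous_on_orbit]
      continuous_intros) auto

lemma sq_integrable_output: "r \<ge> 0 \<Longrightarrow> sq_integrable (lebesgue_on {0..T}) (\<lambda>t. c (P.orbit (t + r) X))"
  by (intro sq_integrable_continuous_on continuous_on_output)

lemma linear_output: "r \<ge> 0 \<Longrightarrow> t \<in> {0..T} \<Longrightarrow> linear (\<lambda>X. c (P.orbit (t + r) X))"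
  using linear_compose[OF P.linear_orbit bounded_linear.linear[OF c], of "t + r"] by (simp add: o_def)

text \<open>Strong continuity makes \<open>Sd t (B b)\<close> measurable in t only for a fixed
  \<open>b\<close>; expanding \<open>u t\<close> in the finite basis reduces the integrand to such
  terms.\<close>

lemma integrable_reach:
  assumes u: "sq_integrable (lebesgue_on {0..T}) u"
  shows "integrable (lebesgue_on {0..T}) (\<lambda>t. Sd t (B (u t)))"
proof -
  obtain M where M: "M > 0" "\<And>t x. t \<in> {0..T} \<Longrightarrow> norm (Sd t x) \<le> M * norm x"
    using C0_semigroup_locally_bounded[OF D.C0] by blast
  have ui: "integrable (lebesgue_on {0..T}) u"
    by (rule sq_integrable_imp_integrable[OF finite_measure_lebesgue_on u]) simp
  have "integrable (lebesgue_on {0..T}) (\<lambda>t. (u t \<bullet> b) *\<^sub>R Sd t (B b))" for b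
  proof (rule Bochner_Integration.integrable_bound)
    show "integrable (lebesgue_on {0..T}) (\<lambda>t. norm (u t \<bullet> b) * (M * norm (B b)))"
      using ui by (intro integrable_mult_left integrable_norm integrable_inner_left) 
    have "(\<lambda>t. Sd t (B b)) \<in> borel_measurable (lebesgue_on {0..T})"
      by (intro continuous_on_measurable_lebesgue_on continuous_on_subset[OF C0_semigroup_continuous_on[OF D.C0]]) auto
    then show "(\<lambda>t. (u t \<bullet> b) *\<^sub>R Sd t (B b)) \<in> borel_measurable (lebesgue_on {0..T})"
      using ui by (intro borel_measurable_scaleR) auto
    show "AE t in lebesgue_on {0..T}. norm ((u t \<bullet> b) *\<^sub>R Sd t (B b)) \<le> norm (norm (u t \<bullet> b) * (M * norm (B b)))"
      by (rule AE_I2) (use M in \<open>auto simp: abs_mult intro!: mult_left_mono\<close>)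
  qed
  then have i: "integrable (lebesgue_on {0..T}) (\<lambda>t. \<Sum>b\<in>Basis. (u t \<bullet> b) *\<^sub>R Sd t (B b))" by auto
  have "(\<Sum>b\<in>Basis. (u t \<bullet> b) *\<^sub>R Sd t (B b)) = Sd t (B (u t))" if "t \<in> {0..T}" for t
  proof -
    have lin: "linear (\<lambda>v. Sd t (B v))"
      using linear_compose[OF bounded_linear.linear[OF B] bounded_linear.linear[OF D.S_linear]] that by (simp add: o_def)
    have "Sd t (B (u t)) = Sd t (B (\<Sum>b\<in>Basis. (u t \<bullet> b) *\<^sub>R b))" by (simp add: euclidean_representation)
    also have "\<dots> = (\<Sum>b\<in>Basis. (u t \<bullet> b) *\<^sub>R Sd t (B b))"
      by (simp add: linear_sum[OF lin] linear_scale[OF lin])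
    finally show ?thesis by simp
  qed
  then show ?thesis using i by (subst Bochner_Integration.integrable_cong[OF refl]) auto
qed

lemma \<beta>d_reach:
  assumes u: "sq_integrable (lebesgue_on {0..T}) u"
  shows "\<beta>d (reach u) X = (LINT t:{0..T}|lebesgue. u t \<bullet> c (P.orbit t X))"
proof -
  interpret \<beta>d: bounded_bilinear \<beta>d by (rule \<beta>d)
  have "\<beta>d (reach u) X = (LINT t|lebesgue_on {0..T}. \<beta>d (Sd t (B (u t))) X)"
    unfolding reach_def set_lint_lebesgue_on
    by (rule integral_bounded_linear[symmetric, OF \<beta>d.bounded_linear_left integrable_reach[OF u]])
  also have "\<dots> = (LINT t|lebesgue_on {0..T}. u t \<bullet> c (P.orbit t X))"
    by (intro Bochner_Integration.integral_cong) (auto simp: adjoint \<beta>_B)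
  finally show ?thesis by (simp add: set_lint_lebesgue_on)
qed

lemma abs_\<beta>d_reach_le:
  assumes u: "sq_integrable (lebesgue_on {0..T}) u"
  shows "\<bar>\<beta>d (reach u) X\<bar> \<le> sqrt (LINT t|lebesgue_on {0..T}. (norm (u t))\<^sup>2) * sqrt (energy 0 X)"
  using sq_integrable_Cauchy_Schwarz[OF u sq_integrable_output[of 0 X]]
  by (simp add: \<beta>d_reach[OF u] energy_def set_lint_lebesgue_on)

text \<open>The functionals \<beta> (E X) with \<open>energy 0 X \<le> 1\<close> are pointwise
  bounded: if \<open>u\<close> reaches \<open>Ed Y\<close>, the value at \<open>Y\<close> is at most
  the norm of \<open>u\<close>. Uniform boundedness together with the inf-sup condition then bounds
  \<open>norm (E X)\<close>, and scaling gives the inequality.\<close>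

lemma controllable_imp_observable:
  assumes ctrl: "range Ed \<subseteq> {reach u | u. sq_integrable (lebesgue_on {0..T}) u}"
  shows "\<exists>\<delta>>0. \<forall>X. energy 0 X \<ge> \<delta>\<^sup>2 * (norm (E X))\<^sup>2"
proof -
  interpret \<beta>: bounded_bilinear \<beta> by (rule \<beta>)
  obtain K where K: "\<And>w. \<exists>X. norm X \<le> K * norm w \<and> (norm w)\<^sup>2 \<le> \<beta> w X" using coercive by blast
  have "\<exists>M. \<forall>X\<in>{X. energy 0 X \<le> 1}. \<forall>Y. norm (\<beta> (E X) Y) \<le> M * norm Y"
  proof (rule uniform_boundedness)
    show "bounded_linear (\<beta> (E X))" for X by (rule \<beta>.bounded_linear_right)
    fix Y
    obtain u where u: "sq_integrable (lebesgue_on {0..T}) u" "Ed Y = reach u" using ctrl by blast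
    have "norm (\<beta> (E X) Y) \<le> sqrt (LINT t|lebesgue_on {0..T}. (norm (u t))\<^sup>2)" if "energy 0 X \<le> 1" for X
    proof -
      have "norm (\<beta> (E X) Y) \<le> sqrt (LINT t|lebesgue_on {0..T}. (norm (u t))\<^sup>2) * sqrt (energy 0 X)"
        using abs_\<beta>d_reach_le[OF u(1), of X] by (simp add: u(2)[symmetric] \<beta>_E)
      also have "\<dots> \<le> sqrt (LINT t|lebesgue_on {0..T}. (norm (u t))\<^sup>2) * 1"
        using that by (intro mult_left_mono) auto
      finally show ?thesis by simp
    qed
    then show "\<exists>M. \<forall>X\<in>{X. energy 0 X \<le> 1}. norm (\<beta> (E X) Y) \<le> M" by blast
  qed
  then obtain M where M: "\<And>X Y. energy 0 X \<le> 1 \<Longrightarrow> norm (\<beta> (E X) Y) \<le> M * norm Y" by blast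
  define L where "L = \<bar>M\<bar> * \<bar>K\<bar> + 1"
  have L: "L > 0" by (simp add: L_def add_nonneg_pos)
  have le: "norm (E X) \<le> L" if X: "energy 0 X \<le> 1" for X
  proof -
    obtain Y where Y: "norm Y \<le> K * norm (E X)" "(norm (E X))\<^sup>2 \<le> \<beta> (E X) Y" using K by blast
    have "(norm (E X))\<^sup>2 \<le> M * norm Y" using Y(2) M[OF X, of Y] by simp
    also have "\<dots> \<le> \<bar>M\<bar> * norm Y" by (intro mult_right_mono) auto
    also have "\<dots> \<le> \<bar>M\<bar> * (\<bar>K\<bar> * norm (E X))"
      by (intro mult_left_mono order_trans[OF Y(1) mult_right_mono]) auto
    also have "\<dots> \<le> L * norm (E X)" by (simp add: L_def distrib_right)
    finally show ?thesis using L by (cases "E X = 0") (auto simp: power2_eq_square)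
  qed
  have scale: "energy 0 (r *\<^sub>R X) = r\<^sup>2 * energy 0 X" for r X
  proof -
    have "(norm (c (P.orbit t (r *\<^sub>R X))))\<^sup>2 = r\<^sup>2 * (norm (c (P.orbit t X)))\<^sup>2" if "t \<in> {0..T}" for t
      using linear_scale[OF linear_output[of 0 t]] that by (simp add: power_mult_distrib)
    then have "energy 0 (r *\<^sub>R X) = (LINT t|lebesgue_on {0..T}. r\<^sup>2 * (norm (c (P.orbit t X)))\<^sup>2)"
      unfolding energy_def set_lint_lebesgue_on
      by (intro Bochner_Integration.integral_cong) auto
    then show ?thesis by (simp add: energy_def set_lint_lebesgue_on)
  qed
  have "(norm (E X))\<^sup>2 \<le> L\<^sup>2 * energy 0 X" for X
  proof (rule field_le_epsilon)
    fix e :: real assume e: "e > 0"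
    \<comment> \<open>The extra term keeps the scaling factor positive when the energy is 0; divided
      by \<open>L\<^sup>2\<close>, it reappears as exactly \<open>e\<close> in the end.\<close>
    define h where "h = energy 0 X + e / L\<^sup>2"
    have en: "energy 0 X \<ge> 0" by (simp add: energy_def set_lint_lebesgue_on)
    have h: "h > 0" using e L en by (simp add: h_def add_nonneg_pos)
    have "energy 0 ((1 / sqrt h) *\<^sub>R X) \<le> 1"
      using h e L by (simp add: scale power_divide h_def)
    from le[OF this] have "norm (E X) \<le> L * sqrt h"
      using h by (simp add: linear_scale[OF bounded_linear.linear[OF P.E]] divide_simps mult.commute)
    then have "(norm (E X))\<^sup>2 \<le> (L * sqrt h)\<^sup>2" by (rule power_mono) simp
    also have "\<dots> = L\<^sup>2 * energy 0 X + e" using h L by (simp add: power_mult_distrib h_def distrib_left)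
    finally show "(norm (E X))\<^sup>2 \<le> L\<^sup>2 * energy 0 X + e" .
  qed
  then show ?thesis using L by (intro exI[of _ "1 / L"]) (simp add: power_divide divide_simps mult.commute)
qed

lemma functional_as_output:
  assumes r: "r \<ge> 0" and obs: "\<delta> > 0" "\<And>X. energy r X \<ge> \<delta>\<^sup>2 * (norm (E X))\<^sup>2"
    and l: "linear l" and bound: "\<And>X. \<bar>l X\<bar> \<le> M * norm (E X)"
  shows "\<exists>u. sq_integrable (lebesgue_on {0..T}) u \<and>
    (\<forall>X. l X = (LINT t:{0..T}|lebesgue. u t \<bullet> c (P.orbit (t + r) X)))"
proof (rule L2_interval_representation[OF T linear_output[OF r] continuous_on_output[OF r] l])
  fix X
  have "\<delta> * norm (E X) \<le> sqrt (energy r X)"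
    using obs by (intro real_le_rsqrt) (simp add: power_mult_distrib)
  then have "norm (E X) \<le> sqrt (energy r X) / \<delta>" using obs(1) by (simp add: field_simps)
  then have "\<bar>M\<bar> * norm (E X) \<le> \<bar>M\<bar> * (sqrt (energy r X) / \<delta>)" by (intro mult_left_mono) auto
  moreover have "M * norm (E X) \<le> \<bar>M\<bar> * norm (E X)" by (intro mult_right_mono) auto
  ultimately show "\<bar>l X\<bar> \<le> (\<bar>M\<bar> / \<delta>) * sqrt (LINT t:{0..T}|lebesgue. (norm (c (P.orbit (t + r) X)))\<^sup>2)"
    using bound[of X] by (simp add: energy_def)
qed

text \<open>With \<beta> w written as the inner product with \<open>G w\<close>, the inf-sup
  condition bounds \<open>w\<close> by \<open>G w\<close>. A bounded functional of \<open>w\<close>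
  is therefore bounded by \<open>G w\<close> and is an inner product on the range of
  \<open>G\<close>.\<close>

lemma \<beta>_represents:
  assumes "bounded_linear l"
  shows "\<exists>Y. \<forall>w. l w = \<beta> w Y"
proof -
  interpret \<beta>: bounded_bilinear \<beta> by (rule \<beta>)
  have riesz: "\<exists>u. \<forall>x. f x = x \<bullet> u" if f: "bounded_linear f" for f :: "'h \<Rightarrow> real"
  proof -
    obtain M where "\<And>x. norm (f x) \<le> norm x * M" using bounded_linear.bounded[OF f] by blast
    then show ?thesis
      by (intro inner_representation_on_range[of "\<lambda>x. x" f M] bounded_linear.linear[OF f])
        (auto simp: mult.commute linear_id[unfolded id_def])
  qed
  have "\<exists>u. \<forall>Y. \<beta> w Y = Y \<bullet> u" for w by (rule riesz[OF \<beta>.bounded_linear_right])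
  then obtain G where G: "\<And>w Y. \<beta> w Y = Y \<bullet> G w" by metis
  have linG: "linear G"
  proof
    fix x y r
    have "Y \<bullet> G (x + y) = Y \<bullet> (G x + G y)" "Y \<bullet> G (r *\<^sub>R x) = Y \<bullet> (r *\<^sub>R G x)" for Y
      by (simp_all add: inner_add_right G[symmetric] \<beta>.add_left \<beta>.scaleR_left)
    then show "G (x + y) = G x + G y" "G (r *\<^sub>R x) = r *\<^sub>R G x" using vector_eq_ldot by blast+
  qed
  obtain K where K: "\<And>w. \<exists>X. norm X \<le> K * norm w \<and> (norm w)\<^sup>2 \<le> \<beta> w X" using coercive by blast
  have GK: "norm w \<le> \<bar>K\<bar> * norm (G w)" for w
  proof -
    obtain X where X: "norm X \<le> K * norm w" "(norm w)\<^sup>2 \<le> \<beta> w X" using K by blast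
    have "(norm w)\<^sup>2 \<le> norm X * norm (G w)" using X(2) norm_cauchy_schwarz[of X "G w"] by (simp add: G)
    also have "\<dots> \<le> (\<bar>K\<bar> * norm w) * norm (G w)"
      by (intro mult_right_mono order_trans[OF X(1)]) auto
    finally show ?thesis by (cases "w = 0") (auto simp: power2_eq_square)
  qed
  obtain M where M: "\<And>x. norm (l x) \<le> norm x * M" "M \<ge> 0" using bounded_linear.nonneg_bounded[OF assms] by blast
  have "\<exists>Y. \<forall>w. l w = G w \<bullet> Y"
  proof (rule inner_representation_on_range[OF linG bounded_linear.linear[OF assms]])
    show "\<bar>l w\<bar> \<le> (M * \<bar>K\<bar>) * norm (G w)" for w
      using M(1)[of w] mult_right_mono[OF GK[of w] M(2)] by (simp add: mult_ac)
  qed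
  then show ?thesis by (simp add: G inner_commute)
qed

text \<open>
  By admissibility \<open>X \<mapsto> \<beta>d (reach u) X\<close> is bounded in terms of \<open>E X\<close>, hence of the form \<open>\<beta> (E X) Z\<close>;
  this \<open>Z\<close> parametrises the reached state.
\<close>

lemma reach_in_domain:
  assumes adm: "\<And>X. energy 0 X \<le> K * (norm (E X))\<^sup>2"
    and u: "sq_integrable (lebesgue_on {0..T}) u"
  shows "reach u \<in> range Ed"
proof -
  interpret \<beta>d: bounded_bilinear \<beta>d by (rule \<beta>d)
  have b: "norm (\<beta>d (reach u) X) \<le> (sqrt (LINT t|lebesgue_on {0..T}. (norm (u t))\<^sup>2) * sqrt \<bar>K\<bar>) * norm (E X)" for X
  proof -
    have "norm (\<beta>d (reach u) X) \<le> sqrt (LINT t|lebesgue_on {0..T}. (norm (u t))\<^sup>2) * sqrt (energy 0 X)"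
      using abs_\<beta>d_reach_le[OF u] by simp
    also have "\<dots> \<le> sqrt (LINT t|lebesgue_on {0..T}. (norm (u t))\<^sup>2) * sqrt (\<bar>K\<bar> * (norm (E X))\<^sup>2)"
      by (intro mult_left_mono real_sqrt_le_mono order_trans[OF adm] mult_right_mono) auto
    finally show ?thesis by (simp add: real_sqrt_mult mult_ac)
  qed
  have "\<exists>Y. \<forall>X. \<beta>d (reach u) X = E X \<bullet> Y"
    by (rule inner_representation_on_range[OF bounded_linear.linear[OF P.E] bounded_linear.linear[OF \<beta>d.bounded_linear_right]])
      (use b in simp)
  then obtain Y where Y: "\<And>X. \<beta>d (reach u) X = E X \<bullet> Y" by blast
  obtain Z where "\<And>w. w \<bullet> Y = \<beta> w Z" using \<beta>_represents[OF bounded_linear_inner_left, of Y] by blast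
  then have "\<beta>d (reach u) X = \<beta>d (Ed Z) X" for X using Y by (simp add: \<beta>_E)
  then have "reach u = Ed Z" by (rule \<beta>d_eqI)
  then show ?thesis by simp
qed

text \<open>The target of the representation is \<open>Sd r (Ed Y)\<close> instead of
  \<open>Ed Y\<close>: the adjoint identity moves the shift of the output onto the reached state, so
  the control found satisfies \<open>Sd r (reach u) = Sd r (Ed Y)\<close>, and injectivity removes
  the shift. The case r = 0 is the unshifted duality.\<close>

lemma observable_shift_imp_controllable:
  assumes r: "r \<ge> 0" and obs: "\<delta> > 0" "\<And>X. energy r X \<ge> \<delta>\<^sup>2 * (norm (E X))\<^sup>2"
    and inj: "inj (Sd r)"
  shows "range Ed \<subseteq> {reach u | u. sq_integrable (lebesgue_on {0..T}) u}"
proof clarify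
  fix Y
  interpret \<beta>d: bounded_bilinear \<beta>d by (rule \<beta>d)
  interpret \<beta>: bounded_bilinear \<beta> by (rule \<beta>)
  interpret Sr: bounded_linear "S r" by (rule P.S_linear[OF r])
  define l where "l X = \<beta>d (Sd r (Ed Y)) X" for X
  have l: "l X = \<beta> (S r (E X)) Y" for X
    using adjoint_E[OF r] r by (simp add: l_def \<beta>_E P.E_orbit)
  obtain M where M: "\<And>a b. norm (\<beta> a b) \<le> norm a * norm b * M" "M \<ge> 0" using \<beta>.nonneg_bounded by blast
  obtain M' where M': "\<And>a. norm (S r a) \<le> norm a * M'" using Sr.bounded by blast
  have "\<exists>u. sq_integrable (lebesgue_on {0..T}) u \<and>
    (\<forall>X. l X = (LINT t:{0..T}|lebesgue. u t \<bullet> c (P.orbit (t + r) X)))"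
  proof (rule functional_as_output[OF r obs])
    show "linear l" unfolding l_def by (rule bounded_linear.linear[OF \<beta>d.bounded_linear_right])
    show "\<bar>l X\<bar> \<le> (M' * norm Y * M) * norm (E X)" for X
    proof -
      have "\<bar>l X\<bar> \<le> norm (S r (E X)) * norm Y * M" using M(1)[of "S r (E X)" Y] by (simp add: l)
      also have "\<dots> \<le> (norm (E X) * M') * norm Y * M" using M' M(2) by (intro mult_right_mono) auto
      finally show ?thesis by (simp add: mult_ac)
    qed
  qed
  then obtain u where u: "sq_integrable (lebesgue_on {0..T}) u"
    "\<And>X. l X = (LINT t:{0..T}|lebesgue. u t \<bullet> c (P.orbit (t + r) X))" by blast
  have "\<beta>d (Sd r (Ed Y)) X = \<beta>d (Sd r (reach u)) X" for X
  proof -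
    have "l X = (LINT t|lebesgue_on {0..T}. u t \<bullet> c (P.orbit t (P.orbit r X)))"
      unfolding u(2) set_lint_lebesgue_on
      by (intro Bochner_Integration.integral_cong) (use r in \<open>auto simp: P.orbit_add\<close>)
    also have "\<dots> = \<beta>d (reach u) (P.orbit r X)" by (simp add: \<beta>d_reach[OF u(1)] set_lint_lebesgue_on)
    also have "\<dots> = \<beta>d (Sd r (reach u)) X" by (simp add: adjoint[OF r])
    finally show ?thesis by (simp add: l_def)
  qed
  then have "Sd r (Ed Y) = Sd r (reach u)" by (rule \<beta>d_eqI)
  then have "Ed Y = reach u" using inj by (simp add: inj_eq)
  then show "\<exists>u'. Ed Y = reach u' \<and> sq_integrable (lebesgue_on {0..T}) u'" using u(1) by blast
qed

lemma observable_iff_controllable: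
  assumes adm: "\<And>X. energy 0 X \<le> K * (norm (E X))\<^sup>2"
  shows "(\<exists>\<delta>>0. \<forall>X. energy 0 X \<ge> \<delta>\<^sup>2 * (norm (E X))\<^sup>2) \<longleftrightarrow>
    {reach u | u. sq_integrable (lebesgue_on {0..T}) u} = range Ed"
proof
  assume "\<exists>\<delta>>0. \<forall>X. energy 0 X \<ge> \<delta>\<^sup>2 * (norm (E X))\<^sup>2"
  moreover have "inj (Sd 0)" by (rule injI) (simp add: D.S_0)
  ultimately have "range Ed \<subseteq> {reach u | u. sq_integrable (lebesgue_on {0..T}) u}"
    using observable_shift_imp_controllable[of 0] by auto
  then show "{reach u | u. sq_integrable (lebesgue_on {0..T}) u} = range Ed"
    using reach_in_domain[OF adm] by auto
qed (use controllable_imp_observable in auto)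

text \<open>The direction towards observability uses that \<open>energy r X\<close> is the unshifted
  energy of the orbit point at time r; passing back to \<open>E X\<close> costs the lower bound of
  \<open>S r\<close>.\<close>

lemma observable_shift_iff_controllable:
  assumes adm: "\<And>X. energy 0 X \<le> K * (norm (E X))\<^sup>2" and r: "r \<ge> 0"
    and below: "\<And>X. norm (E X) \<le> K' * norm (S r (E X))" and inj: "inj (Sd r)"
  shows "(\<exists>\<delta>>0. \<forall>X. energy r X \<ge> \<delta>\<^sup>2 * (norm (E X))\<^sup>2) \<longleftrightarrow>
    {reach u | u. sq_integrable (lebesgue_on {0..T}) u} = range Ed"
proof
  assume "\<exists>\<delta>>0. \<forall>X. energy r X \<ge> \<delta>\<^sup>2 * (norm (E X))\<^sup>2"
  then have "range Ed \<subseteq> {reach u | u. sq_integrable (lebesgue_on {0..T}) u}"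
    using observable_shift_imp_controllable[OF r _ _ inj] by auto
  then show "{reach u | u. sq_integrable (lebesgue_on {0..T}) u} = range Ed"
    using reach_in_domain[OF adm] by auto
next
  assume "{reach u | u. sq_integrable (lebesgue_on {0..T}) u} = range Ed"
  then obtain \<delta> where \<delta>: "\<delta> > 0" "\<And>X. energy 0 X \<ge> \<delta>\<^sup>2 * (norm (E X))\<^sup>2"
    using controllable_imp_observable by auto
  define k where "k = \<bar>K'\<bar> + 1"
  have k: "k > 0" by (simp add: k_def add_nonneg_pos)
  have "(\<delta> / k)\<^sup>2 * (norm (E X))\<^sup>2 \<le> energy r X" for X
  proof -
    have en: "energy r X = energy 0 (P.orbit r X)"
      unfolding energy_def set_lint_lebesgue_on
      by (intro Bochner_Integration.integral_cong) (use r in \<open>auto simp: P.orbit_add\<close>)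
    have "norm (E X) \<le> k * norm (S r (E X))"
      by (rule order_trans[OF below mult_right_mono]) (auto simp: k_def)
    then have "(norm (E X) / k)\<^sup>2 \<le> (norm (S r (E X)))\<^sup>2"
      using k by (intro power_mono) (auto simp: field_simps)
    then have "\<delta>\<^sup>2 * (norm (E X) / k)\<^sup>2 \<le> \<delta>\<^sup>2 * (norm (S r (E X)))\<^sup>2" by (intro mult_left_mono) auto
    also have "\<dots> \<le> energy r X" using \<delta>(2)[of "P.orbit r X"] r by (simp add: en P.E_orbit)
    finally show ?thesis by (simp add: power_divide)
  qed
  then show "\<exists>\<delta>>0. \<forall>X. energy r X \<ge> \<delta>\<^sup>2 * (norm (E X))\<^sup>2" using \<delta>(1) k by (intro exI[of _ "\<delta> / k"]) auto
qed

end

subsection \<open>Convolution and Hankel forms on the delay interval\<close>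

lemma norm_matrix_vector_le:
  fixes M :: "real ^ 'n ^ 'm"
  shows "norm (M *v x) \<le> norm M * norm x"
proof -
  have "norm (M *v x) = L2_set (\<lambda>i. norm ((M *v x) $ i)) UNIV" by (simp add: norm_vec_def)
  also have "\<dots> \<le> L2_set (\<lambda>i. norm (M $ i) * norm x) UNIV"
  proof (rule L2_set_mono)
    fix i
    have "(M *v x) $ i = M $ i \<bullet> x" by (rule matrix_vector_mul_component)
    then show "norm ((M *v x) $ i) \<le> norm (M $ i) * norm x" by (simp add: Cauchy_Schwarz_ineq2)
  qed simp
  also have "\<dots> = norm M * norm x" by (simp add: norm_vec_def L2_set_left_distrib)
  finally show ?thesis .
qed

lemma bounded_bilinear_matrix_vector: "bounded_bilinear (\<lambda>(M :: real ^ 'n ^ 'm) x. M *v x)"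
proof
  show "\<exists>K. \<forall>M x. norm (M *v x) \<le> norm (M :: real ^ 'n ^ 'm) * norm x * K"
    by (intro exI[of _ 1] allI) (simp add: norm_matrix_vector_le)
qed (auto simp: matrix_vector_mult_def vec_eq_iff sum.distrib sum_distrib_left algebra_simps)

interpretation mv: bounded_bilinear "\<lambda>(M :: real ^ 'n ^ 'm) x. M *v x"
  by (rule bounded_bilinear_matrix_vector)

lemma inner_matrix_vector: "(M *v x) \<bullet> y = x \<bullet> (transpose M *v (y :: real ^ 'm))"
  for M :: "real ^ 'n ^ 'm"
  by (metis dot_lmul_matrix inner_commute transpose_matrix_vector)

lemma borel_measurable_matrix_vector [measurable (raw)]:
  fixes f :: "'s \<Rightarrow> real ^ 'n ^ 'm"
  assumes "f \<in> borel_measurable M" "g \<in> borel_measurable M"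
  shows "(\<lambda>x. f x *v g x) \<in> borel_measurable M"
  by (rule borel_measurable_continuous_Pair[OF assms]) (intro mv.continuous_on continuous_intros)

lemma bounded_linear_transpose: "bounded_linear (transpose :: real ^ 'n ^ 'm \<Rightarrow> _)"
  by (rule linear_conv_bounded_linear[THEN iffD1]) (auto simp: linear_iff transpose_def vec_eq_iff)

lemma norm_transpose: "norm (transpose M) = norm (M :: real ^ 'n ^ 'm)"
proof -
  have sq: "(norm M)\<^sup>2 = (\<Sum>i\<in>UNIV. \<Sum>j\<in>UNIV. (M $ i $ j)\<^sup>2)" for M :: "real ^ 'a ^ 'b"
    unfolding power2_norm_eq_inner inner_vec_def by (simp add: power2_eq_square)
  have "(norm (transpose M))\<^sup>2 = (\<Sum>i\<in>UNIV. \<Sum>j\<in>UNIV. (M $ j $ i)\<^sup>2)"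
    unfolding sq by (simp add: transpose_def)
  also have "\<dots> = (norm M)\<^sup>2" unfolding sq by (rule sum.swap)
  finally have "(norm (transpose M))\<^sup>2 = (norm M)\<^sup>2" .
  then show ?thesis by simp
qed

text \<open>Functions are kept on the whole line and vanish off [-1, 0], so that reflection and
  Fubini apply on \<open>lborel\<close> without tracking domains of integration.\<close>

definition delay_fun :: "(real \<Rightarrow> 'a::euclidean_space) \<Rightarrow> bool" where
  "delay_fun f \<longleftrightarrow> sq_integrable lborel f \<and> (\<forall>x. x \<notin> {-1..0} \<longrightarrow> f x = 0)"

definition nrm2 :: "(real \<Rightarrow> 'a::euclidean_space) \<Rightarrow> real" where
  "nrm2 f = sqrt (LINT x|lborel. (norm (f x))\<^sup>2)"

lemma delay_fun_measurable [measurable_dest]: "delay_fun f \<Longrightarrow> f \<in> borel_measurable borel"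
  by (simp add: delay_fun_def sq_integrable_def)

lemma delay_fun_sq: "delay_fun f \<Longrightarrow> sq_integrable lborel f"
  by (simp add: delay_fun_def)

lemma delay_fun_zero: "delay_fun f \<Longrightarrow> x \<notin> {-1..0} \<Longrightarrow> f x = 0"
  by (simp add: delay_fun_def)

lemma nrm2_nonneg [simp]: "nrm2 f \<ge> 0" by (simp add: nrm2_def)

lemma nrm2_sq: "(nrm2 f)\<^sup>2 = (LINT x|lborel. (norm (f x))\<^sup>2)" by (simp add: nrm2_def)

lemma nrm2_mono:
  assumes "sq_integrable lborel g" "f \<in> borel_measurable borel" "\<And>x. norm (f x) \<le> C * norm (g x)" "C \<ge> 0"
  shows "sq_integrable lborel f" and "nrm2 f \<le> C * nrm2 g"
proof -
  have i: "integrable lborel (\<lambda>x. C\<^sup>2 * (norm (g x))\<^sup>2)" using assms(1) by (simp add: sq_integrable_def)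
  have le: "(norm (f x))\<^sup>2 \<le> C\<^sup>2 * (norm (g x))\<^sup>2" for x
    using power_mono[OF assms(3), of x 2] by (simp add: power_mult_distrib)
  have i': "integrable lborel (\<lambda>x. (norm (f x))\<^sup>2)"
    by (rule Bochner_Integration.integrable_bound[OF i]) (use assms(2) le in auto)
  then show "sq_integrable lborel f" using assms(2) by (simp add: sq_integrable_def)
  have "(LINT x|lborel. (norm (f x))\<^sup>2) \<le> (LINT x|lborel. C\<^sup>2 * (norm (g x))\<^sup>2)"
    by (rule integral_mono[OF i' i le])
  then have "(LINT x|lborel. (norm (f x))\<^sup>2) \<le> C\<^sup>2 * (LINT x|lborel. (norm (g x))\<^sup>2)" by simp
  then have "nrm2 f \<le> sqrt (C\<^sup>2 * (LINT x|lborel. (norm (g x))\<^sup>2))" unfolding nrm2_def by (rule real_sqrt_le_mono)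
  then show "nrm2 f \<le> C * nrm2 g" using assms(4) by (simp add: nrm2_def real_sqrt_mult)
qed

lemma delay_fun_bounded:
  assumes "f \<in> borel_measurable borel" "\<And>x. norm (f x) \<le> C" "\<And>x. x \<notin> {-1..0} \<Longrightarrow> f x = 0" "C \<ge> 0"
  shows "delay_fun f" and "nrm2 f \<le> C"
proof -
  have q: "(\<lambda>x. (norm (indicator {-1..0} x :: real))\<^sup>2) = indicator {-1..0}"
    by (auto simp: indicator_def fun_eq_iff)
  have 1: "sq_integrable lborel (indicator {-1..0} :: real \<Rightarrow> real)"
    unfolding sq_integrable_def q by simp
  have 2: "norm (f x) \<le> C * norm (indicator {-1..0} x :: real)" for x
    using assms(2,3) by (auto simp: indicator_def)
  show "delay_fun f" using nrm2_mono(1)[OF 1 assms(1) 2 assms(4)] assms(3) by (simp add: delay_fun_def)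
  have "nrm2 (indicator {-1..0} :: real \<Rightarrow> real) = 1" unfolding nrm2_def q by simp
  then show "nrm2 f \<le> C" using nrm2_mono(2)[OF 1 assms(1) 2 assms(4)] by simp
qed

lemma abs_inner_le_nrm2:
  assumes "sq_integrable lborel f" "sq_integrable lborel g"
  shows "\<bar>LINT x|lborel. f x \<bullet> g x\<bar> \<le> nrm2 f * nrm2 g"
  unfolding nrm2_def by (rule sq_integrable_Cauchy_Schwarz[OF assms])

text \<open>Cauchy-Schwarz against the indicator of an interval of length 1, hence the constant
  1.\<close>

lemma delay_fun_integrable:
  assumes f: "delay_fun f"
  shows "integrable lborel f" and "(LINT x|lborel. norm (f x)) \<le> nrm2 f"
proof -
  let ?i = "indicator {-1..0} :: real \<Rightarrow> real"
  have i: "delay_fun ?i" "nrm2 ?i \<le> 1"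
    by (rule delay_fun_bounded[where C=1]; auto simp: indicator_def)+
  have n: "sq_integrable lborel (\<lambda>x. norm (f x))"
    using f by (auto simp: delay_fun_def sq_integrable_def)
  have eq: "norm (f x) \<bullet> ?i x = norm (f x)" for x
    using delay_fun_zero[OF f, of x] by (auto simp: indicator_def)
  have "integrable lborel (\<lambda>x. norm (f x))"
    using sq_integrable_inner[OF n delay_fun_sq[OF i(1)]] unfolding eq .
  then show "integrable lborel f"
    using delay_fun_measurable[OF f] by (simp add: integrable_norm_iff)
  have "(LINT x|lborel. norm (f x)) \<le> nrm2 (\<lambda>x. norm (f x)) * nrm2 ?i"
    using abs_inner_le_nrm2[OF n delay_fun_sq[OF i(1)]] unfolding eq by simp
  also have "nrm2 (\<lambda>x. norm (f x)) = nrm2 f" by (simp add: nrm2_def)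
  also have "nrm2 f * nrm2 ?i \<le> nrm2 f * 1" by (intro mult_left_mono i(2)) simp
  finally show "(LINT x|lborel. norm (f x)) \<le> nrm2 f" by simp
qed

lemma delay_fun_add: "delay_fun f \<Longrightarrow> delay_fun g \<Longrightarrow> delay_fun (\<lambda>x. f x + g x)"
  by (auto simp: delay_fun_def intro: sq_integrable_add)

lemma delay_fun_scaleR: "delay_fun f \<Longrightarrow> delay_fun (\<lambda>x. r *\<^sub>R f x)"
  by (auto simp: delay_fun_def intro: sq_integrable_scaleR)

lemma delay_fun_transpose: "delay_fun k \<Longrightarrow> delay_fun (\<lambda>x. transpose (k x))"
  for k :: "real \<Rightarrow> real ^ 'n ^ 'm"
proof -
  assume k: "delay_fun k"
  have "(\<lambda>x. transpose (k x)) \<in> borel_measurable borel"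
    using borel_measurable_continuous_on[OF linear_continuous_on[OF bounded_linear_transpose, of UNIV] delay_fun_measurable[OF k]] .
  then show ?thesis using k
    by (auto simp: delay_fun_def sq_integrable_def norm_transpose linear_0[OF bounded_linear.linear[OF bounded_linear_transpose]])
qed

lemma sq_integrable_reflect:
  fixes g :: "real \<Rightarrow> 'a::euclidean_space"
  assumes g: "sq_integrable lborel g"
  shows "sq_integrable lborel (\<lambda>x. g (a - x))" and "nrm2 (\<lambda>x. g (a - x)) = nrm2 g"
proof -
  have [measurable]: "g \<in> borel_measurable borel" using g by (simp add: sq_integrable_def)
  have "integrable lborel (\<lambda>x. (norm (g (a + -1 * x)))\<^sup>2)"
    by (rule lborel_integrable_real_affine) (use g in \<open>auto simp: sq_integrable_def\<close>)
  then show "sq_integrable lborel (\<lambda>x. g (a - x))" by (simp add: sq_integrable_def)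
  show "nrm2 (\<lambda>x. g (a - x)) = nrm2 g"
    unfolding nrm2_def using lborel_integral_real_affine[of "-1" "\<lambda>x. (norm (g x))\<^sup>2" a] by simp
qed

lemma integral_reflect:
  fixes f :: "real \<Rightarrow> 'a::{banach, second_countable_topology}"
  shows "(LINT x|lborel. f (a - x)) = (LINT x|lborel. f x)"
  using lborel_integral_real_affine[of "-1" f a] by simp

text \<open>The convolution at the point \<theta> - 1. If both functions live on [-1, 0] and
  \<theta> does too, only \<sigma> in [-1, \<theta>] contributes.\<close>

definition conv :: "real ^ 'n ^ 'n \<Rightarrow> real \<Rightarrow> (real \<Rightarrow> real ^ 'n) \<Rightarrow> (real \<Rightarrow> real ^ 'n) \<Rightarrow> real" where
  "conv M \<theta> f g = (LINT \<sigma>|lborel. (M *v f \<sigma>) \<bullet> g (\<theta> - 1 - \<sigma>))"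

definition hankel :: "(real \<Rightarrow> real ^ 'n ^ 'n) \<Rightarrow> (real \<Rightarrow> real ^ 'n) \<Rightarrow> (real \<Rightarrow> real ^ 'n) \<Rightarrow> real" where
  "hankel k f g = (LINT \<theta>|lborel. conv (k \<theta>) \<theta> f g)"

definition moment :: "(real \<Rightarrow> real ^ 'n ^ 'n) \<Rightarrow> (real \<Rightarrow> real ^ 'n) \<Rightarrow> real ^ 'n" where
  "moment k f = (LINT \<theta>|lborel. k \<theta> *v f \<theta>)"

text \<open>For a delay function this is the primitive from -1, cut off so as to be a delay function
  again.\<close>

definition prim :: "(real \<Rightarrow> 'a::euclidean_space) \<Rightarrow> real \<Rightarrow> 'a" where
  "prim f \<sigma> = indicator {-1..0} \<sigma> *\<^sub>R (LINT s|lborel. indicator {..\<sigma>} s *\<^sub>R f s)"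

definition cst :: "'a::euclidean_space \<Rightarrow> real \<Rightarrow> 'a" where
  "cst c \<sigma> = indicator {-1..0} \<sigma> *\<^sub>R c"

lemma sq_integrable_mv:
  fixes M :: "real ^ 'n ^ 'm"
  assumes "sq_integrable lborel f"
  shows "sq_integrable lborel (\<lambda>x. M *v f x)" and "nrm2 (\<lambda>x. M *v f x) \<le> norm M * nrm2 f"
proof -
  have [measurable]: "f \<in> borel_measurable borel" using assms by (simp add: sq_integrable_def)
  have m: "(\<lambda>x. M *v f x) \<in> borel_measurable borel" by measurable
  show "sq_integrable lborel (\<lambda>x. M *v f x)" "nrm2 (\<lambda>x. M *v f x) \<le> norm M * nrm2 f"
    using nrm2_mono[OF assms m norm_matrix_vector_le[of M] norm_ge_zero] by blast+
qed

context
  fixes f g :: "real \<Rightarrow> real ^ 'n"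
  assumes f: "delay_fun f" and g: "delay_fun g"
begin

lemma conv_integrable: "integrable lborel (\<lambda>\<sigma>. (M *v f \<sigma>) \<bullet> g (\<theta> - 1 - \<sigma>))"
  by (intro sq_integrable_inner sq_integrable_mv sq_integrable_reflect delay_fun_sq f g)

lemma conv_bound: "\<bar>conv M \<theta> f g\<bar> \<le> norm M * (nrm2 f * nrm2 g)"
proof -
  have "\<bar>conv M \<theta> f g\<bar> \<le> nrm2 (\<lambda>x. M *v f x) * nrm2 (\<lambda>x. g (\<theta> - 1 - x))"
    unfolding conv_def
    by (intro abs_inner_le_nrm2 sq_integrable_mv sq_integrable_reflect delay_fun_sq f g)
  also have "\<dots> \<le> (norm M * nrm2 f) * nrm2 g"
    unfolding sq_integrable_reflect(2)[OF delay_fun_sq[OF g]]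
    by (intro mult_right_mono sq_integrable_mv delay_fun_sq f) simp
  finally show ?thesis by (simp add: mult_ac)
qed

text \<open>The substitution \<sigma> \<mapsto> \<theta> - 1 - \<sigma> exchanges the two
  factors.\<close>

lemma conv_transpose: "conv M \<theta> f g = conv (transpose M) \<theta> g f"
proof -
  have "conv M \<theta> f g = (LINT \<sigma>|lborel. (M *v f (\<theta> - 1 - \<sigma>)) \<bullet> g \<sigma>)"
    unfolding conv_def
    using integral_reflect[of "\<lambda>\<sigma>. (M *v f \<sigma>) \<bullet> g (\<theta> - 1 - \<sigma>)" "\<theta> - 1"] by simp
  moreover have "(M *v x) \<bullet> y = (transpose M *v y) \<bullet> x" for x y
    by (metis inner_matrix_vector inner_commute)
  ultimately show ?thesis unfolding conv_def by (simp only:)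
qed

lemma hankel_integrable:
  assumes k: "delay_fun k"
  shows "integrable lborel (\<lambda>\<theta>. conv (k \<theta>) \<theta> f g)"
proof (rule Bochner_Integration.integrable_bound)
  note [measurable] = delay_fun_measurable[OF f] delay_fun_measurable[OF g] delay_fun_measurable[OF k]
  show "integrable lborel (\<lambda>\<theta>. norm (k \<theta>) * (nrm2 f * nrm2 g))"
    using delay_fun_integrable(1)[OF k] by simp
  show "(\<lambda>\<theta>. conv (k \<theta>) \<theta> f g) \<in> borel_measurable lborel"
    unfolding conv_def by measurable
  show "AE \<theta> in lborel. norm (conv (k \<theta>) \<theta> f g) \<le> norm (norm (k \<theta>) * (nrm2 f * nrm2 g))"
    by (rule AE_I2) (simp add: conv_bound)
qed

lemma hankel_bound:
  assumes k: "delay_fun k"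
  shows "\<bar>hankel k f g\<bar> \<le> (LINT \<theta>|lborel. norm (k \<theta>)) * (nrm2 f * nrm2 g)"
proof -
  have "\<bar>hankel k f g\<bar> \<le> (LINT \<theta>|lborel. \<bar>conv (k \<theta>) \<theta> f g\<bar>)"
    unfolding hankel_def by (rule integral_abs_bound)
  also have "\<dots> \<le> (LINT \<theta>|lborel. norm (k \<theta>) * (nrm2 f * nrm2 g))"
    using hankel_integrable[OF k] delay_fun_integrable(1)[OF k] conv_bound by (intro integral_mono) auto
  finally show ?thesis by simp
qed

lemma hankel_transpose: "hankel k f g = hankel (\<lambda>\<theta>. transpose (k \<theta>)) g f"
  unfolding hankel_def by (simp add: conv_transpose)

end

lemma conv_cong_AE:
  assumes "delay_fun f" "delay_fun f'" "delay_fun g" "AE x in lborel. f x = f' x"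
  shows "conv M \<theta> f g = conv M \<theta> f' g"
proof -
  note [measurable] = delay_fun_measurable[OF assms(1)] delay_fun_measurable[OF assms(2)] delay_fun_measurable[OF assms(3)]
  show ?thesis unfolding conv_def
    by (rule integral_cong_AE) (use assms(4) in \<open>auto elim!: eventually_mono\<close>)
qed

lemma conv_add_left:
  assumes "delay_fun f" "delay_fun f'" "delay_fun g"
  shows "conv M \<theta> (\<lambda>x. f x + f' x) g = conv M \<theta> f g + conv M \<theta> f' g"
  unfolding conv_def using conv_integrable[OF assms(1,3), of M \<theta>] conv_integrable[OF assms(2,3), of M \<theta>]
  by (simp add: mv.add_right inner_add_left)

lemma conv_scaleR_left: "conv M \<theta> (\<lambda>x. r *\<^sub>R f x) g = r * conv M \<theta> f g"
  unfolding conv_def by (simp add: mv.scaleR_right)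

lemma hankel_cong_AE:
  assumes "delay_fun f" "delay_fun f'" "delay_fun g" "AE x in lborel. f x = f' x"
  shows "hankel k f g = hankel k f' g"
  unfolding hankel_def by (simp add: conv_cong_AE[OF assms])

lemma hankel_add_left:
  assumes "delay_fun k" "delay_fun f" "delay_fun f'" "delay_fun g"
  shows "hankel k (\<lambda>x. f x + f' x) g = hankel k f g + hankel k f' g"
  unfolding hankel_def conv_add_left[OF assms(2-)]
  using hankel_integrable[OF assms(2,4,1)] hankel_integrable[OF assms(3,4,1)] by simp

lemma hankel_scaleR_left: "hankel k (\<lambda>x. r *\<^sub>R f x) g = r * hankel k f g"
  unfolding hankel_def by (simp add: conv_scaleR_left)

lemma integrable_bilinear_delay:
  assumes "delay_fun (k :: real \<Rightarrow> real ^ 'n ^ 'm)" "delay_fun f"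
  shows "integrable lborel (\<lambda>\<theta>. k \<theta> *v f \<theta>)" and "norm (LINT \<theta>|lborel. k \<theta> *v f \<theta>) \<le> nrm2 k * nrm2 f"
proof -
  note [measurable] = delay_fun_measurable[OF assms(1)] delay_fun_measurable[OF assms(2)]
  have n: "sq_integrable lborel (\<lambda>x. norm (h x))" "nrm2 (\<lambda>x. norm (h x)) = nrm2 h" if "delay_fun h"
    for h :: "real \<Rightarrow> 'z::euclidean_space"
    using that by (auto simp: delay_fun_def sq_integrable_def nrm2_def)
  have i: "integrable lborel (\<lambda>\<theta>. norm (k \<theta>) * norm (f \<theta>))"
    using sq_integrable_inner[OF n(1)[OF assms(1)] n(1)[OF assms(2)]] by simp
  show i': "integrable lborel (\<lambda>\<theta>. k \<theta> *v f \<theta>)"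
    by (rule Bochner_Integration.integrable_bound[OF i]) (auto simp: norm_matrix_vector_le)
  have "norm (LINT \<theta>|lborel. k \<theta> *v f \<theta>) \<le> (LINT \<theta>|lborel. norm (k \<theta> *v f \<theta>))"
    by (rule integral_norm_bound)
  also have "\<dots> \<le> (LINT \<theta>|lborel. norm (k \<theta>) * norm (f \<theta>))"
    using i i' by (intro integral_mono) (auto simp: norm_matrix_vector_le)
  also have "\<dots> \<le> nrm2 k * nrm2 f"
    using abs_inner_le_nrm2[OF n(1)[OF assms(1)] n(1)[OF assms(2)]] n(2)[OF assms(1)] n(2)[OF assms(2)] by simp
  finally show "norm (LINT \<theta>|lborel. k \<theta> *v f \<theta>) \<le> nrm2 k * nrm2 f" .
qed

lemma moment_inner:
  assumes "delay_fun k" "delay_fun f"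
  shows "moment k f \<bullet> d = (LINT \<theta>|lborel. (k \<theta> *v f \<theta>) \<bullet> d)"
  unfolding moment_def using integral_inner_left[OF integrable_bilinear_delay(1)[OF assms], of d] by simp

text \<open>Both sides integrate \<open>prod (a s) (b \<sigma>)\<close> over the half plane s \<le>
  \<sigma>. The general product covers the convolution as well as the matrix kernels below.\<close>

lemma triangle_Fubini:
  fixes prod :: "'a::euclidean_space \<Rightarrow> 'b::euclidean_space \<Rightarrow> 'c::euclidean_space"
    and a :: "real \<Rightarrow> 'a" and b :: "real \<Rightarrow> 'b"
  assumes prod: "bounded_bilinear prod" and a: "integrable lborel a" and b: "integrable lborel b"
  shows "(LINT \<sigma>|lborel. prod (LINT s|lborel. indicator {..\<sigma>} s *\<^sub>R a s) (b \<sigma>)) =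
    (LINT s|lborel. prod (a s) (LINT \<sigma>|lborel. indicator {s..} \<sigma> *\<^sub>R b \<sigma>))"
proof -
  interpret prod: bounded_bilinear prod by (rule prod)
  have [measurable]: "a \<in> borel_measurable borel" "b \<in> borel_measurable borel"
    using a b by (auto dest: borel_measurable_integrable)
  obtain K where K: "\<And>x y. norm (prod x y) \<le> norm x * norm y * K" "K \<ge> 0" using prod.nonneg_bounded by blast
  define F where "F s \<sigma> = (if s \<le> \<sigma> then prod (a s) (b \<sigma>) else 0)" for s \<sigma>
  have [measurable]: "(\<lambda>p. prod (a (fst p)) (b (snd p))) \<in> borel_measurable (lborel \<Otimes>\<^sub>M lborel)"
    by (rule borel_measurable_continuous_Pair) (auto intro!: prod.continuous_on continuous_intros)
  have Fm: "case_prod F \<in> borel_measurable (lborel \<Otimes>\<^sub>M lborel)"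
    unfolding F_def case_prod_beta by measurable
  have le: "norm (F s \<sigma>) \<le> norm (a s) * norm (b \<sigma>) * K" for s \<sigma> using K by (auto simp: F_def)
  have Fi: "integrable lborel (F s)" for s
  proof (rule Bochner_Integration.integrable_bound)
    show "integrable lborel (\<lambda>\<sigma>. norm (a s) * norm (b \<sigma>) * K)" using b by simp
    show "F s \<in> borel_measurable lborel" using measurable_Pair2[OF Fm, of s] by simp
    show "AE \<sigma> in lborel. norm (F s \<sigma>) \<le> norm (norm (a s) * norm (b \<sigma>) * K)"
      by (rule AE_I2) (use le K in \<open>auto intro: order_trans[OF le]\<close>)
  qed
  have int: "integrable (lborel \<Otimes>\<^sub>M lborel) (case_prod F)"
  proof (rule lborel_pair.Fubini_integrable[OF Fm])
    show "integrable lborel (\<lambda>s. LINT \<sigma>|lborel. norm (case_prod F (s, \<sigma>)))"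
    proof (rule Bochner_Integration.integrable_bound)
      show "integrable lborel (\<lambda>s. norm (a s) * ((LINT \<sigma>|lborel. norm (b \<sigma>)) * K))" using a by simp
      show "(\<lambda>s. LINT \<sigma>|lborel. norm (case_prod F (s, \<sigma>))) \<in> borel_measurable lborel" using Fm by measurable
      have "(LINT \<sigma>|lborel. norm (F s \<sigma>)) \<le> (LINT \<sigma>|lborel. norm (a s) * norm (b \<sigma>) * K)" for s
        using Fi[of s] b le by (intro integral_mono) auto
      then have "(LINT \<sigma>|lborel. norm (F s \<sigma>)) \<le> norm (a s) * ((LINT \<sigma>|lborel. norm (b \<sigma>)) * K)" for s
        by (simp add: mult.assoc)
      then show "AE s in lborel. norm (LINT \<sigma>|lborel. norm (case_prod F (s, \<sigma>))) \<le> norm (norm (a s) * ((LINT \<sigma>|lborel. norm (b \<sigma>)) * K))"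
        by (intro AE_I2) (auto intro: order_trans[OF _ abs_ge_self])
    qed
    show "AE s in lborel. integrable lborel (\<lambda>\<sigma>. case_prod F (s, \<sigma>))" using Fi by simp
  qed
  have ia: "integrable lborel (\<lambda>s. indicator {..\<sigma>} s *\<^sub>R a s)" for \<sigma> :: real
    by (rule integrable_mult_indicator) (use a in auto)
  have ib: "integrable lborel (\<lambda>\<sigma>. indicator {s..} \<sigma> *\<^sub>R b \<sigma>)" for s :: real
    by (rule integrable_mult_indicator) (use b in auto)
  have "prod (LINT s|lborel. indicator {..\<sigma>} s *\<^sub>R a s) (b \<sigma>) = (LINT s|lborel. F s \<sigma>)" for \<sigma>
    unfolding integral_bounded_linear[OF prod.bounded_linear_left ia, symmetric]
    by (rule Bochner_Integration.integral_cong) (auto simp: F_def prod.scaleR_left prod.zero_left indicator_def)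
  moreover have "prod (a s) (LINT \<sigma>|lborel. indicator {s..} \<sigma> *\<^sub>R b \<sigma>) = (LINT \<sigma>|lborel. F s \<sigma>)" for s
    unfolding integral_bounded_linear[OF prod.bounded_linear_right ib, symmetric]
    by (rule Bochner_Integration.integral_cong) (auto simp: F_def prod.scaleR_right prod.zero_right indicator_def)
  ultimately show ?thesis using lborel_pair.Fubini_integral[OF int] by simp
qed

lemma delay_fun_prim:
  assumes f: "delay_fun f"
  shows "delay_fun (prim f)" and "nrm2 (prim f) \<le> nrm2 f"
proof -
  note [measurable] = delay_fun_measurable[OF f]
  have m: "prim f \<in> borel_measurable borel"
  proof -
    have "indicator {..\<sigma>} s *\<^sub>R f s = (if s \<le> \<sigma> then f s else 0)" for s \<sigma> by (simp add: indicator_def)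
    then show ?thesis unfolding prim_def[abs_def] by simp measurable
  qed
  have b: "norm (prim f \<sigma>) \<le> nrm2 f" for \<sigma>
  proof -
    have i: "integrable lborel (\<lambda>s. indicator {..\<sigma>} s *\<^sub>R f s)"
      by (rule integrable_mult_indicator) (use delay_fun_integrable(1)[OF f] in auto)
    have "norm (prim f \<sigma>) \<le> norm (LINT s|lborel. indicator {..\<sigma>} s *\<^sub>R f s)"
      by (simp add: prim_def indicator_def)
    also have "\<dots> \<le> (LINT s|lborel. norm (indicator {..\<sigma>} s *\<^sub>R f s))" by (rule integral_norm_bound)
    also have "\<dots> \<le> (LINT s|lborel. norm (f s))"
      by (intro integral_mono integrable_norm i delay_fun_integrable(1)[OF f]) (auto simp: indicator_def)
    also have "\<dots> \<le> nrm2 f" by (rule delay_fun_integrable(2)[OF f])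
    finally show ?thesis .
  qed
  show "delay_fun (prim f)" "nrm2 (prim f) \<le> nrm2 f"
    by (rule delay_fun_bounded[OF m b]; simp add: prim_def)+
qed

lemma delay_fun_cst: "delay_fun (cst c)" and nrm2_cst: "nrm2 (cst c) = norm c"
proof -
  show "delay_fun (cst c)"
    by (rule delay_fun_bounded(1)[where C="norm c"]) (auto simp: cst_def[abs_def] indicator_def)
  have "(norm (cst c \<sigma>))\<^sup>2 = indicator {-1..0} \<sigma> * (norm c)\<^sup>2" for \<sigma>
    by (simp add: cst_def indicator_def)
  then show "nrm2 (cst c) = norm c" by (simp add: nrm2_def)
qed

text \<open>Integration moves from one convolution factor to the other. The cut-off of
  \<open>prim\<close> at 0 is harmless: for \<theta> \<le> 0 a point \<sigma> > 0 gives an argument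
  \<theta> - 1 - \<sigma> below -1, where the other factor vanishes. Below -1 the uncut integral is
  0 anyway.\<close>

lemma conv_prim:
  assumes f: "delay_fun f" and g: "delay_fun g" and \<theta>: "\<theta> \<le> 0"
  shows "conv M \<theta> (prim f) g = conv M \<theta> f (prim g)"
proof -
  note int = delay_fun_integrable(1)[OF f] delay_fun_integrable(1)[OF g]
  define b where "b \<sigma> = g (\<theta> - 1 - \<sigma>)" for \<sigma>
  have b: "integrable lborel b"
    unfolding b_def using lborel_integrable_real_affine[OF int(2), of "-1" "\<theta> - 1"] by simp
  have bil: "bounded_bilinear (\<lambda>x y. (M *v x) \<bullet> y)"
    using bounded_bilinear.comp1[OF bounded_bilinear_inner mv.bounded_linear_right] .
  have neg: "(LINT s|lborel. indicator {..\<sigma>} s *\<^sub>R h s) = 0" if "delay_fun h" "\<sigma> < -1" for h :: "real \<Rightarrow> real ^ 'n" and \<sigma>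
  proof -
    have "indicator {..\<sigma>} s *\<^sub>R h s = 0" for s
      using that delay_fun_zero[OF that(1), of s] by (auto simp: indicator_def)
    then show ?thesis by (simp only: integral_zero)
  qed
  have "conv M \<theta> (prim f) g = (LINT \<sigma>|lborel. (M *v (LINT s|lborel. indicator {..\<sigma>} s *\<^sub>R f s)) \<bullet> b \<sigma>)"
    unfolding conv_def
  proof (rule Bochner_Integration.integral_cong)
    fix \<sigma>
    show "(M *v prim f \<sigma>) \<bullet> g (\<theta> - 1 - \<sigma>) = (M *v (LINT s|lborel. indicator {..\<sigma>} s *\<^sub>R f s)) \<bullet> b \<sigma>"
      using \<theta> neg[OF f, of \<sigma>] delay_fun_zero[OF g, of "\<theta> - 1 - \<sigma>"]
      by (cases "\<sigma> \<in> {-1..0}") (auto simp: prim_def b_def)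
  qed simp
  also have "\<dots> = (LINT s|lborel. (M *v f s) \<bullet> (LINT \<sigma>|lborel. indicator {s..} \<sigma> *\<^sub>R b \<sigma>))"
    by (rule triangle_Fubini[OF bil int(1) b])
  also have "\<dots> = conv M \<theta> f (prim g)"
    unfolding conv_def
  proof (rule Bochner_Integration.integral_cong)
    fix s
    have "(LINT \<sigma>|lborel. indicator {s..} \<sigma> *\<^sub>R b \<sigma>) = (LINT \<sigma>|lborel. indicator {..\<theta> - 1 - s} \<sigma> *\<^sub>R g \<sigma>)"
      unfolding integral_reflect[of "\<lambda>\<sigma>. indicator {..\<theta> - 1 - s} \<sigma> *\<^sub>R g \<sigma>" "\<theta> - 1", symmetric]
      by (rule Bochner_Integration.integral_cong) (auto simp: b_def indicator_def)
    then show "(M *v f s) \<bullet> (LINT \<sigma>|lborel. indicator {s..} \<sigma> *\<^sub>R b \<sigma>) = (M *v f s) \<bullet> prim g (\<theta> - 1 - s)"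
      using \<theta> neg[OF g, of "\<theta> - 1 - s"] delay_fun_zero[OF f, of s]
      by (cases "\<theta> - 1 - s \<in> {-1..0}"; cases "s \<in> {-1..0}") (auto simp: prim_def)
  qed simp
  finally show ?thesis .
qed

lemma conv_zero [simp]: "conv 0 \<theta> f g = 0" by (simp add: conv_def)

lemma hankel_prim:
  assumes k: "delay_fun k" and f: "delay_fun f" and g: "delay_fun g"
  shows "hankel k (prim f) g = hankel k f (prim g)"
  unfolding hankel_def
proof (rule Bochner_Integration.integral_cong)
  fix \<theta> show "conv (k \<theta>) \<theta> (prim f) g = conv (k \<theta>) \<theta> f (prim g)"
    using conv_prim[OF f g, of \<theta> "k \<theta>"] delay_fun_zero[OF k, of \<theta>] by (cases "\<theta> \<le> 0") auto
qed simp

text \<open>The support of \<open>cst d\<close> restricts the convolution to \<sigma> \<le>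
  \<theta>, so the inner integral is the primitive of \<open>f\<close> at \<theta>.\<close>

lemma hankel_cst:
  assumes k: "delay_fun k" and f: "delay_fun f"
  shows "hankel k f (cst d) = moment k (prim f) \<bullet> d"
  unfolding moment_inner[OF k delay_fun_prim(1)[OF f]] hankel_def
proof (rule Bochner_Integration.integral_cong)
  fix \<theta>
  show "conv (k \<theta>) \<theta> f (cst d) = (k \<theta> *v prim f \<theta>) \<bullet> d"
  proof (cases "\<theta> \<in> {-1..0}")
    case True
    have i: "integrable lborel (\<lambda>s. indicator {..\<theta>} s *\<^sub>R f s)"
      by (rule integrable_mult_indicator) (use delay_fun_integrable(1)[OF f] in auto)
    have bl: "bounded_linear (\<lambda>x. (k \<theta> *v x) \<bullet> d)"
      by (rule bounded_linear_compose[OF bounded_linear_inner_left mv.bounded_linear_right])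
    have "conv (k \<theta>) \<theta> f (cst d) = (LINT \<sigma>|lborel. (k \<theta> *v (indicator {..\<theta>} \<sigma> *\<^sub>R f \<sigma>)) \<bullet> d)"
      unfolding conv_def
    proof (rule Bochner_Integration.integral_cong)
      fix \<sigma>
      show "(k \<theta> *v f \<sigma>) \<bullet> cst d (\<theta> - 1 - \<sigma>) = (k \<theta> *v (indicator {..\<theta>} \<sigma> *\<^sub>R f \<sigma>)) \<bullet> d"
        using True delay_fun_zero[OF f, of \<sigma>]
        by (cases "\<sigma> \<in> {-1..0}") (auto simp: cst_def indicator_def)
    qed simp
    also have "\<dots> = (k \<theta> *v (LINT \<sigma>|lborel. indicator {..\<theta>} \<sigma> *\<^sub>R f \<sigma>)) \<bullet> d"
      by (rule integral_bounded_linear[OF bl i])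
    finally show ?thesis using True by (simp add: prim_def)
  qed (use delay_fun_zero[OF k, of \<theta>] in simp)
qed simp

lemma conv_cst_0:
  assumes f: "delay_fun f"
  shows "conv (mat 1) 0 f (cst d) = (LINT s|lborel. f s) \<bullet> d"
proof -
  have "conv (mat 1) 0 f (cst d) = (LINT s|lborel. f s \<bullet> d)"
    unfolding conv_def
  proof (rule Bochner_Integration.integral_cong)
    fix \<sigma> show "(mat 1 *v f \<sigma>) \<bullet> cst d (0 - 1 - \<sigma>) = f \<sigma> \<bullet> d"
      using delay_fun_zero[OF f, of \<sigma>] by (cases "\<sigma> \<in> {-1..0}") (auto simp: cst_def indicator_def)
  qed simp
  then show ?thesis using delay_fun_integrable(1)[OF f] by simp
qed

subsection \<open>The pairing of the two systems\<close>

lemma AE_delay_iff: "(AE x in delay_measure. P x) \<longleftrightarrow> (AE x in lborel. x \<in> {-1..0} \<longrightarrow> P x)"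
  by (subst AE_restrict_space_iff) (auto simp: AE_completion_iff)

lemma lebesgue_measurable_AE_borel:
  fixes f :: "real \<Rightarrow> 'a::euclidean_space"
  assumes "f \<in> borel_measurable lebesgue"
  obtains g where "g \<in> borel_measurable borel" "AE x in lborel. f x = g x"
proof -
  have "\<exists>g. g \<in> borel_measurable borel \<and> (AE x in lborel. f x \<bullet> b = g x)" for b
    using completion_ex_borel_measurable_real[of "\<lambda>x. f x \<bullet> b" lborel] assms by auto
  then obtain g where g: "\<And>b. g b \<in> borel_measurable borel" "\<And>b. AE x in lborel. f x \<bullet> b = g b x"
    by metis
  show ?thesis
  proof
    show "(\<lambda>x. \<Sum>b\<in>Basis. g b x *\<^sub>R b) \<in> borel_measurable borel" using g(1) by measurable
    have "AE x in lborel. \<forall>b\<in>Basis. f x \<bullet> b = g b x" using g(2) by (intro AE_finite_allI) auto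
    then show "AE x in lborel. f x = (\<Sum>b\<in>Basis. g b x *\<^sub>R b)"
    proof eventually_elim
      case (elim x)
      then have "(\<Sum>b\<in>Basis. g b x *\<^sub>R b) = (\<Sum>b\<in>Basis. (f x \<bullet> b) *\<^sub>R b)" by simp
      then show ?case by (simp add: euclidean_representation)
    qed
  qed
qed

lemma sq_integrable_AE_delay_fun:
  fixes f :: "real \<Rightarrow> 'a::euclidean_space"
  assumes f: "sq_integrable delay_measure f"
  obtains g where "delay_fun g" "AE x in delay_measure. f x = g x"
proof -
  let ?f = "\<lambda>x. indicator {-1..0} x *\<^sub>R f x"
  have fm: "?f \<in> borel_measurable lebesgue"
    using f unfolding sq_integrable_def by (subst (asm) borel_measurable_restrict_space_iff) auto
  obtain g where g: "g \<in> borel_measurable borel" "AE x in lborel. ?f x = g x"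
    by (rule lebesgue_measurable_AE_borel[OF fm])
  let ?g = "\<lambda>x. indicator {-1..0} x *\<^sub>R g x"
  have gm: "?g \<in> borel_measurable borel" using g(1) by measurable
  have ae: "AE x in lborel. ?f x = ?g x" using g(2) by eventually_elim (auto simp: indicator_def)
  have "integrable lebesgue (\<lambda>x. (norm (?g x))\<^sup>2)"
  proof (rule integrable_cong_AE_imp)
    have "integrable lebesgue (\<lambda>x. indicator {-1..0} x *\<^sub>R (norm (f x))\<^sup>2)"
      using f by (simp add: sq_integrable_def integrable_restrict_space)
    moreover have "indicator {-1..0} x *\<^sub>R (norm (f x))\<^sup>2 = (norm (?f x))\<^sup>2" for x
      by (simp add: indicator_def)
    ultimately show "integrable lebesgue (\<lambda>x. (norm (?f x))\<^sup>2)" by simp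
    show "(\<lambda>x. (norm (?g x))\<^sup>2) \<in> borel_measurable lebesgue"
      using borel_measurable_power[OF measurable_compose[OF gm borel_measurable_norm], of 2]
      by (intro measurable_completion) (simp only: measurable_lborel2)
    show "AE x in lebesgue. (norm (?f x))\<^sup>2 = (norm (?g x))\<^sup>2"
      using ae by (intro AE_completion) (auto elim: eventually_mono)
  qed
  moreover have "(\<lambda>x. (norm (?g x))\<^sup>2) \<in> borel_measurable lborel"
    using borel_measurable_power[OF measurable_compose[OF gm borel_measurable_norm], of 2]
    by (simp only: measurable_lborel2)
  ultimately have "integrable lborel (\<lambda>x. (norm (?g x))\<^sup>2)"
    using integrable_completion by metis
  then have "delay_fun ?g" using gm by (simp add: delay_fun_def sq_integrable_def)
  moreover have "AE x in delay_measure. f x = ?g x"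
    unfolding AE_delay_iff using ae by eventually_elim auto
  ultimately show ?thesis by (rule that)
qed

lemma delay_fun_sq_delay: assumes f: "delay_fun f" shows "sq_integrable delay_measure f"
  unfolding sq_integrable_def
proof
  have i: "integrable lborel (\<lambda>x. (norm (f x))\<^sup>2)" and m: "f \<in> borel_measurable borel"
    using f by (auto simp: delay_fun_def sq_integrable_def)
  show "f \<in> borel_measurable delay_measure"
    by (intro measurable_restrict_space1 measurable_completion) (use m in simp)
  have "integrable lebesgue (\<lambda>x. (norm (f x))\<^sup>2)"
    using i m by (subst integrable_completion) (auto intro: borel_measurable_norm borel_measurable_power)
  then have "integrable lebesgue (\<lambda>x. indicator {-1..0} x *\<^sub>R (norm (f x))\<^sup>2)"
    by (intro integrable_mult_indicator) auto
  then show "integrable delay_measure (\<lambda>x. (norm (f x))\<^sup>2)" by (simp add: integrable_restrict_space)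
qed

lemma integral_delay_measure:
  fixes F :: "real \<Rightarrow> 'b::{banach, second_countable_topology}"
  assumes m: "F \<in> borel_measurable borel" and z: "\<And>x. x \<notin> {-1..0} \<Longrightarrow> F x = 0"
  shows "(LINT x|delay_measure. F x) = (LINT x|lborel. F x)"
proof -
  have "(LINT x|delay_measure. F x) = (LINT x|lebesgue. indicator {-1..0} x *\<^sub>R F x)"
    by (rule integral_restrict_space) simp
  also have "(\<lambda>x. indicator {-1..0} x *\<^sub>R F x) = F" using z by (auto simp: indicator_def fun_eq_iff)
  also have "(LINT x|lebesgue. F x) = (LINT x|lborel. F x)" using m by (intro integral_completion) simp
  finally show ?thesis .
qed

text \<open>
  \<open>rep_L2\<close> is only Lebesgue measurable; Fubini on \<open>lborel\<close> needs a Borel representative vanishing outside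
  \<open>[-1, 0]\<close>.
\<close>

definition bor :: "'a::euclidean_space L2 \<Rightarrow> real \<Rightarrow> 'a" where
  "bor \<eta> = (SOME f. delay_fun f \<and> (AE x in delay_measure. rep_L2 \<eta> x = f x))"

lemma delay_fun_bor [simp]: "delay_fun (bor \<eta>)" and rep_bor: "AE x in delay_measure. rep_L2 \<eta> x = bor \<eta> x"
proof -
  obtain g where "delay_fun g" "AE x in delay_measure. rep_L2 \<eta> x = g x"
    by (rule sq_integrable_AE_delay_fun[OF sq_integrable_rep_L2])
  then have "\<exists>f. delay_fun f \<and> (AE x in delay_measure. rep_L2 \<eta> x = f x)" by blast
  from someI_ex[OF this] show "delay_fun (bor \<eta>)" "AE x in delay_measure. rep_L2 \<eta> x = bor \<eta> x"
    unfolding bor_def by blast+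
qed

lemma bor_measurable [measurable]: "bor \<eta> \<in> borel_measurable borel"
  by (rule delay_fun_measurable) simp

lemma abs_bor: "abs_L2 (bor \<eta>) = \<eta>"
proof -
  have "AE x in delay_measure. bor \<eta> x = rep_L2 \<eta> x" using rep_bor[of \<eta>] by eventually_elim simp
  from abs_L2_eqI[OF delay_fun_sq_delay[OF delay_fun_bor] sq_integrable_rep_L2 this]
  show ?thesis by (simp add: abs_rep_L2)
qed

lemma AE_lborel_of_delay:
  assumes "delay_fun f" "delay_fun g" "AE x in delay_measure. f x = g x"
  shows "AE x in lborel. f x = g x"
  using assms(3) unfolding AE_delay_iff
  by eventually_elim (metis assms(1,2) delay_fun_zero)

lemma bor_abs: assumes f: "delay_fun f" shows "AE x in lborel. bor (abs_L2 f) x = f x"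
proof (rule AE_lborel_of_delay[OF delay_fun_bor f])
  show "AE x in delay_measure. bor (abs_L2 f) x = f x"
    using rep_bor[of "abs_L2 f"] rep_abs_L2[OF delay_fun_sq_delay[OF f]] by eventually_elim simp
qed

lemma bor_add: "AE x in lborel. bor (\<eta> + \<xi>) x = bor \<eta> x + bor \<xi> x"
  using bor_abs[OF delay_fun_add[OF delay_fun_bor delay_fun_bor], of \<eta> \<xi>]
  by (simp add: abs_L2_add[OF delay_fun_sq_delay delay_fun_sq_delay, symmetric] abs_bor)

lemma bor_scaleR: "AE x in lborel. bor (r *\<^sub>R \<eta>) x = r *\<^sub>R bor \<eta> x"
  using bor_abs[OF delay_fun_scaleR[OF delay_fun_bor], of r \<eta>]
  by (simp add: abs_L2_scaleR[OF delay_fun_sq_delay, symmetric] abs_bor)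

lemma norm_abs_delay_fun: assumes f: "delay_fun f" shows "norm (abs_L2 f) = nrm2 f"
proof -
  note [measurable] = delay_fun_measurable[OF f]
  have "(norm (abs_L2 f))\<^sup>2 = (LINT x|delay_measure. (norm (f x))\<^sup>2)"
    by (rule norm_abs_L2[OF delay_fun_sq_delay[OF f]])
  also have "\<dots> = (LINT x|lborel. (norm (f x))\<^sup>2)"
    by (rule integral_delay_measure) (auto simp: delay_fun_zero[OF f])
  finally show ?thesis by (simp add: nrm2_def real_sqrt_unique)
qed

lemma nrm2_bor [simp]: "nrm2 (bor \<eta>) = norm \<eta>"
  using norm_abs_delay_fun[OF delay_fun_bor, of \<eta>] by (simp add: abs_bor)

text \<open>Linearity in the second argument is obtained from linearity in the first argument of the
  exchanged form \<open>F'\<close>. The choice \<open>bor\<close> is linear only almost everywhere,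
  hence the congruence hypotheses.\<close>

lemma bounded_bilinear_via_bor:
  fixes F :: "(real \<Rightarrow> 'a::euclidean_space) \<Rightarrow> (real \<Rightarrow> 'a) \<Rightarrow> real"
  assumes cong: "\<And>f f' g. delay_fun f \<Longrightarrow> delay_fun f' \<Longrightarrow> delay_fun g \<Longrightarrow> AE x in lborel. f x = f' x \<Longrightarrow> F f g = F f' g"
    and add: "\<And>f f' g. delay_fun f \<Longrightarrow> delay_fun f' \<Longrightarrow> delay_fun g \<Longrightarrow> F (\<lambda>x. f x + f' x) g = F f g + F f' g"
    and scale: "\<And>f g r. F (\<lambda>x. r *\<^sub>R f x) g = r * F f g"
    and swap: "\<And>f g. delay_fun f \<Longrightarrow> delay_fun g \<Longrightarrow> F f g = F' g f"
    and cong': "\<And>f f' g. delay_fun f \<Longrightarrow> delay_fun f' \<Longrightarrow> delay_fun g \<Longrightarrow> AE x in lborel. f x = f' x \<Longrightarrow> F' f g = F' f' g"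
    and add': "\<And>f f' g. delay_fun f \<Longrightarrow> delay_fun f' \<Longrightarrow> delay_fun g \<Longrightarrow> F' (\<lambda>x. f x + f' x) g = F' f g + F' f' g"
    and scale': "\<And>f g r. F' (\<lambda>x. r *\<^sub>R f x) g = r * F' f g"
    and bound: "\<And>f g. delay_fun f \<Longrightarrow> delay_fun g \<Longrightarrow> \<bar>F f g\<bar> \<le> nrm2 f * nrm2 g * K"
  shows "bounded_bilinear (\<lambda>\<eta> \<xi>. F (bor \<eta>) (bor \<xi>))"
proof
  fix \<eta> \<eta>' \<xi> \<xi>' :: "'a L2" and r :: real
  show "F (bor (\<eta> + \<eta>')) (bor \<xi>) = F (bor \<eta>) (bor \<xi>) + F (bor \<eta>') (bor \<xi>)"
    by (subst cong[OF _ _ _ bor_add]) (auto simp: add intro: delay_fun_add)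
  show "F (bor \<eta>) (bor (\<xi> + \<xi>')) = F (bor \<eta>) (bor \<xi>) + F (bor \<eta>) (bor \<xi>')"
    unfolding swap[OF delay_fun_bor delay_fun_bor]
    by (subst cong'[OF _ _ _ bor_add]) (auto simp: add' intro: delay_fun_add)
  show "F (bor (r *\<^sub>R \<eta>)) (bor \<xi>) = r *\<^sub>R F (bor \<eta>) (bor \<xi>)"
    by (subst cong[OF _ _ _ bor_scaleR]) (auto simp: scale intro: delay_fun_scaleR)
  show "F (bor \<eta>) (bor (r *\<^sub>R \<xi>)) = r *\<^sub>R F (bor \<eta>) (bor \<xi>)"
    unfolding swap[OF delay_fun_bor delay_fun_bor]
    by (subst cong'[OF _ _ _ bor_scaleR]) (auto simp: scale' intro: delay_fun_scaleR)
  show "\<exists>K. \<forall>\<eta> \<xi>. norm (F (bor \<eta>) (bor \<xi>)) \<le> norm \<eta> * norm \<xi> * K"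
    using bound[OF delay_fun_bor delay_fun_bor] by auto
qed

lemma bounded_bilinear_conv: "bounded_bilinear (\<lambda>\<eta> \<xi>. conv M \<theta> (bor \<eta>) (bor \<xi>))"
  by (rule bounded_bilinear_via_bor[where F' = "conv (transpose M) \<theta>" and K = "norm M"])
    (auto intro: conv_cong_AE conv_add_left conv_scaleR_left conv_transpose simp: conv_bound mult.commute)

lemma bounded_bilinear_hankel:
  assumes k: "delay_fun k"
  shows "bounded_bilinear (\<lambda>\<eta> \<xi>. hankel k (bor \<eta>) (bor \<xi>))"
  by (rule bounded_bilinear_via_bor[where F' = "hankel (\<lambda>\<theta>. transpose (k \<theta>))" and K = "LINT \<theta>|lborel. norm (k \<theta>)"])
    (use k hankel_bound in \<open>auto intro: hankel_cong_AE hankel_add_left hankel_scaleR_left hankel_transpose delay_fun_transpose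
        simp: mult.commute[of "_ * _"]\<close>)

lemma bounded_linear_moment:
  fixes k :: "real \<Rightarrow> real ^ 'n ^ 'n"
  assumes k: "delay_fun k" shows "bounded_linear (\<lambda>\<eta>. moment k (bor \<eta>))"
proof
  note [measurable] = delay_fun_measurable[OF k]
  note i = integrable_bilinear_delay[OF k delay_fun_bor]
  fix \<eta> \<xi> :: "(real ^ 'n) L2" and r :: real
  have "moment k (bor (\<eta> + \<xi>)) = (LINT \<theta>|lborel. k \<theta> *v bor \<eta> \<theta> + k \<theta> *v bor \<xi> \<theta>)"
    unfolding moment_def
    by (rule integral_cong_AE) (use bor_add[of \<eta> \<xi>] in \<open>auto elim!: eventually_mono simp: mv.add_right\<close>)
  then show "moment k (bor (\<eta> + \<xi>)) = moment k (bor \<eta>) + moment k (bor \<xi>)"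
    using i by (simp add: moment_def)
  have "moment k (bor (r *\<^sub>R \<eta>)) = (LINT \<theta>|lborel. r *\<^sub>R (k \<theta> *v bor \<eta> \<theta>))"
    unfolding moment_def
    by (rule integral_cong_AE) (use bor_scaleR[of r \<eta>] in \<open>auto elim!: eventually_mono simp: mv.scaleR_right\<close>)
  then show "moment k (bor (r *\<^sub>R \<eta>)) = r *\<^sub>R moment k (bor \<eta>)" by (simp add: moment_def)
  show "\<exists>K. \<forall>\<eta>. norm (moment k (bor \<eta>)) \<le> norm \<eta> * K"
    using i(2) by (intro exI[of _ "nrm2 k"]) (auto simp: moment_def mult.commute)
qed

lemma moment_cong_AE:
  assumes "delay_fun k" "delay_fun f" "delay_fun g" "AE x in lborel. f x = g x"
  shows "moment k f = moment k g"
proof -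
  note [measurable] = assms(1-3)[THEN delay_fun_measurable]
  show ?thesis unfolding moment_def
    by (rule integral_cong_AE) (use assms(4) in \<open>auto elim!: eventually_mono\<close>)
qed

text \<open>The primitive of \<eta> from -1, this time without a cut-off, and as a function of the
  class.\<close>

definition initial :: "'a::euclidean_space L2 \<Rightarrow> real \<Rightarrow> 'a" where
  "initial \<eta> \<theta> = (LINT s|lborel. indicator {..\<theta>} s *\<^sub>R bor \<eta> s)"

lemma integral_initial_cong:
  assumes "delay_fun f" "delay_fun g" "AE x in lborel. f x = g x"
  shows "(LINT s|lborel. indicator {..\<sigma>::real} s *\<^sub>R f s) = (LINT s|lborel. indicator {..\<sigma>} s *\<^sub>R g s)"
proof -
  note [measurable] = delay_fun_measurable[OF assms(1)] delay_fun_measurable[OF assms(2)]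
  show ?thesis by (rule integral_cong_AE) (use assms(3) in \<open>auto elim!: eventually_mono\<close>)
qed

lemma initial_integrable: "delay_fun f \<Longrightarrow> integrable lborel (\<lambda>s. indicator {..\<sigma>::real} s *\<^sub>R f s)"
  by (rule integrable_mult_indicator) (use delay_fun_integrable(1) in auto)

lemma norm_initial_le: "norm (initial \<eta> \<theta>) \<le> norm \<eta>"
proof -
    have "norm (initial \<eta> \<theta>) \<le> (LINT s|lborel. norm (indicator {..\<theta>} s *\<^sub>R bor \<eta> s))"
      unfolding initial_def by (rule integral_norm_bound)
    also have "\<dots> \<le> (LINT s|lborel. norm (bor \<eta> s))"
      by (intro integral_mono integrable_norm initial_integrable delay_fun_integrable(1) delay_fun_bor)
        (auto simp: indicator_def)
    also have "\<dots> \<le> norm \<eta>" using delay_fun_integrable(2)[OF delay_fun_bor, of \<eta>] by simp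
    finally show ?thesis .
qed

lemma bounded_linear_initial: "bounded_linear (\<lambda>\<eta> :: 'a::euclidean_space L2. initial \<eta> \<theta>)"
proof
    fix \<eta> \<xi> :: "'a L2" and r :: real
    have "initial (\<eta> + \<xi>) \<theta> = (LINT s|lborel. indicator {..\<theta>} s *\<^sub>R (bor \<eta> s + bor \<xi> s))"
      unfolding initial_def by (rule integral_initial_cong[OF _ _ bor_add]) (auto intro: delay_fun_add)
    also have "\<dots> = initial \<eta> \<theta> + initial \<xi> \<theta>"
      unfolding initial_def scaleR_add_right
      by (rule Bochner_Integration.integral_add) (simp_all add: initial_integrable)
    finally show "initial (\<eta> + \<xi>) \<theta> = initial \<eta> \<theta> + initial \<xi> \<theta>" .
    have "initial (r *\<^sub>R \<eta>) \<theta> = (LINT s|lborel. indicator {..\<theta>} s *\<^sub>R (r *\<^sub>R bor \<eta> s))"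
      unfolding initial_def by (rule integral_initial_cong[OF _ _ bor_scaleR]) (auto intro: delay_fun_scaleR)
    also have "\<dots> = (LINT s|lborel. r *\<^sub>R (indicator {..\<theta>} s *\<^sub>R bor \<eta> s))" by (simp only: scaleR_left_commute)
    also have "\<dots> = r *\<^sub>R initial \<eta> \<theta>" unfolding initial_def by (rule integral_scaleR_right)
    finally show "initial (r *\<^sub>R \<eta>) \<theta> = r *\<^sub>R initial \<eta> \<theta>" .
    show "\<exists>K. \<forall>\<eta> :: 'a L2. norm (initial \<eta> \<theta>) \<le> norm \<eta> * K"
      by (intro exI[of _ 1]) (simp add: norm_initial_le)
qed

lemma initial_minus_1 [simp]: "initial \<eta> (-1) = 0"
  unfolding initial_def
proof (rule integral_eq_zero_AE)
  have "AE s in lborel. s \<noteq> (-1::real)" by (rule AE_lborel_singleton)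
  then show "AE s in lborel. indicator {..-1} s *\<^sub>R bor \<eta> s = 0"
  proof eventually_elim
    case (elim s)
    then show ?case using delay_fun_zero[OF delay_fun_bor, of s \<eta>] by (auto simp: indicator_def)
  qed
qed

lemma initial_0: "initial \<eta> 0 = (LINT s|lborel. bor \<eta> s)"
  unfolding initial_def
proof (rule Bochner_Integration.integral_cong)
  show "indicator {..0} s *\<^sub>R bor \<eta> s = bor \<eta> s" for s
    using delay_fun_zero[OF delay_fun_bor, of s \<eta>] by (auto simp: indicator_def)
qed simp

definition const_L2 :: "'a::euclidean_space \<Rightarrow> 'a L2" where "const_L2 c = abs_L2 (cst c)"

definition prim_L2 :: "'a::euclidean_space L2 \<Rightarrow> 'a L2" where "prim_L2 \<eta> = abs_L2 (prim (bor \<eta>))"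

lemma norm_const_L2: "norm (const_L2 c) = norm c"
  by (simp add: const_L2_def norm_abs_delay_fun delay_fun_cst nrm2_cst)

lemma bounded_linear_const_L2: "bounded_linear const_L2"
proof
  show "\<exists>K. \<forall>c. norm (const_L2 c :: 'a L2) \<le> norm c * K" by (intro exI[of _ 1]) (simp add: norm_const_L2)
  fix b c :: 'a and r :: real
  have "cst (b + c) = (\<lambda>\<sigma>. cst b \<sigma> + cst c \<sigma>)" "cst (r *\<^sub>R c) = (\<lambda>\<sigma>. r *\<^sub>R cst c \<sigma>)"
    by (auto simp: cst_def scaleR_add_right)
  then show "const_L2 (b + c) = const_L2 b + const_L2 c" "const_L2 (r *\<^sub>R c) = r *\<^sub>R const_L2 c"
    by (simp_all add: const_L2_def abs_L2_add abs_L2_scaleR delay_fun_sq_delay delay_fun_cst)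
qed

lemma bounded_linear_prim_L2: "bounded_linear (prim_L2 :: 'a::euclidean_space L2 \<Rightarrow> _)"
proof
  fix \<eta> \<xi> :: "'a L2" and r :: real
  note d = delay_fun_prim(1)[OF delay_fun_bor]
  note lin = bounded_linear.linear[OF bounded_linear_initial]
  have p: "prim (bor \<zeta>) = (\<lambda>\<sigma>. indicator {-1..0} \<sigma> *\<^sub>R initial \<zeta> \<sigma>)" for \<zeta> :: "'a L2"
    by (simp add: fun_eq_iff prim_def initial_def)
  have "prim (bor (\<eta> + \<xi>)) = (\<lambda>\<sigma>. prim (bor \<eta>) \<sigma> + prim (bor \<xi>) \<sigma>)"
    "prim (bor (r *\<^sub>R \<eta>)) = (\<lambda>\<sigma>. r *\<^sub>R prim (bor \<eta>) \<sigma>)"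
    unfolding p by (simp_all add: fun_eq_iff scaleR_add_right linear_add[OF lin] linear_scale[OF lin] scaleR_left_commute)
  then show "prim_L2 (\<eta> + \<xi>) = prim_L2 \<eta> + prim_L2 \<xi>" "prim_L2 (r *\<^sub>R \<eta>) = r *\<^sub>R prim_L2 \<eta>"
    by (simp_all add: prim_L2_def abs_L2_add abs_L2_scaleR delay_fun_sq_delay d)
  show "\<exists>K. \<forall>\<eta> :: 'a L2. norm (prim_L2 \<eta>) \<le> norm \<eta> * K"
    using delay_fun_prim(2)[OF delay_fun_bor]
    by (intro exI[of _ 1]) (auto simp: prim_L2_def norm_abs_delay_fun d)
qed

text \<open>The map E: c and \<eta> determine \<phi> as c plus the primitive of \<eta>, and the
  first component is \<phi>(0) - A1 \<phi>(-1).\<close>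

definition state :: "real ^ 'n ^ 'n \<Rightarrow> 'n::finite M2 \<Rightarrow> 'n M2" where
  "state A1 X = (fst X + initial (snd X) 0 - A1 *v fst X, const_L2 (fst X) + prim_L2 (snd X))"

text \<open>The map N, with the delay functional already integrated by parts into A0 c + \<integral>
  k \<eta>.\<close>

definition velocity :: "real ^ 'n ^ 'n \<Rightarrow> (real \<Rightarrow> real ^ 'n ^ 'n) \<Rightarrow> 'n::finite M2 \<Rightarrow> 'n M2" where
  "velocity A0 k X = (A0 *v fst X + moment k (bor (snd X)), snd X)"

definition pairing :: "(real \<Rightarrow> real ^ 'n ^ 'n) \<Rightarrow> 'n::finite M2 \<Rightarrow> 'n M2 \<Rightarrow> real" where
  "pairing k w X = fst w \<bullet> fst X - moment k (bor (snd w)) \<bullet> fst X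
     + conv (mat 1) 0 (bor (snd w)) (bor (snd X)) - hankel k (bor (snd w)) (bor (snd X))"

lemma bounded_linear_state: "bounded_linear (state A1)"
  unfolding state_def[abs_def]
  by (intro bounded_linear_Pair bounded_linear_add bounded_linear_sub bounded_linear_fst
      bounded_linear_compose[OF bounded_linear_initial bounded_linear_snd]
      bounded_linear_compose[OF mv.bounded_linear_right bounded_linear_fst]
      bounded_linear_compose[OF bounded_linear_const_L2 bounded_linear_fst]
      bounded_linear_compose[OF bounded_linear_prim_L2 bounded_linear_snd])

lemma bounded_linear_velocity: "delay_fun k \<Longrightarrow> bounded_linear (velocity A0 k)"
  unfolding velocity_def[abs_def]
  by (intro bounded_linear_Pair bounded_linear_add bounded_linear_snd
      bounded_linear_compose[OF bounded_linear_moment bounded_linear_snd]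
      bounded_linear_compose[OF mv.bounded_linear_right bounded_linear_fst])

lemma bounded_bilinear_add_real:
  fixes p q :: "'a::real_normed_vector \<Rightarrow> 'b::real_normed_vector \<Rightarrow> real"
  assumes "bounded_bilinear p" "bounded_bilinear q"
  shows "bounded_bilinear (\<lambda>x y. p x y + q x y)"
proof -
  interpret p: bounded_bilinear p by fact
  interpret q: bounded_bilinear q by fact
  obtain K L where K: "\<And>x y. norm (p x y) \<le> norm x * norm y * K" "\<And>x y. norm (q x y) \<le> norm x * norm y * L"
    using p.bounded q.bounded by blast
  show ?thesis
  proof
    have "norm (p x y + q x y) \<le> norm x * norm y * (K + L)" for x y
      using K[of x y] norm_triangle_ineq[of "p x y" "q x y"] by (simp add: distrib_left)
    then show "\<exists>K. \<forall>x y. norm (p x y + q x y) \<le> norm x * norm y * K" by blast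
  qed (auto simp: p.add_left q.add_left p.add_right q.add_right p.scaleR_left q.scaleR_left
      p.scaleR_right q.scaleR_right distrib_left)
qed

lemma bounded_bilinear_diff_real:
  fixes p q :: "'a::real_normed_vector \<Rightarrow> 'b::real_normed_vector \<Rightarrow> real"
  assumes p: "bounded_bilinear p" and q: "bounded_bilinear q"
  shows "bounded_bilinear (\<lambda>x y. p x y - q x y)"
proof -
  interpret q: bounded_bilinear q by fact
  have "bounded_bilinear (\<lambda>x y. q (- x) y)"
    using q.comp1[OF bounded_linear_minus[OF bounded_linear_ident]] .
  from bounded_bilinear_add_real[OF p this] show ?thesis by (simp add: q.minus_left)
qed

lemma bounded_bilinear_pairing:
  assumes k: "delay_fun k" shows "bounded_bilinear (pairing k)"
  unfolding pairing_def[abs_def]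
  by (intro bounded_bilinear_add_real bounded_bilinear_diff_real
      bounded_bilinear.comp[OF bounded_bilinear_inner] bounded_bilinear.comp[OF bounded_bilinear_conv]
      bounded_bilinear.comp[OF bounded_bilinear_hankel[OF k]] bounded_linear_fst bounded_linear_snd
      bounded_linear_compose[OF bounded_linear_moment[OF k] bounded_linear_snd])

text \<open>\<eta> is a component of the velocity, and c is recovered by subtracting the primitive
  of \<eta> from \<phi>.\<close>

lemma graph_norm_state:
  fixes A1 A0 :: "real ^ 'n ^ 'n"
  shows "\<exists>K. \<forall>X. norm X \<le> K * (norm (state A1 X) + norm (velocity A0 k X))"
proof -
  obtain K where K: "\<And>\<eta> :: (real ^ 'n) L2. norm (prim_L2 \<eta>) \<le> norm \<eta> * K" "K \<ge> 0"
    using bounded_linear.nonneg_bounded[OF bounded_linear_prim_L2] by blast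
  have "norm X \<le> (K + 2) * (norm (state A1 X) + norm (velocity A0 k X))" for X :: "'n M2"
  proof -
    have s: "norm (snd X) \<le> norm (velocity A0 k X)"
      using norm_snd_le[of "snd (velocity A0 k X)" "fst (velocity A0 k X)"] by (simp add: velocity_def)
    have "const_L2 (fst X) = snd (state A1 X) - prim_L2 (snd X)" by (simp add: state_def)
    then have "norm (fst X) \<le> norm (snd (state A1 X)) + norm (prim_L2 (snd X))"
      using norm_triangle_ineq4 by (metis norm_const_L2)
    also have "norm (snd (state A1 X)) \<le> norm (state A1 X)"
      using norm_snd_le[of "snd (state A1 X)" "fst (state A1 X)"] by simp
    also have "norm (prim_L2 (snd X)) \<le> K * norm (velocity A0 k X)"
      using K(1)[of "snd X"] mult_left_mono[OF s K(2)] by (simp add: mult.commute)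
    finally have "norm (fst X) \<le> norm (state A1 X) + K * norm (velocity A0 k X)" by simp
    moreover have "norm X \<le> norm (fst X) + norm (snd X)"
      using norm_Pair_le[of "fst X" "snd X"] by simp
    moreover have "K * norm (state A1 X) \<ge> 0" using K(2) by simp
    moreover have "norm (state A1 X) \<ge> 0" "norm (velocity A0 k X) \<ge> 0" by simp_all
    ultimately show ?thesis using s unfolding distrib_left distrib_right by linarith
  qed
  then show ?thesis by blast
qed

text \<open>The moment in \<open>velocity\<close> cancels the one in \<open>pairing\<close>; an
  inner product with A0, a convolution and a Hankel form remain, and each of them
  transposes.\<close>

lemma pairing_velocity:
  assumes k: "delay_fun k"
  shows "pairing (\<lambda>\<theta>. transpose (k \<theta>)) (velocity (transpose A0) (\<lambda>\<theta>. transpose (k \<theta>)) Y) X = pairing k (velocity A0 k X) Y"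
proof -
  have "conv (mat 1) 0 (bor (snd Y)) (bor (snd X)) = conv (mat 1) 0 (bor (snd X)) (bor (snd Y))"
    using conv_transpose[of "bor (snd Y)" "bor (snd X)" "mat 1" 0] by simp
  moreover have "hankel (\<lambda>\<theta>. transpose (k \<theta>)) (bor (snd Y)) (bor (snd X)) = hankel k (bor (snd X)) (bor (snd Y))"
    by (rule hankel_transpose[symmetric]) simp_all
  moreover have "(transpose A0 *v fst Y) \<bullet> fst X = (A0 *v fst X) \<bullet> fst Y"
    by (metis inner_matrix_vector inner_commute)
  ultimately show ?thesis by (simp only: pairing_def velocity_def fst_conv snd_conv inner_add_left)
qed

text \<open>The terms match crosswise: the integral of \<eta> against a constant is the convolution
  of that constant with \<eta>, the moment of a primitive is a Hankel form with a constant, and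
  primitives move across both forms. The other terms correspond by transposition.\<close>

lemma pairing_state:
  assumes k: "delay_fun k"
  shows "pairing (\<lambda>\<theta>. transpose (k \<theta>)) (state (transpose A1) Y) X = pairing k (state A1 X) Y"
proof -
  define kT where "kT = (\<lambda>\<theta>. transpose (k \<theta>))"
  have kT: "delay_fun kT" unfolding kT_def by (rule delay_fun_transpose[OF k])
  have tr: "(\<lambda>\<theta>. transpose (kT \<theta>)) = k" by (simp add: kT_def)
  note d [simp] = delay_fun_cst delay_fun_prim(1)[OF delay_fun_bor]
  define f where "f = bor (snd X)"
  define g where "g = bor (snd Y)"
  have [simp]: "delay_fun f" "delay_fun g" by (simp_all add: f_def g_def)
  \<comment> \<open>Stated for an arbitrary kernel and matrix, since both systems are expanded with
    it.\<close>
  have exp: "pairing k (state A1 X) Y =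
      fst X \<bullet> fst Y + (LINT s|lborel. bor (snd X) s) \<bullet> fst Y - (A1 *v fst X) \<bullet> fst Y
      - moment k (cst (fst X)) \<bullet> fst Y - moment k (prim (bor (snd X))) \<bullet> fst Y
      + conv (mat 1) 0 (cst (fst X)) (bor (snd Y)) + conv (mat 1) 0 (prim (bor (snd X))) (bor (snd Y))
      - hankel k (cst (fst X)) (bor (snd Y)) - hankel k (prim (bor (snd X))) (bor (snd Y))"
    if k: "delay_fun k" for k and A1 :: "real ^ 'n ^ 'n" and X Y
  proof -
    have "bor (const_L2 (fst X)) = bor (abs_L2 (cst (fst X)))" "bor (prim_L2 (snd X)) = bor (abs_L2 (prim (bor (snd X))))"
      by (simp_all add: const_L2_def prim_L2_def)
    then have ae: "AE x in lborel. bor (const_L2 (fst X)) x = cst (fst X) x"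
      "AE x in lborel. bor (prim_L2 (snd X)) x = prim (bor (snd X)) x"
      using bor_abs[OF delay_fun_cst, of "fst X"] bor_abs[OF delay_fun_prim(1)[OF delay_fun_bor], of "snd X"] by simp_all
    show ?thesis
      unfolding pairing_def state_def fst_conv snd_conv initial_0
      by (simp add: linear_add[OF bounded_linear.linear[OF bounded_linear_moment[OF k]]]
          bounded_bilinear.add_left[OF bounded_bilinear_conv] bounded_bilinear.add_left[OF bounded_bilinear_hankel[OF k]]
          conv_cong_AE[OF _ _ _ ae(1)] conv_cong_AE[OF _ _ _ ae(2)]
          hankel_cong_AE[OF _ _ _ ae(1)] hankel_cong_AE[OF _ _ _ ae(2)]
          moment_cong_AE[OF k _ _ ae(1)] moment_cong_AE[OF k _ _ ae(2)]
          inner_add_left inner_diff_left)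
  qed
  have cst_conv: "conv (mat 1) 0 (cst c) h = (LINT s|lborel. h s) \<bullet> c" if "delay_fun h" for c and h :: "real \<Rightarrow> real ^ 'n"
    using conv_transpose[of "cst c" h "mat 1" 0] conv_cst_0[OF that, of c] that by simp
  have cst_hankel: "hankel k (cst c) g = moment kT (prim g) \<bullet> c" "hankel kT (cst c) f = moment k (prim f) \<bullet> c" for c
    using hankel_transpose[of "cst c" g k] hankel_cst[OF kT, of g c] hankel_transpose[of "cst c" f kT]
      hankel_cst[OF k, of f c] by (simp_all add: kT_def tr[unfolded kT_def])
  have e3: "moment kT (cst (fst Y)) \<bullet> fst X = moment k (cst (fst X)) \<bullet> fst Y"
    unfolding moment_inner[OF kT delay_fun_cst] moment_inner[OF k delay_fun_cst]
  proof (rule Bochner_Integration.integral_cong)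
    fix \<theta>
    have "(transpose (k \<theta>) *v fst Y) \<bullet> fst X = (k \<theta> *v fst X) \<bullet> fst Y"
      by (metis inner_matrix_vector inner_commute)
    then show "(kT \<theta> *v cst (fst Y) \<theta>) \<bullet> fst X = (k \<theta> *v cst (fst X) \<theta>) \<bullet> fst Y"
      by (simp only: kT_def cst_def mv.scaleR_right inner_scaleR_left)
  qed simp
  have e4: "conv (mat 1) 0 (prim g) f = conv (mat 1) 0 (prim f) g"
    using conv_transpose[of "prim g" f "mat 1" 0] conv_prim[of f g 0 "mat 1"]
      delay_fun_prim(1)[of g] by simp
  have e5: "hankel kT (prim g) f = hankel k (prim f) g"
    using hankel_transpose[of "prim g" f kT] hankel_prim[OF k, of f g] delay_fun_prim(1)[of g] by (simp add: tr)
  have e6: "(transpose A1 *v fst Y) \<bullet> fst X = (A1 *v fst X) \<bullet> fst Y"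
    by (metis inner_matrix_vector inner_commute)
  show ?thesis
    unfolding kT_def[symmetric] exp[OF k] exp[OF kT] f_def[symmetric] g_def[symmetric]
    by (simp only: e3 e4 e5 e6 cst_hankel cst_conv \<open>delay_fun f\<close> \<open>delay_fun g\<close> inner_commute[of "fst Y" "fst X"])
qed

section \<open>The inf-sup condition for the pairing\<close>

lemma delay_fun_exp:
  assumes f: "delay_fun f" and r: "r \<ge> 0"
  shows "delay_fun (\<lambda>\<sigma>. exp (r * \<sigma>) *\<^sub>R f \<sigma>)" "nrm2 (\<lambda>\<sigma>. exp (r * \<sigma>) *\<^sub>R f \<sigma>) \<le> nrm2 f"
    and "delay_fun (\<lambda>\<sigma>. exp (- r * \<sigma>) *\<^sub>R f \<sigma>)" "nrm2 (\<lambda>\<sigma>. exp (- r * \<sigma>) *\<^sub>R f \<sigma>) \<le> exp r * nrm2 f"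
    and "nrm2 f \<le> nrm2 (\<lambda>\<sigma>. exp (- r * \<sigma>) *\<^sub>R f \<sigma>)"
proof -
  note [measurable] = delay_fun_measurable[OF f]
  have m: "(\<lambda>\<sigma>. exp (r * \<sigma>) *\<^sub>R f \<sigma>) \<in> borel_measurable borel" "(\<lambda>\<sigma>. exp (- r * \<sigma>) *\<^sub>R f \<sigma>) \<in> borel_measurable borel"
    by measurable
  have 1: "norm (exp (r * \<sigma>) *\<^sub>R f \<sigma>) \<le> 1 * norm (f \<sigma>)" for \<sigma>
    using r delay_fun_zero[OF f, of \<sigma>]
    by (cases "\<sigma> \<in> {-1..0}") (auto intro!: mult_left_le_one_le simp: mult_nonneg_nonpos)
  have 2: "norm (exp (- r * \<sigma>) *\<^sub>R f \<sigma>) \<le> exp r * norm (f \<sigma>)" for \<sigma>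
    using r delay_fun_zero[OF f, of \<sigma>] mult_left_mono[of "- \<sigma>" 1 r]
    by (cases "\<sigma> \<in> {-1..0}") (auto intro!: mult_right_mono)
  have 3: "norm (f \<sigma>) \<le> 1 * norm (exp (- r * \<sigma>) *\<^sub>R f \<sigma>)" for \<sigma>
  proof (cases "\<sigma> \<in> {-1..0}")
    case True
    then have "1 \<le> exp (- r * \<sigma>)" using r by (simp add: mult_nonneg_nonpos)
    then show ?thesis using mult_right_mono[of 1 "exp (- r * \<sigma>)" "norm (f \<sigma>)"] by simp
  qed (use delay_fun_zero[OF f, of \<sigma>] in simp)
  note n1 = nrm2_mono[OF delay_fun_sq[OF f] m(1) 1] and n2 = nrm2_mono[OF delay_fun_sq[OF f] m(2) 2]
  show d: "delay_fun (\<lambda>\<sigma>. exp (r * \<sigma>) *\<^sub>R f \<sigma>)" "delay_fun (\<lambda>\<sigma>. exp (- r * \<sigma>) *\<^sub>R f \<sigma>)"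
    using n1(1) n2(1) delay_fun_zero[OF f] by (auto simp: delay_fun_def)
  show "nrm2 (\<lambda>\<sigma>. exp (r * \<sigma>) *\<^sub>R f \<sigma>) \<le> nrm2 f" using n1(2) by simp
  show "nrm2 (\<lambda>\<sigma>. exp (- r * \<sigma>) *\<^sub>R f \<sigma>) \<le> exp r * nrm2 f" using n2(2) by simp
  show "nrm2 f \<le> nrm2 (\<lambda>\<sigma>. exp (- r * \<sigma>) *\<^sub>R f \<sigma>)"
    using nrm2_mono(2)[OF delay_fun_sq[OF d(2)] _ 3] by simp
qed

text \<open>The arguments \<sigma> and \<theta> - 1 - \<sigma> add up to \<theta> - 1, so the
  weights multiply to a factor independent of \<sigma>.\<close>

lemma conv_exp:
  "conv M \<theta> (\<lambda>\<sigma>. exp (r * \<sigma>) *\<^sub>R f \<sigma>) (\<lambda>\<sigma>. exp (r * \<sigma>) *\<^sub>R g \<sigma>) = exp (r * (\<theta> - 1)) * conv M \<theta> f g"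
proof -
  have "(M *v (exp (r * \<sigma>) *\<^sub>R f \<sigma>)) \<bullet> (exp (r * (\<theta> - 1 - \<sigma>)) *\<^sub>R g (\<theta> - 1 - \<sigma>)) =
      exp (r * (\<theta> - 1)) * ((M *v f \<sigma>) \<bullet> g (\<theta> - 1 - \<sigma>))" for \<sigma>
    by (simp add: mv.scaleR_right exp_add[symmetric] algebra_simps flip: mult.assoc)
  then show ?thesis by (simp add: conv_def)
qed

text \<open>On the support of \<open>k\<close> the weights are at most 1 and tend to 0 except at the
  null set \<theta> = 0, so dominated convergence applies.\<close>

lemma exp_weight_small:
  assumes k: "delay_fun (k :: real \<Rightarrow> 'a::euclidean_space)"
  obtains r where "r \<ge> 0" "(LINT \<theta>|lborel. exp (r * \<theta>) * norm (k \<theta>)) \<le> 1 / 2"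
    "integrable lborel (\<lambda>\<theta>. exp (r * \<theta>) * norm (k \<theta>))"
proof -
  note [measurable] = delay_fun_measurable[OF k]
  have i: "integrable lborel (\<lambda>\<theta>. norm (k \<theta>))" using delay_fun_integrable(1)[OF k] by simp
  have le: "norm (exp (real n * \<theta>) * norm (k \<theta>)) \<le> norm (k \<theta>)" for n \<theta>
    using delay_fun_zero[OF k, of \<theta>]
    by (cases "\<theta> \<in> {-1..0}") (auto intro!: mult_left_le_one_le simp: mult_nonneg_nonpos abs_mult)
  have "(\<lambda>n. LINT \<theta>|lborel. exp (real n * \<theta>) * norm (k \<theta>)) \<longlonglongrightarrow> (LINT (\<theta>::real)|lborel. 0)"
  proof (rule integral_dominated_convergence[where w="\<lambda>\<theta>. norm (k \<theta>)"])
    have "AE \<theta> in lborel. \<theta> \<noteq> (0::real)" by (rule AE_lborel_singleton)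
    then show "AE \<theta> in lborel. (\<lambda>n. exp (real n * \<theta>) * norm (k \<theta>)) \<longlonglongrightarrow> 0"
    proof eventually_elim
      case (elim \<theta>)
      show ?case
      proof (cases "\<theta> \<in> {-1..0}")
        case True
        then have "norm (exp \<theta>) < 1" using elim by simp
        from LIMSEQ_power_zero[OF this] have "(\<lambda>n. exp (real n * \<theta>)) \<longlonglongrightarrow> 0"
          by (simp add: exp_of_nat_mult)
        from tendsto_mult_left_zero[OF this] show ?thesis .
      qed (use delay_fun_zero[OF k, of \<theta>] in simp)
    qed
  qed (use i le in auto)
  then have "(\<lambda>n. LINT \<theta>|lborel. exp (real n * \<theta>) * norm (k \<theta>)) \<longlonglongrightarrow> 0" by simp
  from order_tendstoD(2)[OF this, of "1/2"] obtain n where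
    "(LINT \<theta>|lborel. exp (real n * \<theta>) * norm (k \<theta>)) < 1 / 2"
    by (auto simp: eventually_sequentially)
  moreover have "integrable lborel (\<lambda>\<theta>. exp (real n * \<theta>) * norm (k \<theta>))"
    by (rule Bochner_Integration.integrable_bound[OF i]) (use le in auto)
  ultimately show ?thesis by (intro that[of "real n"]) auto
qed

text \<open>
  Both terms are homogeneous under \<open>f(\<sigma>) \<mapsto> e\<^sup>r\<^sup>\<sigma> f(\<sigma>)\<close>, up to the weight \<open>e\<^sup>r\<^sup>\<theta>\<close> on the kernel; for large \<open>r\<close> this
  weight makes the Hankel term small.
\<close>

lemma conv_minus_hankel_coercive:
  assumes k: "delay_fun k"
  shows "\<exists>a>0. \<exists>K\<ge>0. \<forall>f. delay_fun f \<longrightarrow>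
    (\<exists>g. delay_fun g \<and> nrm2 g \<le> K * nrm2 f \<and> a * (nrm2 f)\<^sup>2 \<le> conv (mat 1) 0 f g - hankel k f g)"
proof -
  obtain r where r: "r \<ge> 0" "(LINT \<theta>|lborel. exp (r * \<theta>) * norm (k \<theta>)) \<le> 1 / 2"
    and ri: "integrable lborel (\<lambda>\<theta>. exp (r * \<theta>) * norm (k \<theta>))"
    by (rule exp_weight_small[OF k])
  have main: "\<exists>g. delay_fun g \<and> nrm2 g \<le> exp r * nrm2 f \<and>
      exp (- r) / 2 * (nrm2 f)\<^sup>2 \<le> conv (mat 1) 0 f g - hankel k f g" if f: "delay_fun f" for f
  proof -
    define f0 where "f0 \<sigma> = exp (- r * \<sigma>) *\<^sub>R f \<sigma>" for \<sigma>
    \<comment> \<open>Reflection about -1/2 turns the convolution at \<theta> = 0 into the squared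
      norm of \<open>f0\<close>.\<close>
    define g0 where "g0 \<rho> = f0 (-1 - \<rho>)" for \<rho>
    define g where "g \<rho> = exp (r * \<rho>) *\<^sub>R g0 \<rho>" for \<rho>
    have f0: "delay_fun f0" "nrm2 f0 \<le> exp r * nrm2 f" "nrm2 f \<le> nrm2 f0"
      using delay_fun_exp(3,4,5)[OF f r(1)] by (simp_all add: f0_def[abs_def])
    have g0: "delay_fun g0" "nrm2 g0 = nrm2 f0"
    proof -
      show "nrm2 g0 = nrm2 f0" unfolding g0_def by (rule sq_integrable_reflect(2)[OF delay_fun_sq[OF f0(1)]])
      have "sq_integrable lborel g0" unfolding g0_def by (rule sq_integrable_reflect(1)[OF delay_fun_sq[OF f0(1)]])
      moreover have "g0 \<rho> = 0" if "\<rho> \<notin> {-1..0}" for \<rho>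
        unfolding g0_def by (rule delay_fun_zero[OF f0(1)]) (use that in auto)
      ultimately show "delay_fun g0" by (auto simp: delay_fun_def)
    qed
    have g: "delay_fun g" "nrm2 g \<le> nrm2 g0"
      unfolding g_def by (rule delay_fun_exp[OF g0(1) r(1)])+
    have f_eq: "f = (\<lambda>\<sigma>. exp (r * \<sigma>) *\<^sub>R f0 \<sigma>)" by (simp add: f0_def fun_eq_iff flip: exp_add)
    have cv: "conv M \<theta> f g = exp (r * (\<theta> - 1)) * conv M \<theta> f0 g0" for M \<theta>
      unfolding f_eq g_def by (rule conv_exp)
    have c1: "conv (mat 1) 0 f0 g0 = (nrm2 f0)\<^sup>2"
      by (simp add: conv_def g0_def nrm2_sq power2_norm_eq_inner)
    have "hankel k f g \<le> (LINT \<theta>|lborel. exp (- r) * (nrm2 f0)\<^sup>2 * (exp (r * \<theta>) * norm (k \<theta>)))"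
      unfolding hankel_def
    proof (rule integral_mono[OF hankel_integrable[OF f g(1) k]])
      show "integrable lborel (\<lambda>\<theta>. exp (- r) * (nrm2 f0)\<^sup>2 * (exp (r * \<theta>) * norm (k \<theta>)))"
        using ri by (rule integrable_mult_right)
      fix \<theta>
      have "conv (k \<theta>) \<theta> f0 g0 \<le> norm (k \<theta>) * (nrm2 f0 * nrm2 f0)"
        using conv_bound[OF f0(1) g0(1), of "k \<theta>" \<theta>] g0(2) by simp
      then have "conv (k \<theta>) \<theta> f g \<le> exp (r * (\<theta> - 1)) * (norm (k \<theta>) * (nrm2 f0 * nrm2 f0))"
        unfolding cv by (intro mult_left_mono) auto
      also have "\<dots> = exp (- r) * (nrm2 f0)\<^sup>2 * (exp (r * \<theta>) * norm (k \<theta>))"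
        by (simp add: right_diff_distrib exp_diff exp_minus power2_eq_square field_simps)
      finally show "conv (k \<theta>) \<theta> f g \<le> exp (- r) * (nrm2 f0)\<^sup>2 * (exp (r * \<theta>) * norm (k \<theta>))" .
    qed
    also have "\<dots> = exp (- r) * (nrm2 f0)\<^sup>2 * (LINT \<theta>|lborel. exp (r * \<theta>) * norm (k \<theta>))"
      by (rule integral_mult_right_zero)
    also have "\<dots> \<le> exp (- r) * (nrm2 f0)\<^sup>2 * (1 / 2)" by (intro mult_left_mono r(2)) simp
    \<comment> \<open>The convolution term equals \<open>exp (- r) * (nrm2 f0)\<^sup>2\<close> and
      the Hankel term takes at most half of it.\<close>
    finally have "exp (- r) / 2 * (nrm2 f0)\<^sup>2 \<le> conv (mat 1) 0 f g - hankel k f g"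
      unfolding cv c1 by simp
    moreover have "exp (- r) / 2 * (nrm2 f)\<^sup>2 \<le> exp (- r) / 2 * (nrm2 f0)\<^sup>2"
      by (intro mult_left_mono power_mono f0(3)) auto
    ultimately have "exp (- r) / 2 * (nrm2 f)\<^sup>2 \<le> conv (mat 1) 0 f g - hankel k f g" by (rule order_trans[rotated])
    moreover have "nrm2 g \<le> exp r * nrm2 f" using g(2) g0(2) f0(2) by simp
    ultimately show ?thesis using g(1) by blast
  qed
  show ?thesis by (intro exI[of _ "exp (- r) / 2"] exI[of _ "exp r"] conjI allI impI main) auto
qed

lemma pairing_coercive:
  assumes k: "delay_fun k"
  shows "\<exists>K. \<forall>w. \<exists>X. norm X \<le> K * norm w \<and> (norm w)\<^sup>2 \<le> pairing k w X"
proof -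
  obtain a K where a: "a > 0" and K: "K \<ge> 0" and ex: "\<forall>f. delay_fun f \<longrightarrow>
    (\<exists>g. delay_fun g \<and> nrm2 g \<le> K * nrm2 f \<and> a * (nrm2 f)\<^sup>2 \<le> conv (mat 1) 0 f g - hankel k f g)"
    using conv_minus_hankel_coercive[OF k] by (elim exE conjE)
  define m where "m = nrm2 k"
  \<comment> \<open>With the test element (2 v, s \<eta>), the choice s a =
    \<open>m\<^sup>2 + 1\<close> leaves one |v|^2 and m^2 |\<psi>|^2 to complete the square with the
    moment term, and still one |v|^2 + |\<psi>|^2.\<close>
  define s where "s = (m\<^sup>2 + 1) / a"
  have s: "s \<ge> 0" using a by (simp add: s_def)
  have "\<exists>X. norm X \<le> (2 + s * K) * norm w \<and> (norm w)\<^sup>2 \<le> pairing k w X" for w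
  proof -
    obtain v \<psi> where w: "w = (v, \<psi>)" by (cases w)
    obtain g where g: "delay_fun g" "nrm2 g \<le> K * norm \<psi>"
      "a * (norm \<psi>)\<^sup>2 \<le> conv (mat 1) 0 (bor \<psi>) g - hankel k (bor \<psi>) g"
      using ex[rule_format, OF delay_fun_bor, of \<psi>] by auto
    define \<eta> where "\<eta> = abs_L2 g"
    have n\<eta>: "norm \<eta> \<le> K * norm \<psi>" using g by (simp add: \<eta>_def norm_abs_delay_fun)
    have ae: "AE x in lborel. bor \<eta> x = g x" unfolding \<eta>_def by (rule bor_abs[OF g(1)])
    have sw: "conv (mat 1) 0 (bor \<psi>) (bor \<eta>) = conv (mat 1) 0 (bor \<psi>) g" "hankel k (bor \<psi>) (bor \<eta>) = hankel k (bor \<psi>) g"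
      using conv_transpose[OF delay_fun_bor[of \<psi>] delay_fun_bor[of \<eta>], of "mat 1" 0]
        conv_transpose[OF delay_fun_bor[of \<psi>] g(1), of "mat 1" 0]
        hankel_transpose[OF delay_fun_bor[of \<psi>] delay_fun_bor[of \<eta>], of k]
        hankel_transpose[OF delay_fun_bor[of \<psi>] g(1), of k]
        conv_cong_AE[OF delay_fun_bor g(1) delay_fun_bor ae] hankel_cong_AE[OF delay_fun_bor g(1) delay_fun_bor ae]
      by simp_all
    define X where "X = (2 *\<^sub>R v, s *\<^sub>R \<eta>)"
    have nv: "norm v \<le> norm w" "norm \<psi> \<le> norm w"
      unfolding w by (rule norm_fst_le, rule norm_snd_le)
    have "norm X \<le> 2 * norm v + s * norm \<eta>"
      using norm_Pair_le[of "2 *\<^sub>R v" "s *\<^sub>R \<eta>"] s by (simp add: X_def)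
    also have "\<dots> \<le> 2 * norm w + s * (K * norm w)"
      using nv K s n\<eta> by (intro add_mono mult_left_mono order_trans[OF n\<eta>]) auto
    finally have 1: "norm X \<le> (2 + s * K) * norm w" by (simp add: algebra_simps)
    have "moment k (bor \<psi>) \<bullet> v \<le> (m * norm \<psi>) * norm v"
    proof -
      have "moment k (bor \<psi>) \<bullet> v \<le> norm (moment k (bor \<psi>)) * norm v" by (rule norm_cauchy_schwarz)
      also have "\<dots> \<le> (m * norm \<psi>) * norm v"
        using integrable_bilinear_delay(2)[OF k delay_fun_bor, of \<psi>] by (intro mult_right_mono) (auto simp: moment_def m_def)
      finally show ?thesis .
    qed
    moreover have "s * (a * (norm \<psi>)\<^sup>2) \<le> s * (conv (mat 1) 0 (bor \<psi>) (bor \<eta>) - hankel k (bor \<psi>) (bor \<eta>))"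
      unfolding sw by (intro mult_left_mono g(3) s)
    moreover have "s * (a * (norm \<psi>)\<^sup>2) = (m\<^sup>2 + 1) * (norm \<psi>)\<^sup>2" using a by (simp add: s_def)
    moreover have "pairing k w X = 2 * (norm v)\<^sup>2 - 2 * (moment k (bor \<psi>) \<bullet> v)
        + s * (conv (mat 1) 0 (bor \<psi>) (bor \<eta>) - hankel k (bor \<psi>) (bor \<eta>))"
      unfolding pairing_def w X_def fst_conv snd_conv
        bounded_bilinear.scaleR_right[OF bounded_bilinear_conv] bounded_bilinear.scaleR_right[OF bounded_bilinear_hankel[OF k]]
      by (simp add: power2_norm_eq_inner right_diff_distrib)
    moreover have "0 \<le> (norm v)\<^sup>2 - 2 * (m * norm \<psi> * norm v) + m\<^sup>2 * (norm \<psi>)\<^sup>2"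
    proof -
      have "0 \<le> (norm v - m * norm \<psi>)\<^sup>2" by simp
      also have "\<dots> = (norm v)\<^sup>2 - 2 * (m * norm \<psi> * norm v) + m\<^sup>2 * (norm \<psi>)\<^sup>2"
        by (simp add: power2_eq_square algebra_simps)
      finally show ?thesis .
    qed
    moreover have "(m\<^sup>2 + 1) * (norm \<psi>)\<^sup>2 = m\<^sup>2 * (norm \<psi>)\<^sup>2 + (norm \<psi>)\<^sup>2" by (simp add: distrib_right)
    moreover have "(norm w)\<^sup>2 = (norm v)\<^sup>2 + (norm \<psi>)\<^sup>2" by (simp add: w norm_Pair)
    ultimately have "(norm w)\<^sup>2 \<le> pairing k w X" by linarith
    with 1 show ?thesis by blast
  qed
  then show ?thesis by blast
qed

subsection \<open>The domain of the generator\<close>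

text \<open>The absolutely continuous representative \<phi> itself, which has point values, in
  contrast to the class stored in \<open>state\<close>.\<close>

definition profile :: "'n::finite M2 \<Rightarrow> real \<Rightarrow> real ^ 'n" where
  "profile X \<theta> = fst X + initial (snd X) \<theta>"

lemma integral_rep_L2:
  assumes \<theta>: "\<theta> \<in> {-1..0}"
  shows "(LINT s:{-1..\<theta>}|lebesgue. rep_L2 \<eta> s) = initial \<eta> \<theta>"
proof -
  have "(LINT s:{-1..\<theta>}|lebesgue. rep_L2 \<eta> s) = (LINT s|lebesgue. indicator {..\<theta>} s *\<^sub>R bor \<eta> s)"
    unfolding set_lebesgue_integral_def
  proof (rule integral_cong_AE)
    have "set_integrable lebesgue {-1..\<theta>} (rep_L2 \<eta>)"
      by (rule set_integrable_subset[OF set_integrable_rep_L2]) (use \<theta> in auto)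
    then show "(\<lambda>s. indicator {-1..\<theta>} s *\<^sub>R rep_L2 \<eta> s) \<in> borel_measurable lebesgue"
      unfolding set_integrable_def by (rule borel_measurable_integrable)
    show "(\<lambda>s. indicator {..\<theta>} s *\<^sub>R bor \<eta> s) \<in> borel_measurable lebesgue"
      by (intro measurable_completion) measurable
    have "AE s in lborel. s \<in> {-1..0} \<longrightarrow> rep_L2 \<eta> s = bor \<eta> s"
      using rep_bor[of \<eta>] unfolding AE_delay_iff .
    then have "AE s in lebesgue. s \<in> {-1..0} \<longrightarrow> rep_L2 \<eta> s = bor \<eta> s" by (rule AE_completion)
    then show "AE s in lebesgue. indicator {-1..\<theta>} s *\<^sub>R rep_L2 \<eta> s = indicator {..\<theta>} s *\<^sub>R bor \<eta> s"
    proof eventually_elim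
      case (elim s)
      then show ?case using \<theta> delay_fun_zero[OF delay_fun_bor, of s \<eta>]
        by (cases "s \<in> {-1..0}") (auto simp: indicator_def)
    qed
  qed
  also have "\<dots> = initial \<eta> \<theta>" unfolding initial_def by (rule integral_completion) measurable
  finally show ?thesis .
qed

lemma profile_minus_1 [simp]: "profile X (-1) = fst X" by (simp add: profile_def)

lemma fst_state: "fst (state A1 X) = profile X 0 - A1 *v profile X (-1)"
  by (simp add: state_def profile_def)

lemma bor_state: "AE \<theta> in lborel. bor (snd (state A1 X)) \<theta> = indicator {-1..0} \<theta> *\<^sub>R profile X \<theta>"
proof -
  have "AE \<theta> in lborel. bor (const_L2 (fst X)) \<theta> = cst (fst X) \<theta>" "AE \<theta> in lborel. bor (prim_L2 (snd X)) \<theta> = prim (bor (snd X)) \<theta>"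
    unfolding const_L2_def prim_L2_def by (intro bor_abs delay_fun_cst delay_fun_prim(1)[OF delay_fun_bor])+
  with bor_add[of "const_L2 (fst X)" "prim_L2 (snd X)"] show ?thesis
    by eventually_elim (simp add: state_def cst_def prim_def profile_def initial_def scaleR_add_right)
qed

lemma H1_rep_state: "H1_rep (snd (state A1 X)) (profile X) (snd X)"
  unfolding H1_rep_def
proof (intro conjI ballI)
  have "AE \<theta> in delay_measure. bor (snd (state A1 X)) \<theta> = profile X \<theta>"
    unfolding AE_delay_iff using bor_state[of A1 X] by eventually_elim simp
  with rep_bor[of "snd (state A1 X)"] show "AE \<theta> in delay_measure. rep_L2 (snd (state A1 X)) \<theta> = profile X \<theta>"
    by eventually_elim simp
  show "profile X \<theta> = profile X (-1) + (LINT s:{-1..\<theta>}|lebesgue. rep_L2 (snd X) s)" if "\<theta> \<in> {-1..0}" for \<theta>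
    unfolding integral_rep_L2[OF that] by (simp add: profile_def)
qed

lemmas continuous_on_profile = H1_rep_continuous_on[OF H1_rep_state]
lemmas pointval_state = pointval_eq[OF H1_rep_state]
lemmas weak_deriv_state = weak_deriv_eq[OF H1_rep_state]

lemma range_state:
  fixes A1 :: "real ^ 'n ^ 'n"
  shows "range (state A1) = neutral_dom A1"
proof (rule set_eqI)
  fix x :: "'n M2"
  show "x \<in> range (state A1) \<longleftrightarrow> x \<in> neutral_dom A1"
  proof
    assume "x \<in> range (state A1)"
    then obtain X where x: "x = state A1 X" by blast
    have "snd x \<in> H1" unfolding x H1_def using H1_rep_state by blast
    then show "x \<in> neutral_dom A1"
      unfolding neutral_dom_def by (simp add: case_prod_beta x pointval_state fst_state)
  next
    assume x: "x \<in> neutral_dom A1"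
    then obtain f \<psi> where f: "H1_rep (snd x) f \<psi>" by (auto simp: neutral_dom_def H1_def)
    \<comment> \<open>The coordinates are the value at -1 and the derivative of the absolutely
      continuous representative.\<close>
    define X where "X = (f (-1), \<psi>)"
    have tr: "f \<theta> = profile X \<theta>" if "\<theta> \<in> {-1..0}" for \<theta>
      using H1_rep_integral[OF f that] integral_rep_L2[OF that, of \<psi>] by (simp add: profile_def X_def algebra_simps)
    have "AE \<theta> in delay_measure. rep_L2 (snd x) \<theta> = rep_L2 (snd (state A1 X)) \<theta>"
    proof -
      have "AE \<theta> in delay_measure. rep_L2 (snd x) \<theta> = f \<theta>" using f unfolding H1_rep_def by blast
      moreover have "AE \<theta> in delay_measure. rep_L2 (snd (state A1 X)) \<theta> = profile X \<theta>"
        using H1_rep_state[of A1 X] unfolding H1_rep_def by blast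
      moreover have "AE \<theta> in delay_measure. f \<theta> = profile X \<theta>" by (rule AE_I2) (simp add: tr)
      ultimately show ?thesis by eventually_elim simp
    qed
    then have s: "snd x = snd (state A1 X)"
      using abs_L2_eqI[OF sq_integrable_rep_L2 sq_integrable_rep_L2, of "snd x" "snd (state A1 X)"]
      by (simp add: abs_rep_L2)
    have "fst x = pointval (snd x) 0 - A1 *v pointval (snd x) (-1)" using x by (auto simp: neutral_dom_def)
    then have "fst x = fst (state A1 X)" unfolding s fst_state by (simp add: pointval_state)
    then have "x = state A1 X" using s by (rule prod_eqI)
    then show "x \<in> range (state A1)" by (rule range_eqI)
  qed
qed

text \<open>The kernel k of the integrated delay functional: inserting \<phi> as c plus the
  primitive of \<eta> into the A3 term and exchanging the integrations puts on \<eta>(s) the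
  integral of A3 from s to 0. The constant part becomes A0 = \<integral> A3.\<close>

definition reduced_kernel :: "(real \<Rightarrow> real ^ 'n ^ 'n) \<Rightarrow> (real \<Rightarrow> real ^ 'n ^ 'n) \<Rightarrow> real \<Rightarrow> real ^ 'n ^ 'n" where
  "reduced_kernel a2 a3 s = a2 s + indicator {-1..0} s *\<^sub>R (LINT \<theta>|lborel. indicator {s..} \<theta> *\<^sub>R a3 \<theta>)"

lemma delay_fun_reduced_kernel:
  assumes a2: "delay_fun a2" and a3: "delay_fun a3"
  shows "delay_fun (reduced_kernel a2 a3)"
  unfolding reduced_kernel_def[abs_def]
proof (rule delay_fun_add[OF a2])
  note [measurable] = delay_fun_measurable[OF a3]
  let ?p = "\<lambda>s. indicator {-1..0} s *\<^sub>R (LINT \<theta>|lborel. indicator {s..} \<theta> *\<^sub>R a3 \<theta>)"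
  show "delay_fun ?p"
  proof (rule delay_fun_bounded(1))
    have "indicator {s..} \<theta> *\<^sub>R a3 \<theta> = (if s \<le> \<theta> then a3 \<theta> else 0)" for s \<theta> by (simp add: indicator_def)
    then show "?p \<in> borel_measurable borel" by simp measurable
    fix s
    have "norm (?p s) \<le> norm (LINT \<theta>|lborel. indicator {s..} \<theta> *\<^sub>R a3 \<theta>)" by (simp add: indicator_def)
    also have "\<dots> \<le> (LINT \<theta>|lborel. norm (indicator {s..} \<theta> *\<^sub>R a3 \<theta>))" by (rule integral_norm_bound)
    also have "\<dots> \<le> (LINT \<theta>|lborel. norm (a3 \<theta>))"
      by (intro integral_mono integrable_norm integrable_mult_indicator delay_fun_integrable(1)[OF a3])
        (auto simp: indicator_def)
    finally show "norm (?p s) \<le> (LINT \<theta>|lborel. norm (a3 \<theta>))" .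
  qed auto
qed

lemma reduced_kernel_transpose:
  assumes a3: "delay_fun a3"
  shows "reduced_kernel (\<lambda>\<theta>. transpose (a2 \<theta>)) (\<lambda>\<theta>. transpose (a3 \<theta>)) = (\<lambda>s. transpose (reduced_kernel a2 a3 s))"
proof
  fix s
  note lin = bounded_linear.linear[OF bounded_linear_transpose]
  have "integrable lborel (\<lambda>\<theta>. indicator {s..} \<theta> *\<^sub>R a3 \<theta>)"
    by (intro integrable_mult_indicator delay_fun_integrable(1)[OF a3]) auto
  from integral_bounded_linear[OF bounded_linear_transpose this]
  show "reduced_kernel (\<lambda>\<theta>. transpose (a2 \<theta>)) (\<lambda>\<theta>. transpose (a3 \<theta>)) s = transpose (reduced_kernel a2 a3 s)"
    by (simp add: reduced_kernel_def linear_add[OF lin] linear_scale[OF lin])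
qed

lemma neutral_op_state:
  assumes a2: "delay_fun a2" and a3: "delay_fun a3"
    and A2: "AE \<theta> in delay_measure. A2 \<theta> = a2 \<theta>" and A3: "AE \<theta> in delay_measure. A3 \<theta> = a3 \<theta>"
    and m: "A2 \<in> borel_measurable delay_measure" "A3 \<in> borel_measurable delay_measure"
  shows "neutral_op A2 A3 (state A1 X) = velocity (LINT \<theta>|lborel. a3 \<theta>) (reduced_kernel a2 a3) X"
proof -
  note [measurable] = delay_fun_measurable[OF a2] delay_fun_measurable[OF a3]
  define \<eta> where "\<eta> = bor (snd X)"
  have \<eta>: "delay_fun \<eta>" by (simp add: \<eta>_def)
  note [measurable] = delay_fun_measurable[OF \<eta>]
  note d = delay_fun_cst[of "fst X"] delay_fun_prim(1)[OF \<eta>]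
  note [measurable] = d[THEN delay_fun_measurable]
  let ?F = "\<lambda>\<theta>. a2 \<theta> *v \<eta> \<theta> + a3 \<theta> *v (cst (fst X) \<theta> + prim \<eta> \<theta>)"
  have rm: "rep_L2 \<phi> \<in> borel_measurable delay_measure" for \<phi> :: "(real ^ 'n) L2"
    using sq_integrable_rep_L2[of \<phi>] by (simp add: sq_integrable_def)
  have "(LINT \<theta>:{-1..0}|lebesgue. A2 \<theta> *v rep_L2 (snd X) \<theta> + A3 \<theta> *v rep_L2 (snd (state A1 X)) \<theta>)
      = (LINT \<theta>|delay_measure. ?F \<theta>)"
    unfolding set_lint_lebesgue_on
  proof (rule integral_cong_AE)
    show "(\<lambda>\<theta>. A2 \<theta> *v rep_L2 (snd X) \<theta> + A3 \<theta> *v rep_L2 (snd (state A1 X)) \<theta>) \<in> borel_measurable delay_measure"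
      by (intro borel_measurable_add borel_measurable_matrix_vector m rm)
    show "?F \<in> borel_measurable delay_measure"
      by (intro measurable_restrict_space1 measurable_completion) measurable
    have "AE \<theta> in delay_measure. bor (snd (state A1 X)) \<theta> = profile X \<theta>"
      unfolding AE_delay_iff using bor_state[of A1 X] by eventually_elim simp
    moreover have "AE \<theta> in delay_measure. \<theta> \<in> {-1..0}" by (rule AE_I2) simp
    ultimately show "AE \<theta> in delay_measure. A2 \<theta> *v rep_L2 (snd X) \<theta> + A3 \<theta> *v rep_L2 (snd (state A1 X)) \<theta> = ?F \<theta>"
      using A2 A3 rep_bor[of "snd X"] rep_bor[of "snd (state A1 X)"]
    proof eventually_elim
      case (elim \<theta>)
      then show ?case by (simp add: profile_def initial_def cst_def prim_def \<eta>_def)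
    qed
  qed
  also have "\<dots> = (LINT \<theta>|lborel. ?F \<theta>)"
    by (rule integral_delay_measure) (use delay_fun_zero[OF a2] delay_fun_zero[OF a3] in auto)
  also have "\<dots> = (LINT \<theta>|lborel. a2 \<theta> *v \<eta> \<theta>) + ((LINT \<theta>|lborel. a3 \<theta> *v cst (fst X) \<theta>) + (LINT \<theta>|lborel. a3 \<theta> *v prim \<eta> \<theta>))"
    unfolding mv.add_right
    using integrable_bilinear_delay(1)[OF a2 \<eta>] integrable_bilinear_delay(1)[OF a3 d(1)] integrable_bilinear_delay(1)[OF a3 d(2)]
    by simp
  also have "(LINT \<theta>|lborel. a3 \<theta> *v cst (fst X) \<theta>) = (LINT \<theta>|lborel. a3 \<theta>) *v fst X"
  proof -
    have "a3 \<theta> *v cst (fst X) \<theta> = a3 \<theta> *v fst X" for \<theta>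
      using delay_fun_zero[OF a3, of \<theta>] by (cases "\<theta> \<in> {-1..0}") (auto simp: cst_def)
    then show ?thesis
      using integral_bounded_linear[OF mv.bounded_linear_left delay_fun_integrable(1)[OF a3], of "fst X"] by simp
  qed
  also have "(LINT \<theta>|lborel. a3 \<theta> *v prim \<eta> \<theta>) = (LINT s|lborel. (LINT \<theta>|lborel. indicator {s..} \<theta> *\<^sub>R a3 \<theta>) *v \<eta> s)"
  proof -
    have "a3 \<theta> *v prim \<eta> \<theta> = a3 \<theta> *v (LINT s|lborel. indicator {..\<theta>} s *\<^sub>R \<eta> s)" for \<theta>
      using delay_fun_zero[OF a3, of \<theta>] by (cases "\<theta> \<in> {-1..0}") (auto simp: prim_def)
    then show ?thesis
      using triangle_Fubini[OF bounded_bilinear.flip[OF bounded_bilinear_matrix_vector]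
          delay_fun_integrable(1)[OF \<eta>] delay_fun_integrable(1)[OF a3]] by simp
  qed
  also have "(LINT \<theta>|lborel. a2 \<theta> *v \<eta> \<theta>) + ((LINT \<theta>|lborel. a3 \<theta>) *v fst X
      + (LINT s|lborel. (LINT \<theta>|lborel. indicator {s..} \<theta> *\<^sub>R a3 \<theta>) *v \<eta> s))
      = (LINT \<theta>|lborel. a3 \<theta>) *v fst X + moment (reduced_kernel a2 a3) \<eta>"
  proof -
    \<comment> \<open>The tail integral of \<open>a3\<close> is not a delay function by itself; the
      difference of \<open>reduced_kernel a2 a3\<close> and \<open>a2\<close> is its cut-off, with
      the same effect on \<eta>.\<close>
    have k: "delay_fun (\<lambda>s. reduced_kernel a2 a3 s + (-1) *\<^sub>R a2 s)"
      by (intro delay_fun_add delay_fun_scaleR delay_fun_reduced_kernel a2 a3)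
    have eq: "(LINT \<theta>|lborel. indicator {s..} \<theta> *\<^sub>R a3 \<theta>) *v \<eta> s = (reduced_kernel a2 a3 s + (-1) *\<^sub>R a2 s) *v \<eta> s" for s
      using delay_fun_zero[OF \<eta>, of s] by (cases "s \<in> {-1..0}") (auto simp: reduced_kernel_def)
    have "moment (reduced_kernel a2 a3) \<eta> = (LINT s|lborel. a2 s *v \<eta> s + (reduced_kernel a2 a3 s + (-1) *\<^sub>R a2 s) *v \<eta> s)"
      unfolding moment_def by (simp add: mv.add_left[symmetric])
    also have "\<dots> = (LINT s|lborel. a2 s *v \<eta> s) + (LINT s|lborel. (reduced_kernel a2 a3 s + (-1) *\<^sub>R a2 s) *v \<eta> s)"
      by (rule Bochner_Integration.integral_add[OF integrable_bilinear_delay(1)[OF a2 \<eta>] integrable_bilinear_delay(1)[OF k \<eta>]])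
    finally show ?thesis by (simp add: eq add.commute add.left_commute)
  qed
  finally show ?thesis
    by (simp add: neutral_op_def case_prod_beta velocity_def weak_deriv_state \<eta>_def)
qed

subsection \<open>Transport of the state along orbits\<close>

lemma integral_continuous_lborel:
  fixes f :: "real \<Rightarrow> 'a::euclidean_space"
  assumes "continuous_on {a..b} f"
  shows "integrable lborel (\<lambda>s. indicator {a..b} s *\<^sub>R f s)"
    and "(LINT s|lborel. indicator {a..b} s *\<^sub>R f s) = integral {a..b} f"
proof -
  have i: "set_integrable lborel {a..b} f" by (rule borel_integrable_atLeastAtMost'[OF assms])
  then show "integrable lborel (\<lambda>s. indicator {a..b} s *\<^sub>R f s)" by (simp add: set_integrable_def)
  show "(LINT s|lborel. indicator {a..b} s *\<^sub>R f s) = integral {a..b} f"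
    using set_borel_integral_eq_integral(2)[OF i] by (simp add: set_lebesgue_integral_def)
qed

lemma initial_state:
  assumes \<theta>: "\<theta> \<in> {-1..0}"
  shows "initial (snd (state A1 X)) \<theta> = integral {-1..\<theta>} (profile X)"
proof -
  have c: "continuous_on {-1..\<theta>} (profile X)"
    by (rule continuous_on_subset[OF continuous_on_profile]) (use \<theta> in auto)
  have "initial (snd (state A1 X)) \<theta> = (LINT s|lborel. indicator {-1..\<theta>} s *\<^sub>R profile X s)"
    unfolding initial_def
  proof (rule integral_cong_AE)
    show "(\<lambda>s. indicator {-1..\<theta>} s *\<^sub>R profile X s) \<in> borel_measurable lborel"
      using integral_continuous_lborel(1)[OF c] by (rule borel_measurable_integrable)
    show "AE s in lborel. indicator {..\<theta>} s *\<^sub>R bor (snd (state A1 X)) s = indicator {-1..\<theta>} s *\<^sub>R profile X s"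
      using bor_state[of A1 X] by eventually_elim (use \<theta> in \<open>auto simp: indicator_def\<close>)
  qed measurable
  also have "\<dots> = integral {-1..\<theta>} (profile X)" by (rule integral_continuous_lborel(2)[OF c])
  finally show ?thesis .
qed

lemma initial_state_derivative:
  assumes \<theta>: "\<theta> \<in> {-1..0}"
  shows "((initial (snd (state A1 X))) has_vector_derivative profile X \<theta>) (at \<theta> within {-1..0})"
proof (rule has_vector_derivative_transform[OF \<theta> initial_state])
  show "((\<lambda>\<theta>. integral {-1..\<theta>} (profile X)) has_vector_derivative profile X \<theta>) (at \<theta> within {-1..0})"
    by (rule integral_has_vector_derivative[OF continuous_on_profile \<theta>])
qed

lemma initial_state_shifted_derivative:
  assumes "\<And>r. r \<in> A \<Longrightarrow> a + m * r \<in> {-1..0}" and s: "s \<in> A"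
  shows "((\<lambda>r. initial (snd (state A1 X)) (a + m * r)) has_vector_derivative m *\<^sub>R profile X (a + m * s)) (at s within A)"
proof (rule vector_diff_chain_within[of "\<lambda>r. a + m * r" m s A "initial (snd (state A1 X))", unfolded o_def])
  show "((\<lambda>r. a + m * r) has_vector_derivative m) (at s within A)"
    by (auto intro!: derivative_eq_intros)
  show "(initial (snd (state A1 X)) has_vector_derivative profile X (a + m * s)) (at (a + m * s) within (\<lambda>r. a + m * r) ` A)"
    by (rule has_vector_derivative_within_subset[OF initial_state_derivative]) (use assms in auto)
qed

lemma norm_snd_state: "(norm (snd (state A1 X)))\<^sup>2 = integral {-1..0} (\<lambda>\<theta>. (norm (profile X \<theta>))\<^sup>2)"
proof -
  have c: "continuous_on {-1..0} (\<lambda>\<theta>. (norm (profile X \<theta>))\<^sup>2)" by (intro continuous_intros continuous_on_profile)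
  have "(norm (snd (state A1 X)))\<^sup>2 = (LINT \<theta>|lborel. (norm (bor (snd (state A1 X)) \<theta>))\<^sup>2)"
    by (simp add: nrm2_sq[symmetric])
  also have "\<dots> = (LINT \<theta>|lborel. indicator {-1..0} \<theta> *\<^sub>R (norm (profile X \<theta>))\<^sup>2)"
  proof (rule integral_cong_AE)
    show "(\<lambda>\<theta>. indicator {-1..0} \<theta> *\<^sub>R (norm (profile X \<theta>))\<^sup>2) \<in> borel_measurable lborel"
      using integral_continuous_lborel(1)[OF c] by (rule borel_measurable_integrable)
    show "AE \<theta> in lborel. (norm (bor (snd (state A1 X)) \<theta>))\<^sup>2 = indicator {-1..0} \<theta> *\<^sub>R (norm (profile X \<theta>))\<^sup>2"
      using bor_state[of A1 X] by eventually_elim (auto simp: indicator_def)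
  qed measurable
  also have "\<dots> = integral {-1..0} (\<lambda>\<theta>. (norm (profile X \<theta>))\<^sup>2)" by (rule integral_continuous_lborel(2)[OF c])
  finally show ?thesis .
qed

lemma initial_diff: "initial (\<eta> - \<xi>) \<theta> = initial \<eta> \<theta> - initial \<xi> \<theta>"
  and initial_scaleR: "initial (r *\<^sub>R \<eta>) \<theta> = r *\<^sub>R initial \<eta> \<theta>"
  by (rule linear_diff linear_scale, rule bounded_linear.linear[OF bounded_linear_initial])+

locale neutral_semigroup = parametrised_semigroup "state A1" "velocity A0 k" A S
  for A1 A0 :: "real ^ 'n ^ 'n" and k A S +
  assumes kernel: "delay_fun k"
begin

text \<open>That the orbit shifts the L2 component to the left has to be extracted from the
  generator, whose second component is the derivative in \<theta>. The primitive of the L2 component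
  is followed at the moving point t - 1 - s: the change in time and the change of place cancel up to
  the value of \<phi> at -1.\<close>

lemma transport_derivative:
  assumes t: "t \<in> {0..1}" and s: "s \<in> {0..t}"
  shows "((\<lambda>r. initial (snd (S r (state A1 X))) (t - 1 - r)) has_vector_derivative - fst (orbit s X)) (at s within {0..t})"
proof -
  let ?F = "at s within {0..t}"
  define \<psi> where "\<psi> r = snd (S r (state A1 X))" for r
  define \<eta> where "\<eta> = snd (orbit s X)"
  have \<psi>: "\<psi> s = snd (state A1 (orbit s X))" using s by (simp add: \<psi>_def E_orbit)
  have "((\<lambda>r. S r (state A1 X)) has_vector_derivative velocity A0 k (orbit s X)) ?F"
    by (rule has_vector_derivative_within_subset[OF orbit_derivative]) (use s in auto)
  from bounded_linear.has_vector_derivative[OF bounded_linear_snd this]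
  have "(\<psi> has_vector_derivative \<eta>) ?F" by (simp add: \<psi>_def[abs_def] velocity_def \<eta>_def)
  then have q: "((\<lambda>r. (\<psi> r - \<psi> s) /\<^sub>R (r - s)) \<longlongrightarrow> \<eta>) ?F" unfolding has_vector_derivative_iff_quotient .
  have rng: "t - 1 - r \<in> {-1..0}" if "r \<in> {0..t}" for r using that t by auto
  \<comment> \<open>The quotient splits into three parts: the error of the time quotient, small
    uniformly in the evaluation point as \<open>initial\<close> is bounded by the norm; its limit
    \<eta> at the moving point; and the motion of the point for a fixed class.\<close>
  have "((\<lambda>r. initial ((\<psi> r - \<psi> s) /\<^sub>R (r - s) - \<eta>) (t - 1 - r)) \<longlongrightarrow> 0) ?F"
    by (rule Lim_null_comparison[OF always_eventually tendsto_norm_zero[OF LIM_zero[OF q]]])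
      (simp add: norm_initial_le)
  moreover have "((\<lambda>r. initial \<eta> (t - 1 - r)) \<longlongrightarrow> initial \<eta> (t - 1 - s)) ?F"
  proof -
    have "continuous_on {0..t} (\<lambda>r. profile (orbit s X) (t - 1 - r) - fst (orbit s X))"
      by (intro continuous_intros continuous_on_compose2[OF continuous_on_profile]) (use t in auto)
    then have "continuous_on {0..t} (\<lambda>r. initial \<eta> (t - 1 - r))" by (simp add: profile_def \<eta>_def)
    then show ?thesis using s by (auto simp: continuous_on_def)
  qed
  moreover have "((\<lambda>r. (initial (\<psi> s) (t - 1 - r) - initial (\<psi> s) (t - 1 - s)) /\<^sub>R (r - s)) \<longlongrightarrow> - profile (orbit s X) (t - 1 - s)) ?F"
  proof -
    have "((\<lambda>r. initial (snd (state A1 (orbit s X))) ((t - 1) + (-1) * r)) has_vector_derivative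
        (-1) *\<^sub>R profile (orbit s X) ((t - 1) + (-1) * s)) ?F"
      by (rule initial_state_shifted_derivative[OF _ s]) (use t in auto)
    then show ?thesis unfolding has_vector_derivative_iff_quotient by (simp add: \<psi>)
  qed
  ultimately have "((\<lambda>r. initial ((\<psi> r - \<psi> s) /\<^sub>R (r - s) - \<eta>) (t - 1 - r) + initial \<eta> (t - 1 - r)
      + (initial (\<psi> s) (t - 1 - r) - initial (\<psi> s) (t - 1 - s)) /\<^sub>R (r - s))
      \<longlongrightarrow> 0 + initial \<eta> (t - 1 - s) + - profile (orbit s X) (t - 1 - s)) ?F"
    by (intro tendsto_add)
  moreover have "0 + initial \<eta> (t - 1 - s) + - profile (orbit s X) (t - 1 - s) = - fst (orbit s X)"
    by (simp add: profile_def \<eta>_def)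
  moreover have "initial ((\<psi> r - \<psi> s) /\<^sub>R (r - s) - \<eta>) (t - 1 - r) + initial \<eta> (t - 1 - r)
      + (initial (\<psi> s) (t - 1 - r) - initial (\<psi> s) (t - 1 - s)) /\<^sub>R (r - s)
      = (initial (\<psi> r) (t - 1 - r) - initial (\<psi> s) (t - 1 - s)) /\<^sub>R (r - s)" for r
    by (simp add: initial_diff initial_scaleR scaleR_diff_right)
  ultimately show ?thesis unfolding has_vector_derivative_iff_quotient by (simp add: \<psi>_def)
qed

lemma continuous_on_fst_orbit: "continuous_on {0..} (\<lambda>r. fst (orbit r X))"
  by (intro continuous_intros continuous_on_orbit)

lemma integral_fst_orbit:
  assumes t: "t \<in> {0..1}"
  shows "integral {0..t} (\<lambda>r. fst (orbit r X)) = initial (snd (state A1 X)) (t - 1)"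
proof -
  \<comment> \<open>At s = t the moving point has arrived at -1, where the primitive
    vanishes.\<close>
  have "((\<lambda>s. - fst (orbit s X)) has_integral
      initial (snd (S t (state A1 X))) (t - 1 - t) - initial (snd (S 0 (state A1 X))) (t - 1 - 0)) {0..t}"
    by (rule fundamental_theorem_of_calculus) (use t transport_derivative[OF t] in auto)
  then have "((\<lambda>s. fst (orbit s X)) has_integral initial (snd (state A1 X)) (t - 1)) {0..t}"
    using has_integral_neg[of "\<lambda>s. - fst (orbit s X)"] by (force simp: S_0)
  then show ?thesis by (rule integral_unique)
qed

text \<open>During the first unit of time z(t - 1) is the initial function. The integrated identity
  is differentiated, both integrands being continuous.\<close>

lemma fst_orbit:
  assumes t: "t \<in> {0..1}"
  shows "fst (orbit t X) = profile X (t - 1)"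
proof (rule vector_derivative_unique_within_closed_interval[of 0 1 t, unfolded box_real])
  have c: "continuous_on {0..1} (\<lambda>r. fst (orbit r X))"
    by (rule continuous_on_subset[OF continuous_on_fst_orbit]) auto
  show "((\<lambda>t. integral {0..t} (\<lambda>r. fst (orbit r X))) has_vector_derivative fst (orbit t X)) (at t within {0..1})"
    by (rule integral_has_vector_derivative[OF c t])
  show "((\<lambda>t. integral {0..t} (\<lambda>r. fst (orbit r X))) has_vector_derivative profile X (t - 1)) (at t within {0..1})"
  proof (rule has_vector_derivative_transform[OF t integral_fst_orbit])
    show "((\<lambda>t. initial (snd (state A1 X)) (t - 1)) has_vector_derivative profile X (t - 1)) (at t within {0..1})"
      using initial_state_shifted_derivative[of "{0..1}" "-1" 1 t A1 X] t by (simp add: algebra_simps)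
  qed
qed (use t in auto)

text \<open>The first coordinate of the orbit at time s is z(s - 1), hence the offset 1 in z(r +
  \<theta>).\<close>

lemma profile_orbit:
  assumes "r \<ge> 0" "\<theta> \<in> {-1..0}"
  shows "profile (orbit r X) \<theta> = fst (orbit (r + \<theta> + 1) X)"
  using fst_orbit[of "\<theta> + 1" "orbit r X"] orbit_add[of "\<theta> + 1" r X] assms by (simp add: add_ac)

lemma continuous_on_sq_fst_orbit: "a \<ge> 0 \<Longrightarrow> continuous_on {a..b} (\<lambda>r. (norm (fst (orbit r X)))\<^sup>2)"
  by (intro continuous_intros continuous_on_subset[OF continuous_on_fst_orbit]) auto

lemma norm_snd_orbit:
  assumes r: "r \<ge> 0"
  shows "(norm (snd (S r (state A1 X))))\<^sup>2 = integral {r..r + 1} (\<lambda>s. (norm (fst (orbit s X)))\<^sup>2)"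
proof -
  have "(norm (snd (S r (state A1 X))))\<^sup>2 = integral {-1..0} (\<lambda>\<theta>. (norm (profile (orbit r X) \<theta>))\<^sup>2)"
    using r by (simp add: E_orbit[symmetric] norm_snd_state)
  also have "\<dots> = integral {-1..0} ((\<lambda>s. (norm (fst (orbit s X)))\<^sup>2) \<circ> (+) (r + 1))"
    by (intro integral_cong) (use r in \<open>auto simp: profile_orbit add_ac\<close>)
  also have "\<dots> = integral {r..r + 1} (\<lambda>s. (norm (fst (orbit s X)))\<^sup>2)"
    by (subst integral_shift_Icc_real) (simp add: add_ac)
  finally show ?thesis .
qed

lemma integrable_sq_fst_orbit: "a \<ge> 0 \<Longrightarrow> (\<lambda>r. (norm (fst (orbit r X)))\<^sup>2) integrable_on {a..b}"
  by (intro integrable_continuous_real continuous_on_sq_fst_orbit)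

text \<open>Over a unit window the integral of |z(s - 1)|^2 is exactly the squared norm of an L2
  component of the orbit, and n windows cover [0, T].\<close>

lemma admissible: "\<exists>K. \<forall>X. integral {0..T} (\<lambda>s. (norm (fst (orbit s X)))\<^sup>2) \<le> K * (norm (state A1 X))\<^sup>2"
proof -
  obtain n :: nat where n: "T \<le> real n" using real_arch_simple by blast
  obtain M where M: "\<And>t x. t \<in> {0..real n} \<Longrightarrow> norm (S t x) \<le> M * norm x"
    using C0_semigroup_locally_bounded[OF C0] by blast
  have step: "integral {0..real m} (\<lambda>s. (norm (fst (orbit s X)))\<^sup>2) \<le> real m * (M * norm (state A1 X))\<^sup>2" if "m \<le> n" for m X
    using that
  proof (induction m)
    case (Suc m)
    have "integral {0..real (Suc m)} (\<lambda>s. (norm (fst (orbit s X)))\<^sup>2) =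
        integral {0..real m} (\<lambda>s. (norm (fst (orbit s X)))\<^sup>2) + (norm (snd (S (real m) (state A1 X))))\<^sup>2"
      using Henstock_Kurzweil_Integration.integral_combine[of 0 "real m" "real m + 1" "\<lambda>s. (norm (fst (orbit s X)))\<^sup>2"]
      by (simp add: integrable_sq_fst_orbit norm_snd_orbit add.commute)
    also have "(norm (snd (S (real m) (state A1 X))))\<^sup>2 \<le> (M * norm (state A1 X))\<^sup>2"
    proof (rule power_mono)
      have "norm (snd (S (real m) (state A1 X))) \<le> norm (S (real m) (state A1 X))"
        using norm_snd_le[of "snd (S (real m) (state A1 X))" "fst (S (real m) (state A1 X))"] by simp
      also have "\<dots> \<le> M * norm (state A1 X)" using M[of "real m"] Suc.prems by simp
      finally show "norm (snd (S (real m) (state A1 X))) \<le> M * norm (state A1 X)" .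
    qed simp
    finally show ?case using Suc by (simp add: algebra_simps)
  qed simp
  have "integral {0..T} (\<lambda>s. (norm (fst (orbit s X)))\<^sup>2) \<le> (real n * M\<^sup>2) * (norm (state A1 X))\<^sup>2" for X
  proof -
    have "integral {0..T} (\<lambda>s. (norm (fst (orbit s X)))\<^sup>2) \<le> integral {0..real n} (\<lambda>s. (norm (fst (orbit s X)))\<^sup>2)"
      by (rule integral_subset_le) (use n in \<open>auto simp: integrable_sq_fst_orbit\<close>)
    with step[of n X] show ?thesis by (simp add: power_mult_distrib mult.assoc)
  qed
  then show ?thesis by blast
qed

text \<open>The quantity v - \<integral> k \<psi> has derivative A0 z(s - 1). Integrating it from t
  to 1 and inserting v(t) = z(t) - A1 z(t - 1) expresses A1 z(t - 1) by the state at time 1, by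
  z(t), by later values of z and by a moment of the current state: the equation read
  backwards.\<close>

lemma momentum:
  assumes t: "t \<in> {0..1}"
  shows "A1 *v fst (orbit t X) = fst (orbit (t + 1) X) - (fst (S 1 (state A1 X)) - moment k (bor (snd (S 1 (state A1 X)))))
      + A0 *v integral {t..1} (\<lambda>r. fst (orbit r X)) - moment k (bor (snd (S t (state A1 X))))"
proof -
  define w where "w s = fst (S s (state A1 X)) - moment k (bor (snd (S s (state A1 X))))" for s
  have bl: "bounded_linear (\<lambda>x :: 'n M2. fst x - moment k (bor (snd x)))"
    by (intro bounded_linear_sub bounded_linear_fst bounded_linear_compose[OF bounded_linear_moment[OF kernel] bounded_linear_snd])
  have "(w has_vector_derivative A0 *v fst (orbit s X)) (at s within {t..1})" if "s \<in> {t..1}" for s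
  proof -
    have "((\<lambda>r. S r (state A1 X)) has_vector_derivative velocity A0 k (orbit s X)) (at s within {t..1})"
      by (rule has_vector_derivative_within_subset[OF orbit_derivative]) (use that t in auto)
    from bounded_linear.has_vector_derivative[OF bl this] show ?thesis
      by (simp add: w_def[abs_def] velocity_def)
  qed
  then have "((\<lambda>s. A0 *v fst (orbit s X)) has_integral (w 1 - w t)) {t..1}"
    by (intro fundamental_theorem_of_calculus) (use t in auto)
  moreover have "((\<lambda>s. A0 *v fst (orbit s X)) has_integral A0 *v integral {t..1} (\<lambda>r. fst (orbit r X))) {t..1}"
    using has_integral_linear[OF integrable_integral[OF integrable_continuous_real] mv.bounded_linear_right, of t 1 "\<lambda>r. fst (orbit r X)" A0]
      continuous_on_subset[OF continuous_on_fst_orbit, of "{t..1}" X] t by (auto simp: o_def)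
  ultimately have w: "w 1 - w t = A0 *v integral {t..1} (\<lambda>r. fst (orbit r X))" by (rule has_integral_unique)
  have "fst (S t (state A1 X)) = fst (orbit (t + 1) X) - A1 *v fst (orbit t X)"
    using t profile_orbit[of t 0 X] by (simp add: E_orbit[symmetric] fst_state)
  then show ?thesis using w by (simp add: w_def algebra_simps)
qed

end

subsection \<open>Backward estimate for invertible \<open>A\<^sub>-\<^sub>1\<close>\<close>

context neutral_semigroup
begin

text \<open>Cauchy-Schwarz on an interval of length at most 1, by integrating the square of
  \<open>z r - J\<close>.\<close>

lemma norm_integral_fst_orbit:
  assumes t: "t \<in> {0..1}"
  shows "(norm (integral {t..1} (\<lambda>r. fst (orbit r X))))\<^sup>2 \<le> integral {t..1} (\<lambda>r. (norm (fst (orbit r X)))\<^sup>2)"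
proof -
  define z where "z r = norm (fst (orbit r X))" for r
  define J where "J = integral {t..1} z"
  have cZ: "continuous_on {t..1} (\<lambda>r. fst (orbit r X))"
    by (rule continuous_on_subset[OF continuous_on_fst_orbit]) (use t in auto)
  then have cz: "continuous_on {t..1} z" unfolding z_def by (rule continuous_on_norm)
  have hz: "(z has_integral J) {t..1}" unfolding J_def by (intro integrable_integral integrable_continuous_real cz)
  have hz2: "((\<lambda>r. (z r)\<^sup>2) has_integral integral {t..1} (\<lambda>r. (z r)\<^sup>2)) {t..1}"
    by (intro integrable_integral integrable_continuous_real continuous_intros cz)
  have "((\<lambda>r. (z r)\<^sup>2 - 2 * J * z r + J\<^sup>2) has_integral integral {t..1} (\<lambda>r. (z r)\<^sup>2) - 2 * J * J + (1 - t) * J\<^sup>2) {t..1}"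
    using has_integral_const_real[of "J\<^sup>2" t 1] t
    by (intro has_integral_add has_integral_diff has_integral_mult_right hz hz2) auto
  then have "0 \<le> integral {t..1} (\<lambda>r. (z r)\<^sup>2) - 2 * J * J + (1 - t) * J\<^sup>2"
  proof (rule has_integral_nonneg)
    fix r
    have "0 \<le> (z r - J)\<^sup>2" by simp
    then show "0 \<le> (z r)\<^sup>2 - 2 * J * z r + J\<^sup>2" by (simp add: power2_diff algebra_simps)
  qed
  moreover have "(1 - t) * J\<^sup>2 \<le> 1 * J\<^sup>2" by (rule mult_right_mono) (use t in auto)
  ultimately have "J\<^sup>2 \<le> integral {t..1} (\<lambda>r. (z r)\<^sup>2)" by (simp add: power2_eq_square)
  moreover have "norm (integral {t..1} (\<lambda>r. fst (orbit r X))) \<le> J"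
    unfolding J_def
    by (rule integral_norm_bound_integral[OF integrable_continuous_real[OF cZ] integrable_continuous_real[OF cz]])
      (simp add: z_def)
  ultimately show ?thesis unfolding z_def by (meson norm_ge_zero order_trans power_mono)
qed

lemma norm_moment_le: "norm (moment k (bor \<psi>)) \<le> nrm2 k * norm \<psi>"
  using integrable_bilinear_delay(2)[OF kernel delay_fun_bor, of \<psi>] by (simp add: moment_def)

lemma norm_momentum_le: "norm (fst x - moment k (bor (snd x))) \<le> (1 + nrm2 k) * norm x"
proof -
  have "norm (fst x) \<le> norm x" "norm (snd x) \<le> norm x"
    using norm_fst_le[of "fst x" "snd x"] norm_snd_le[of "snd x" "fst x"] by simp_all
  then have "norm (fst x - moment k (bor (snd x))) \<le> norm x + nrm2 k * norm x"
    by (intro order_trans[OF norm_triangle_ineq4] add_mono order_trans[OF norm_moment_le] mult_left_mono) auto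
  then show ?thesis by (simp add: distrib_right)
qed

text \<open>The window [t, t + 1] is split at 1; its second part lies in [1, 2], the window of the
  state at time 1.\<close>

lemma norm_snd_orbit_le:
  assumes t: "t \<in> {0..1}"
  shows "(norm (snd (S t (state A1 X))))\<^sup>2 \<le> integral {t..1} (\<lambda>r. (norm (fst (orbit r X)))\<^sup>2) + (norm (snd (S 1 (state A1 X))))\<^sup>2"
proof -
  have "(norm (snd (S t (state A1 X))))\<^sup>2 = integral {t..1} (\<lambda>r. (norm (fst (orbit r X)))\<^sup>2) + integral {1..t + 1} (\<lambda>r. (norm (fst (orbit r X)))\<^sup>2)"
    using Henstock_Kurzweil_Integration.integral_combine[of t 1 "t + 1" "\<lambda>r. (norm (fst (orbit r X)))\<^sup>2"] t
    by (simp add: norm_snd_orbit integrable_sq_fst_orbit)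
  moreover have "integral {1..t + 1} (\<lambda>r. (norm (fst (orbit r X)))\<^sup>2) \<le> integral {1..1 + 1} (\<lambda>r. (norm (fst (orbit r X)))\<^sup>2)"
    by (rule integral_subset_le) (use t integrable_sq_fst_orbit[of 1 X] in auto)
  ultimately show ?thesis by (simp add: norm_snd_orbit)
qed

text \<open>Inverting \<open>A1\<close> in the momentum identity bounds z(t - 1) by z(t), the state
  at time 1 and the integral \<mu> over later times. The factor 4 comes from squaring a sum of four
  terms.\<close>

lemma norm_fst_orbit_le:
  fixes X
  assumes B: "B ** A1 = mat 1" and t: "t \<in> {0..1}"
  defines "n1 \<equiv> norm (S 1 (state A1 X))" and "\<mu> \<equiv> integral {t..1} (\<lambda>r. (norm (fst (orbit r X)))\<^sup>2)"
  shows "(norm (fst (orbit t X)))\<^sup>2 \<le> 4 * (norm B)\<^sup>2 * ((norm (fst (orbit (t + 1) X)))\<^sup>2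
    + ((1 + nrm2 k)\<^sup>2 + (nrm2 k)\<^sup>2) * n1\<^sup>2 + ((norm A0)\<^sup>2 + (nrm2 k)\<^sup>2) * \<mu>)"
proof -
  define w where "w = fst (S 1 (state A1 X)) - moment k (bor (snd (S 1 (state A1 X))))"
  define I where "I = integral {t..1} (\<lambda>r. fst (orbit r X))"
  define \<psi> where "\<psi> = snd (S t (state A1 X))"
  have n1: "norm (snd (S 1 (state A1 X))) \<le> n1"
    using norm_snd_le[of "snd (S 1 (state A1 X))" "fst (S 1 (state A1 X))"] by (simp add: n1_def)
  have w: "norm w \<le> (1 + nrm2 k) * n1" unfolding w_def n1_def by (rule norm_momentum_le)
  have \<psi>: "(norm \<psi>)\<^sup>2 \<le> \<mu> + n1\<^sup>2"
    using norm_snd_orbit_le[OF t, of X] power_mono[OF n1, of 2] by (simp add: \<psi>_def \<mu>_def)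
  have I: "(norm I)\<^sup>2 \<le> \<mu>" unfolding I_def \<mu>_def by (rule norm_integral_fst_orbit[OF t])
  have "B *v (A1 *v fst (orbit t X)) = fst (orbit t X)" by (simp add: matrix_vector_mul_assoc B)
  then have "norm (fst (orbit t X)) \<le> norm B * norm (A1 *v fst (orbit t X))"
    using norm_matrix_vector_le[of B "A1 *v fst (orbit t X)"] by simp
  also have "A1 *v fst (orbit t X) = fst (orbit (t + 1) X) - w + A0 *v I - moment k (bor \<psi>)"
    unfolding w_def I_def \<psi>_def by (rule momentum[OF t])
  finally have "(norm (fst (orbit t X)))\<^sup>2 \<le> (norm B)\<^sup>2 * (norm (fst (orbit (t + 1) X) - w + A0 *v I - moment k (bor \<psi>)))\<^sup>2"
    by (metis norm_ge_zero power_mono power_mult_distrib)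
  also have "\<dots> \<le> (norm B)\<^sup>2 * (4 * ((norm (fst (orbit (t + 1) X)))\<^sup>2 + (norm w)\<^sup>2 + (norm (A0 *v I))\<^sup>2 + (norm (moment k (bor \<psi>)))\<^sup>2))"
  proof (rule mult_left_mono)
    have sq4: "(p + q + r + s)\<^sup>2 \<le> 4 * (p\<^sup>2 + q\<^sup>2 + r\<^sup>2 + s\<^sup>2)" for p q r s :: real
    proof -
      have "0 \<le> (p - q)\<^sup>2 + (p - r)\<^sup>2 + (p - s)\<^sup>2 + (q - r)\<^sup>2 + (q - s)\<^sup>2 + (r - s)\<^sup>2" by simp
      then show ?thesis by (simp add: power2_eq_square algebra_simps)
    qed
    let ?a = "fst (orbit (t + 1) X)" and ?c = "A0 *v I" and ?d = "moment k (bor \<psi>)"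
    have "norm (?a - w + ?c - ?d) \<le> norm ?a + norm w + norm ?c + norm ?d"
      using norm_triangle_ineq4[of "?a - w + ?c" ?d] norm_triangle_ineq[of "?a - w" ?c] norm_triangle_ineq4[of ?a w]
      by linarith
    from power_mono[OF this norm_ge_zero, of 2] sq4[of "norm ?a" "norm w" "norm ?c" "norm ?d"]
    show "(norm (?a - w + ?c - ?d))\<^sup>2 \<le> 4 * ((norm ?a)\<^sup>2 + (norm w)\<^sup>2 + (norm ?c)\<^sup>2 + (norm ?d)\<^sup>2)" by (rule order_trans)
  qed simp
  also have "\<dots> \<le> (norm B)\<^sup>2 * (4 * ((norm (fst (orbit (t + 1) X)))\<^sup>2 + (1 + nrm2 k)\<^sup>2 * n1\<^sup>2
      + (norm A0)\<^sup>2 * \<mu> + (nrm2 k)\<^sup>2 * (\<mu> + n1\<^sup>2)))"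
  proof (intro mult_left_mono add_mono order_refl)
    show "(norm w)\<^sup>2 \<le> (1 + nrm2 k)\<^sup>2 * n1\<^sup>2"
      using power_mono[OF w norm_ge_zero, of 2] by (simp add: power_mult_distrib)
    have "(norm (A0 *v I))\<^sup>2 \<le> (norm A0)\<^sup>2 * (norm I)\<^sup>2"
      using power_mono[OF norm_matrix_vector_le norm_ge_zero, of A0 I 2] by (simp add: power_mult_distrib)
    also have "\<dots> \<le> (norm A0)\<^sup>2 * \<mu>" by (intro mult_left_mono I) simp
    finally show "(norm (A0 *v I))\<^sup>2 \<le> (norm A0)\<^sup>2 * \<mu>" .
    have "(norm (moment k (bor \<psi>)))\<^sup>2 \<le> (nrm2 k)\<^sup>2 * (norm \<psi>)\<^sup>2"
      using power_mono[OF norm_moment_le norm_ge_zero, of \<psi> 2] by (simp add: power_mult_distrib)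
    also have "\<dots> \<le> (nrm2 k)\<^sup>2 * (\<mu> + n1\<^sup>2)" by (intro mult_left_mono \<psi>) simp
    finally show "(norm (moment k (bor \<psi>)))\<^sup>2 \<le> (nrm2 k)\<^sup>2 * (\<mu> + n1\<^sup>2)" .
  qed auto
  finally show ?thesis by (simp add: algebra_simps)
qed

text \<open>A Gronwall argument for \<open>\<mu>(t) = \<integral>\<^sub>t\<^sup>1 \<parallel>z(s - 1)\<parallel>\<^sup>2 ds\<close>, run backwards from \<open>\<mu>(1) = 0\<close>.\<close>

lemma norm_snd_state_le:
  assumes B: "B ** A1 = mat 1"
  shows "\<exists>K\<ge>0. \<forall>X. norm (snd (state A1 X)) \<le> K * norm (S 1 (state A1 X))"
proof -
  define \<alpha> where "\<alpha> = 4 * (norm B)\<^sup>2"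
  define \<beta> where "\<beta> = 4 * (norm B)\<^sup>2 * ((1 + nrm2 k)\<^sup>2 + (nrm2 k)\<^sup>2)"
  define \<gamma> where "\<gamma> = 4 * (norm B)\<^sup>2 * ((norm A0)\<^sup>2 + (nrm2 k)\<^sup>2)"
  have pos: "\<alpha> \<ge> 0" "\<beta> \<ge> 0" "\<gamma> \<ge> 0" by (auto simp: \<alpha>_def \<beta>_def \<gamma>_def)
  have "(norm (snd (state A1 X)))\<^sup>2 \<le> exp \<gamma> * (\<alpha> + \<beta>) * (norm (S 1 (state A1 X)))\<^sup>2" for X
  proof -
    define n1 where "n1 = norm (S 1 (state A1 X))"
    define z where "z r = (norm (fst (orbit r X)))\<^sup>2" for r
    define \<mu> where "\<mu> t = integral {0..1} z - integral {0..t} z" for t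
    have cz: "continuous_on {0..1} z" unfolding z_def by (rule continuous_on_sq_fst_orbit) simp
    have \<mu>: "\<mu> t = integral {t..1} z" if "t \<in> {0..1}" for t
      using Henstock_Kurzweil_Integration.integral_combine[of 0 t 1 z] that integrable_continuous_real[OF cz]
      by (simp add: \<mu>_def algebra_simps)
    have key: "z t \<le> \<alpha> * z (t + 1) + \<beta> * n1\<^sup>2 + \<gamma> * \<mu> t" if "t \<in> {0..1}" for t
    proof -
      have dist: "\<alpha> * (a + p * b + q * c) = \<alpha> * a + (\<alpha> * p) * b + (\<alpha> * q) * c" for a b c p q
        by (simp add: distrib_left)
      have "z t \<le> \<alpha> * (z (t + 1) + ((1 + nrm2 k)\<^sup>2 + (nrm2 k)\<^sup>2) * n1\<^sup>2
          + ((norm A0)\<^sup>2 + (nrm2 k)\<^sup>2) * integral {t..1} z)"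
        unfolding z_def[abs_def] n1_def \<alpha>_def by (rule norm_fst_orbit_le[OF B that])
      also have "\<dots> = \<alpha> * z (t + 1) + \<beta> * n1\<^sup>2 + \<gamma> * integral {t..1} z"
        unfolding \<beta>_def \<gamma>_def \<alpha>_def[symmetric] by (rule dist)
      finally show ?thesis unfolding \<mu>[OF that] .
    qed
    \<comment> \<open>The integrating factor absorbs the \<gamma> \<mu> term of \<open>key\<close>,
      which leaves a lower bound for the derivative of \<open>F\<close> free of \<mu>. Since
      \<open>F 1 = 0\<close>, integrating it bounds F 0 = \<mu> 0, the squared norm wanted.\<close>
    define F where "F t = exp (\<gamma> * t) * \<mu> t" for t
    have "(F has_vector_derivative exp (\<gamma> * t) * (\<gamma> * \<mu> t - z t)) (at t within {0..1})" if "t \<in> {0..1}" for t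
    proof -
      have "((\<lambda>t. integral {0..t} z) has_vector_derivative z t) (at t within {0..1})"
        by (rule integral_has_vector_derivative[OF cz that])
      then have "((\<lambda>t. integral {0..t} z) has_field_derivative z t) (at t within {0..1})"
        by (simp add: has_real_derivative_iff_has_vector_derivative)
      then have "(F has_field_derivative exp (\<gamma> * t) * (\<gamma> * \<mu> t - z t)) (at t within {0..1})"
        unfolding F_def[abs_def] \<mu>_def[abs_def]
        by (auto intro!: derivative_eq_intros simp: algebra_simps)
      then show ?thesis by (simp add: has_real_derivative_iff_has_vector_derivative)
    qed
    then have upper: "((\<lambda>t. exp (\<gamma> * t) * (\<gamma> * \<mu> t - z t)) has_integral F 1 - F 0) {0..1}"
      by (intro fundamental_theorem_of_calculus) auto
    have lower: "((\<lambda>t. - exp \<gamma> * (\<alpha> * z (t + 1) + \<beta> * n1\<^sup>2)) has_integral - exp \<gamma> * (\<alpha> * integral {1..2} z + \<beta> * n1\<^sup>2)) {0..1}"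
    proof -
      have "(z has_integral integral {1..2} z) {0+1..1+1}"
        unfolding z_def by simp (intro integrable_integral integrable_sq_fst_orbit, simp)
      then have "(z \<circ> (+) 1 has_integral integral {1..2} z) {0..1}" by (simp only: has_integral_shift_Icc_real)
      then have "((\<lambda>t. z (t + 1)) has_integral integral {1..2} z) {0..1}" by (simp add: o_def add.commute)
      moreover have "((\<lambda>t. \<beta> * n1\<^sup>2) has_integral \<beta> * n1\<^sup>2) {0..1::real}"
        using has_integral_const_real[of "\<beta> * n1\<^sup>2" 0 1] by simp
      ultimately show ?thesis by (rule has_integral_mult_right[OF has_integral_add[OF has_integral_mult_right]])
    qed
    have "- exp \<gamma> * (\<alpha> * z (t + 1) + \<beta> * n1\<^sup>2) \<le> exp (\<gamma> * t) * (\<gamma> * \<mu> t - z t)" if t: "t \<in> {0..1}" for t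
    proof -
      define Q where "Q = \<alpha> * z (t + 1) + \<beta> * n1\<^sup>2"
      have "exp (\<gamma> * t) \<le> exp \<gamma>" using t pos by (simp add: mult_left_le)
      moreover have "0 \<le> Q" using pos by (simp add: z_def Q_def)
      ultimately have "exp (\<gamma> * t) * Q \<le> exp \<gamma> * Q" by (rule mult_right_mono)
      moreover have "exp (\<gamma> * t) * (- Q) \<le> exp (\<gamma> * t) * (\<gamma> * \<mu> t - z t)"
        by (rule mult_left_mono) (use key[OF t] in \<open>unfold Q_def, linarith\<close>, simp)
      ultimately show ?thesis unfolding Q_def[symmetric] mult_minus_left mult_minus_right by linarith
    qed
    then have "- exp \<gamma> * (\<alpha> * integral {1..2} z + \<beta> * n1\<^sup>2) \<le> F 1 - F 0"
      by (rule has_integral_le[OF lower upper])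
    moreover have "F 1 = 0" by (simp add: F_def \<mu>_def)
    moreover have "F 0 = (norm (snd (state A1 X)))\<^sup>2"
      using norm_snd_orbit[of 0 X] by (simp add: F_def \<mu>_def z_def[abs_def] S_0)
    moreover have "integral {1..2} z \<le> n1\<^sup>2"
    proof -
      have "integral {1..2} z = (norm (snd (S 1 (state A1 X))))\<^sup>2"
        using norm_snd_orbit[of 1 X] by (simp add: z_def[abs_def])
      also have "\<dots> \<le> n1\<^sup>2"
        using norm_snd_le[of "snd (S 1 (state A1 X))" "fst (S 1 (state A1 X))"] by (simp add: n1_def)
      finally show ?thesis .
    qed
    ultimately have "(norm (snd (state A1 X)))\<^sup>2 \<le> exp \<gamma> * (\<alpha> * integral {1..2} z + \<beta> * n1\<^sup>2)"
      and z12: "integral {1..2} z \<le> n1\<^sup>2"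
      by simp_all
    note this(1)
    also have "exp \<gamma> * (\<alpha> * integral {1..2} z + \<beta> * n1\<^sup>2) \<le> exp \<gamma> * (\<alpha> * n1\<^sup>2 + \<beta> * n1\<^sup>2)"
      by (intro mult_left_mono add_mono z12 pos order_refl) simp
    finally show ?thesis by (simp add: n1_def distrib_right mult.assoc)
  qed
  from real_sqrt_le_mono[OF this]
  have "norm (snd (state A1 X)) \<le> sqrt (exp \<gamma> * (\<alpha> + \<beta>)) * norm (S 1 (state A1 X))" for X
    by (simp only: real_sqrt_mult real_sqrt_abs abs_norm_cancel)
  then show ?thesis using pos by (intro exI[of _ "sqrt (exp \<gamma> * (\<alpha> + \<beta>))"]) auto
qed

text \<open>On the domain the L2 component is bounded by the Gronwall estimate, after which the
  momentum identity at t = 0 bounds the first component. The inequality is closed, so density of the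
  domain suffices.\<close>

lemma S_1_bounded_below:
  assumes "det A1 \<noteq> 0"
  shows "\<exists>K. \<forall>x. norm x \<le> K * norm (S 1 x)"
proof -
  obtain B where B: "B ** A1 = mat 1"
    using assms invertible_det_nz[of A1] by (auto simp: invertible_def)
  obtain K where K: "K \<ge> 0" "\<And>X. norm (snd (state A1 X)) \<le> K * norm (S 1 (state A1 X))"
    using norm_snd_state_le[OF B] by blast
  define L where "L = 1 + nrm2 k + norm A0 * K + nrm2 k * K + K"
  have dom: "norm x \<le> L * norm (S 1 x)" if dom: "x \<in> range (state A1)" for x
  proof -
    obtain X where x: "x = state A1 X" using dom by blast
    define n1 where "n1 = norm (S 1 (state A1 X))"
    define w where "w = fst (S 1 (state A1 X)) - moment k (bor (snd (S 1 (state A1 X))))"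
    define I where "I = integral {0..1} (\<lambda>r. fst (orbit r X))"
    have "A1 *v fst (orbit 0 X) = profile X 0 - w + A0 *v I - moment k (bor (snd (state A1 X)))"
      using momentum[of 0 X] fst_orbit[of 1 X] by (simp add: w_def I_def S_0)
    then have fs: "fst x = w - A0 *v I + moment k (bor (snd x))"
      by (simp add: x fst_state orbit_0)
    have I: "norm I \<le> norm (snd x)"
    proof (rule power2_le_imp_le)
      show "(norm I)\<^sup>2 \<le> (norm (snd x))\<^sup>2"
        using norm_integral_fst_orbit[of 0 X] norm_snd_orbit[of 0 X] by (simp add: I_def x S_0)
    qed simp
    have "norm (fst x) \<le> norm w + norm (A0 *v I) + norm (moment k (bor (snd x)))"
      unfolding fs using norm_triangle_ineq[of "w - A0 *v I" "moment k (bor (snd x))"] norm_triangle_ineq4[of w "A0 *v I"]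
      by linarith
    also have "norm w \<le> n1 + nrm2 k * n1"
      using norm_momentum_le[of "S 1 (state A1 X)"] by (simp add: w_def n1_def distrib_right)
    also have "norm (A0 *v I) \<le> norm A0 * (K * n1)"
      using I K(2)[of X] by (intro order_trans[OF norm_matrix_vector_le] mult_left_mono) (auto simp: x n1_def)
    also have "norm (moment k (bor (snd x))) \<le> nrm2 k * (K * n1)"
      using K(2)[of X] by (intro order_trans[OF norm_moment_le] mult_left_mono) (auto simp: x n1_def)
    finally have "norm (fst x) \<le> n1 + nrm2 k * n1 + norm A0 * (K * n1) + nrm2 k * (K * n1)" by simp
    moreover have "norm (snd x) \<le> K * n1" using K(2)[of X] by (simp add: x n1_def)
    moreover have "norm x \<le> norm (fst x) + norm (snd x)" using norm_Pair_le[of "fst x" "snd x"] by simp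
    ultimately show ?thesis unfolding n1_def[folded x] L_def by (simp add: algebra_simps)
  qed
  have "norm x \<le> L * norm (S 1 x)" for x
  proof -
    have "closed {x. norm x \<le> L * norm (S 1 x)}"
      by (intro closed_Collect_le continuous_intros linear_continuous_on[OF S_linear]) simp
    then have "closure (range (state A1)) \<subseteq> {x. norm x \<le> L * norm (S 1 x)}"
      using dom by (intro closure_minimal) auto
    then show ?thesis using generates_dense[OF generates] by auto
  qed
  then show ?thesis by blast
qed

end

subsection \<open>The duality theorem\<close>

lemma sq_integrable_cong:
  assumes "\<And>x. x \<in> space M \<Longrightarrow> f x = g x"
  shows "sq_integrable M f \<longleftrightarrow> sq_integrable M g"
  unfolding sq_integrable_def
  by (intro conj_cong measurable_cong Bochner_Integration.integrable_cong refl) (simp_all add: assms)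

lemma sq_integrable_matrix:
  fixes A :: "'s \<Rightarrow> real ^ 'n ^ 'm"
  assumes A: "\<And>i j. sq_integrable M (\<lambda>x. A x $ i $ j)"
  shows "sq_integrable M A"
proof -
  have m: "(\<lambda>x. A x $ i $ j) \<in> borel_measurable M" for i j using A by (simp add: sq_integrable_def)
  have "A \<in> borel_measurable M"
    by (rule borel_measurable_euclidean_space[THEN iffD2]) (auto simp: Basis_vec_def inner_axis m)
  moreover have "(norm (A x))\<^sup>2 = (\<Sum>i\<in>UNIV. \<Sum>j\<in>UNIV. (norm (A x $ i $ j))\<^sup>2)" for x
    unfolding power2_norm_eq_inner inner_vec_def by simp
  moreover have "integrable M (\<lambda>x. \<Sum>i\<in>UNIV. \<Sum>j\<in>UNIV. (norm (A x $ i $ j))\<^sup>2)"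
    by (intro Bochner_Integration.integrable_sum) (use A in \<open>simp add: sq_integrable_def\<close>)
  ultimately show ?thesis by (simp add: sq_integrable_def)
qed

context dual_semigroups
begin

text \<open>Constant sequences restrict the inequality to the domain. Conversely, the output of an
  approximating state is split into \<open>y\<close> and an error; the factor 2 from squaring this
  sum is paid for by passing to \<delta> / 2.\<close>

lemma exactly_observable_iff_energy:
  assumes r: "r \<ge> 0" and out: "\<And>t X. t \<in> {0..T} \<Longrightarrow> c' (S t (E X)) = c (P.orbit (t + r) X)"
  shows "exactly_observable (range E) c' S T \<longleftrightarrow> (\<exists>\<delta>>0. \<forall>X. energy r X \<ge> \<delta>\<^sup>2 * (norm (E X))\<^sup>2)"
proof
  have sq: "sq_integrable (lebesgue_on {0..T}) (\<lambda>t. c' (S t (E X)))" for X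
    using sq_integrable_output[OF r, of X] by (rule sq_integrable_cong[THEN iffD2, rotated]) (simp add: out)
  have en: "energy r X = (LINT t|lebesgue_on {0..T}. (norm (c' (S t (E X))))\<^sup>2)" for X
    unfolding energy_def set_lint_lebesgue_on
    by (rule Bochner_Integration.integral_cong) (auto simp: out)
  {
    assume "exactly_observable (range E) c' S T"
    then obtain \<delta> where \<delta>: "\<delta> > 0" "\<And>x y. observation (range E) c' S T x y \<Longrightarrow>
        (LINT t:{0..T}|lebesgue. (norm (y t))\<^sup>2) \<ge> \<delta>\<^sup>2 * (norm x)\<^sup>2"
      unfolding exactly_observable_def by blast
    have "observation (range E) c' S T (E X) (\<lambda>t. c' (S t (E X)))" for X
      unfolding observation_def by (intro conjI sq exI[of _ "\<lambda>_. E X"]) (simp_all add: sq set_lebesgue_integral_def)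
    from \<delta>(2)[OF this] have "energy r X \<ge> \<delta>\<^sup>2 * (norm (E X))\<^sup>2" for X
      by (simp add: en set_lint_lebesgue_on)
    with \<delta>(1) show "\<exists>\<delta>>0. \<forall>X. energy r X \<ge> \<delta>\<^sup>2 * (norm (E X))\<^sup>2" by blast
  }
  {
    assume "\<exists>\<delta>>0. \<forall>X. energy r X \<ge> \<delta>\<^sup>2 * (norm (E X))\<^sup>2"
    then obtain \<delta> where \<delta>: "\<delta> > 0" "\<And>X. energy r X \<ge> \<delta>\<^sup>2 * (norm (E X))\<^sup>2" by blast
    have "(\<delta> / 2)\<^sup>2 * (norm x)\<^sup>2 \<le> (LINT t:{0..T}|lebesgue. (norm (y t))\<^sup>2)"
      if obs: "observation (range E) c' S T x y" for x y
    proof -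
      define I where "I = (LINT t|lebesgue_on {0..T}. (norm (y t))\<^sup>2)"
      obtain X where y: "sq_integrable (lebesgue_on {0..T}) y" and X: "\<And>k. X k \<in> range E" "X \<longlonglongrightarrow> x"
        and lim: "(\<lambda>k. LINT t:{0..T}|lebesgue. (norm (c' (S t (X k)) - y t))\<^sup>2) \<longlonglongrightarrow> 0"
        using obs unfolding observation_def by blast
      define d where "d k = (LINT t|lebesgue_on {0..T}. (norm (c' (S t (X k)) - y t))\<^sup>2)" for k
      have d: "d \<longlonglongrightarrow> 0" using lim unfolding d_def[abs_def] set_lint_lebesgue_on .
      have "\<delta>\<^sup>2 * (norm (X k))\<^sup>2 \<le> 2 * I + 2 * d k" for k
      proof -
        obtain Z where Z: "X k = E Z" using X(1) by blast
        have sqd: "sq_integrable (lebesgue_on {0..T}) (\<lambda>t. c' (S t (X k)) - y t)"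
          unfolding Z by (rule sq_integrable_diff[OF sq y])
        have "\<delta>\<^sup>2 * (norm (X k))\<^sup>2 \<le> (LINT t|lebesgue_on {0..T}. (norm (c' (S t (X k))))\<^sup>2)"
          using \<delta>(2)[of Z] by (simp add: en Z)
        also have "\<dots> \<le> (LINT t|lebesgue_on {0..T}. 2 * (norm (y t))\<^sup>2 + 2 * (norm (c' (S t (X k)) - y t))\<^sup>2)"
        proof (rule integral_mono)
          show "integrable (lebesgue_on {0..T}) (\<lambda>t. (norm (c' (S t (X k))))\<^sup>2)"
            using sq[of Z] by (simp add: Z sq_integrable_def)
          show "integrable (lebesgue_on {0..T}) (\<lambda>t. 2 * (norm (y t))\<^sup>2 + 2 * (norm (c' (S t (X k)) - y t))\<^sup>2)"
            using y sqd by (simp add: sq_integrable_def)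
          fix t
          define a where "a = c' (S t (X k)) - y t"
          have "norm (y t + a) \<le> norm (y t) + norm a" by (rule norm_triangle_ineq)
          then have "(norm (y t + a))\<^sup>2 \<le> (norm (y t) + norm a)\<^sup>2" by (rule power_mono) simp
          also have "\<dots> \<le> 2 * (norm (y t))\<^sup>2 + 2 * (norm a)\<^sup>2"
            using sum_squares_bound[of "norm (y t)" "norm a"] by (simp add: power2_sum)
          finally show "(norm (c' (S t (X k))))\<^sup>2 \<le> 2 * (norm (y t))\<^sup>2 + 2 * (norm (c' (S t (X k)) - y t))\<^sup>2"
            by (simp add: a_def)
        qed
        also have "\<dots> = 2 * I + 2 * d k" using y sqd by (simp add: sq_integrable_def I_def d_def)
        finally show ?thesis .
      qed
      moreover have "(\<lambda>k. \<delta>\<^sup>2 * (norm (X k))\<^sup>2) \<longlonglongrightarrow> \<delta>\<^sup>2 * (norm x)\<^sup>2" by (intro tendsto_intros X)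
      moreover have "(\<lambda>k. 2 * I + 2 * d k) \<longlonglongrightarrow> 2 * I + 2 * 0" by (intro tendsto_intros d)
      ultimately have "\<delta>\<^sup>2 * (norm x)\<^sup>2 \<le> 2 * I + 2 * 0" by (intro LIMSEQ_le) auto
      moreover have "I \<ge> 0" by (simp add: I_def)
      ultimately have "(\<delta> / 2)\<^sup>2 * (norm x)\<^sup>2 \<le> I" by (simp add: power_divide)
      then show ?thesis by (simp add: I_def set_lint_lebesgue_on)
    qed
    then show "exactly_observable (range E) c' S T"
      unfolding exactly_observable_def using \<delta>(1) by (intro exI[of _ "\<delta> / 2"]) auto
  }
qed

lemma exactly_controllable_iff:
  "exactly_controllable (range Ed) B Sd T \<longleftrightarrow> {reach u | u. sq_integrable (lebesgue_on {0..T}) u} = range Ed"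
  unfolding exactly_controllable_def reach_def ..

end

text \<open>The coefficients are replaced by Borel versions equal almost everywhere, which leaves
  the operator unchanged on the domain.\<close>

lemma neutral_semigroupI:
  fixes A1 :: "real ^ 'n ^ 'n"
  assumes A2: "delay_fun a2" "AE \<theta> in delay_measure. A2 \<theta> = a2 \<theta>" "A2 \<in> borel_measurable delay_measure"
    and A3: "delay_fun a3" "AE \<theta> in delay_measure. A3 \<theta> = a3 \<theta>" "A3 \<in> borel_measurable delay_measure"
    and gen: "generates (neutral_dom A1) (neutral_op A2 A3) S"
  shows "neutral_semigroup A1 (LINT \<theta>|lborel. a3 \<theta>) (reduced_kernel a2 a3) (neutral_op A2 A3) S"
proof (intro neutral_semigroup.intro parametrised_semigroup.intro neutral_semigroup_axioms.intro)
  show k: "delay_fun (reduced_kernel a2 a3)" by (rule delay_fun_reduced_kernel[OF A2(1) A3(1)])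
  show "bounded_linear (state A1)" by (rule bounded_linear_state)
  show "bounded_linear (velocity (LINT \<theta>|lborel. a3 \<theta>) (reduced_kernel a2 a3))" by (rule bounded_linear_velocity[OF k])
  show "\<exists>K. \<forall>X. norm X \<le> K * (norm (state A1 X) + norm (velocity (LINT \<theta>|lborel. a3 \<theta>) (reduced_kernel a2 a3) X))"
    by (rule graph_norm_state)
  show "generates (range (state A1)) (neutral_op A2 A3) S" unfolding range_state by (rule gen)
  show "neutral_op A2 A3 (state A1 X) = velocity (LINT \<theta>|lborel. a3 \<theta>) (reduced_kernel a2 a3) X" for X
    by (rule neutral_op_state[OF A2(1) A3(1) A2(2) A3(2) A2(3) A3(3)])
qed

text \<open>The L2 component of the input is 0, so only the inner product with c = \<phi>(-1)
  survives.\<close>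

lemma pairing_input:
  assumes k: "delay_fun k"
  shows "pairing k (transpose C *v u, 0) X = u \<bullet> (C *v fst X)"
proof -
  have "pairing k (transpose C *v u, 0) X = (transpose C *v u) \<bullet> fst X"
    by (simp only: pairing_def fst_conv snd_conv linear_0[OF bounded_linear.linear[OF bounded_linear_moment[OF k]]]
        bounded_bilinear.zero_left[OF bounded_bilinear_conv] bounded_bilinear.zero_left[OF bounded_bilinear_hankel[OF k]]) simp
  then show ?thesis by (metis inner_matrix_vector inner_commute)
qed

theorem theorem3p3:
  fixes A1 :: "real ^ 'n ^ 'n" and C :: "real ^ 'n ^ 'p"
    and A2 A3 :: "real \<Rightarrow> real ^ 'n ^ 'n"
    and T :: real
    and S Sd :: "real \<Rightarrow> 'n M2 \<Rightarrow> 'n M2"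
  assumes "\<And>i j. sq_integrable (lebesgue_on {-1..0}) (\<lambda>\<theta>. A2 \<theta> $ i $ j)"
    and "\<And>i j. sq_integrable (lebesgue_on {-1..0}) (\<lambda>\<theta>. A3 \<theta> $ i $ j)"
    and "T > 0"
    and "generates (neutral_dom A1) (neutral_op A2 A3) S"
    and "generates (neutral_dom (transpose A1))
           (neutral_op (\<lambda>\<theta>. transpose (A2 \<theta>)) (\<lambda>\<theta>. transpose (A3 \<theta>))) Sd"
  shows "(exactly_observable (neutral_dom A1) (output_at C (-1)) S T \<longleftrightarrow>
            exactly_controllable (neutral_dom (transpose A1)) (\<lambda>u. (transpose C *v u, 0)) Sd T) \<and>
         (det A1 \<noteq> 0 \<longrightarrow>
           (exactly_observable (neutral_dom A1) (output_at C 0) S T \<longleftrightarrow>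
            exactly_controllable (neutral_dom (transpose A1)) (\<lambda>u. (transpose C *v u, 0)) Sd T))"
proof -
  have sq: "sq_integrable delay_measure A2" "sq_integrable delay_measure A3"
    by (intro sq_integrable_matrix assms)+
  obtain a2 where a2: "delay_fun a2" "AE \<theta> in delay_measure. A2 \<theta> = a2 \<theta>"
    by (rule sq_integrable_AE_delay_fun[OF sq(1)])
  obtain a3 where a3: "delay_fun a3" "AE \<theta> in delay_measure. A3 \<theta> = a3 \<theta>"
    by (rule sq_integrable_AE_delay_fun[OF sq(2)])
  have m: "A2 \<in> borel_measurable delay_measure" "A3 \<in> borel_measurable delay_measure"
    using sq by (simp_all add: sq_integrable_def)
  have transposed: "(\<lambda>\<theta>. transpose (A \<theta>)) \<in> borel_measurable delay_measure"
    "AE \<theta> in delay_measure. transpose (A \<theta>) = transpose (a \<theta>)"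
    if "A \<in> borel_measurable delay_measure" "AE \<theta> in delay_measure. A \<theta> = a \<theta>" for A a :: "real \<Rightarrow> real ^ 'n ^ 'n"
    using borel_measurable_continuous_on[OF linear_continuous_on[OF bounded_linear_transpose, of UNIV] that(1)] that(2)
    by (auto elim: eventually_mono)
  define A0 where "A0 = (LINT \<theta>|lborel. a3 \<theta>)"
  define k where "k = reduced_kernel a2 a3"
  have k: "delay_fun k" unfolding k_def by (rule delay_fun_reduced_kernel[OF a2(1) a3(1)])
  interpret P: neutral_semigroup A1 A0 k "neutral_op A2 A3" S
    unfolding A0_def k_def by (rule neutral_semigroupI[OF a2 m(1) a3 m(2) assms(4)])
  have "neutral_semigroup (transpose A1) (LINT \<theta>|lborel. transpose (a3 \<theta>))
      (reduced_kernel (\<lambda>\<theta>. transpose (a2 \<theta>)) (\<lambda>\<theta>. transpose (a3 \<theta>)))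
      (neutral_op (\<lambda>\<theta>. transpose (A2 \<theta>)) (\<lambda>\<theta>. transpose (A3 \<theta>))) Sd"
    by (rule neutral_semigroupI[OF delay_fun_transpose[OF a2(1)] transposed(2,1)[OF m(1) a2(2)]
          delay_fun_transpose[OF a3(1)] transposed(2,1)[OF m(2) a3(2)] assms(5)])
  then interpret D: neutral_semigroup "transpose A1" "transpose A0" "\<lambda>\<theta>. transpose (k \<theta>)"
      "neutral_op (\<lambda>\<theta>. transpose (A2 \<theta>)) (\<lambda>\<theta>. transpose (A3 \<theta>))" Sd
    unfolding A0_def k_def reduced_kernel_transpose[OF a3(1)]
      integral_bounded_linear[OF bounded_linear_transpose delay_fun_integrable(1)[OF a3(1)]] .
  interpret dual_semigroups "state A1" "velocity A0 k" "neutral_op A2 A3" S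
    "state (transpose A1)" "velocity (transpose A0) (\<lambda>\<theta>. transpose (k \<theta>))"
    "neutral_op (\<lambda>\<theta>. transpose (A2 \<theta>)) (\<lambda>\<theta>. transpose (A3 \<theta>))" Sd
    "pairing k" "pairing (\<lambda>\<theta>. transpose (k \<theta>))" "\<lambda>X. C *v fst X" "\<lambda>u. (transpose C *v u, 0)" T
  proof (intro dual_semigroups.intro dual_semigroups_axioms.intro P.parametrised_semigroup_axioms
      D.parametrised_semigroup_axioms)
    show "bounded_linear (\<lambda>X :: 'n M2. C *v fst X)"
      by (rule bounded_linear_compose[OF mv.bounded_linear_right bounded_linear_fst])
    show "bounded_linear (\<lambda>u. (transpose C *v u, 0) :: 'n M2)"
      by (rule bounded_linear_Pair[OF mv.bounded_linear_right bounded_linear_zero])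
    show "pairing (\<lambda>\<theta>. transpose (k \<theta>)) (transpose C *v u, 0) X = u \<bullet> (C *v fst X)" for u X
      by (rule pairing_input[OF delay_fun_transpose[OF k]])
  qed (use bounded_bilinear_pairing[OF k] bounded_bilinear_pairing[OF delay_fun_transpose[OF k]]
      pairing_coercive[OF k] pairing_coercive[OF delay_fun_transpose[OF k]] assms(3) in
      \<open>simp_all only: pairing_state[OF k] pairing_velocity[OF k]\<close>)
  obtain K where K: "\<And>X. integral {0..T} (\<lambda>s. (norm (fst (P.orbit s X)))\<^sup>2) \<le> K * (norm (state A1 X))\<^sup>2"
    using P.admissible by blast
  have adm: "energy 0 X \<le> ((norm C)\<^sup>2 * K) * (norm (state A1 X))\<^sup>2" for X
  proof -
    let ?z = "\<lambda>t. (norm (fst (P.orbit t X)))\<^sup>2"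
    have ai: "set_integrable lebesgue {0..T} ?z"
      by (rule absolutely_integrable_continuous_real[OF P.continuous_on_sq_fst_orbit]) simp
    then have i: "integrable (lebesgue_on {0..T}) ?z"
      by (simp add: set_integrable_def integrable_restrict_space)
    have "energy 0 X \<le> (LINT t|lebesgue_on {0..T}. (norm C)\<^sup>2 * ?z t)"
      unfolding energy_def set_lint_lebesgue_on add_0_right
    proof (rule integral_mono)
      show "integrable (lebesgue_on {0..T}) (\<lambda>t. (norm (C *v fst (P.orbit t X)))\<^sup>2)"
        using sq_integrable_output[of 0 X] by (simp add: sq_integrable_def)
      show "integrable (lebesgue_on {0..T}) (\<lambda>t. (norm C)\<^sup>2 * ?z t)" using i by simp
      show "(norm (C *v fst (P.orbit t X)))\<^sup>2 \<le> (norm C)\<^sup>2 * ?z t" for t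
        using power_mono[OF norm_matrix_vector_le norm_ge_zero, of C "fst (P.orbit t X)" 2]
        by (simp add: power_mult_distrib)
    qed
    also have "\<dots> = (norm C)\<^sup>2 * integral {0..T} ?z"
      using set_lebesgue_integral_eq_integral(2)[OF ai] by (simp add: set_lint_lebesgue_on)
    also have "\<dots> \<le> (norm C)\<^sup>2 * (K * (norm (state A1 X))\<^sup>2)" by (intro mult_left_mono K) simp
    finally show ?thesis by (simp add: mult.assoc)
  qed
  \<comment> \<open>Coordinates at time s carry z(s - 1): C z(t - 1) is the shift 0 and C z(t) the
    shift 1.\<close>
  have out: "output_at C (-1) (S t (state A1 X)) = C *v fst (P.orbit (t + 0) X)"
    "output_at C 0 (S t (state A1 X)) = C *v fst (P.orbit (t + 1) X)" if "t \<in> {0..T}" for t X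
    using that P.profile_orbit[of t 0 X]
    by (simp_all add: output_at_def case_prod_beta P.E_orbit[symmetric] pointval_state)
  have obs: "exactly_observable (range (state A1)) (output_at C (-1)) S T \<longleftrightarrow>
      (\<exists>\<delta>>0. \<forall>X. energy 0 X \<ge> \<delta>\<^sup>2 * (norm (state A1 X))\<^sup>2)"
    "exactly_observable (range (state A1)) (output_at C 0) S T \<longleftrightarrow>
      (\<exists>\<delta>>0. \<forall>X. energy 1 X \<ge> \<delta>\<^sup>2 * (norm (state A1 X))\<^sup>2)"
    by (rule exactly_observable_iff_energy, simp, erule out)+
  have "exactly_observable (neutral_dom A1) (output_at C (-1)) S T \<longleftrightarrow>
      exactly_controllable (neutral_dom (transpose A1)) (\<lambda>u. (transpose C *v u, 0)) Sd T"
    unfolding range_state[symmetric] exactly_controllable_iff obs(1)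
    by (rule observable_iff_controllable[OF adm])
  moreover have "exactly_observable (neutral_dom A1) (output_at C 0) S T \<longleftrightarrow>
      exactly_controllable (neutral_dom (transpose A1)) (\<lambda>u. (transpose C *v u, 0)) Sd T" if det: "det A1 \<noteq> 0"
  proof -
    obtain K1 where K1: "\<And>x. norm x \<le> K1 * norm (S 1 x)" using P.S_1_bounded_below[OF det] by blast
    \<comment> \<open>The determinant is invariant under transposition, so the backward estimate
      holds for the transposed system too and yields injectivity of \<open>Sd 1\<close>.\<close>
    obtain K2 where K2: "\<And>x. norm x \<le> K2 * norm (Sd 1 x)" using D.S_1_bounded_below det by (auto simp: det_transpose)
    have "inj (Sd 1)"
    proof (rule linear_injective_0[THEN iffD2], rule bounded_linear.linear[OF D.S_linear], simp, intro allI impI)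
      fix x assume "Sd 1 x = 0"
      then show "x = 0" using K2[of x] by simp
    qed
    then show ?thesis
      unfolding range_state[symmetric] exactly_controllable_iff obs(2)
      by (intro observable_shift_iff_controllable[OF adm zero_le_one K1])
  qed
  ultimately show ?thesis by blast
qed

end
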